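(* Let $\gamma$ be a closed rectifiable curve in $\mathbb{C}$, let $D=\{z\in\mathbb{C}\setminus\gamma : \operatorname{Ind}(\gamma,z)\neq 0\}$, and let $f$ be a continuous complex-valued function on $D\cup\gamma$ such that the $\overline{\partial}$-derivative of $f$ in $D$, in the sense of distributions, belongs to $L^2(D)$. Then $$\int_\gamma f(z)\,dz = 2i\int_{D}\overline{\partial} f(z)\,\operatorname{Ind}(\gamma,z)\,dA(z).$$
   Context: A closed rectifiable curve is a continuous complex-valued mapping $\gamma$ of bounded variation defined on the unit circle $\mathbb{T}$ (not assumed injective); the same letter $\gamma$ also denotes the image of $\mathbb{T}$ under the mapping. For $z\notin\gamma$, the index (winding number) is $\operatorname{Ind}(\gamma,z)=\frac{1}{2\pi i}\int_\gamma\frac{dw}{w-z}$. The set $D$ is open, and may be empty (in which case the right-hand side is $0$). $dA$ is planar Lebesgue measure, $\overline{\partial}=\partial/\partial\overline{z}=\frac12\left(\frac{\partial}{\partial x}+i\frac{\partial}{\partial y}\right)$ is the Cauchy-Riemann operator, and in the formula $\overline{\partial} f$ denotes the $L^2(D)$ function representing the distributional derivative. The function $\operatorname{Ind}(\gamma,\cdot)$ is defined off $\gamma$, hence almost everywhere, and belongs to $L^2(\mathbb{C})$, so the right-hand integral is absolutely convergent. *)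

theory Defs
  imports "HOL-Analysis.Analysis"
begin

section \<open>Closed rectifiable curves\<close>

definition bounded_variation_on :: "(real \<Rightarrow> complex) \<Rightarrow> real \<Rightarrow> real \<Rightarrow> bool" where
  "bounded_variation_on g a b \<longleftrightarrow>
     (\<exists>B. \<forall>d. d division_of {a..b} \<longrightarrow> (\<Sum>k\<in>d. norm (g (Sup k) - g (Inf k))) \<le> B)"

text \<open>A curve is a map on the unit circle; it is traversed counterclockwise by the parameter
  \<open>t \<in> {0..1}\<close>.\<close>

definition circle_param :: "(complex \<Rightarrow> complex) \<Rightarrow> real \<Rightarrow> complex" where
  "circle_param \<gamma> t = \<gamma> (cis (2 * pi * t))"

definition closed_rectifiable_curve :: "(complex \<Rightarrow> complex) \<Rightarrow> bool" where
  "closed_rectifiable_curve \<gamma> \<longleftrightarrow>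
     continuous_on (sphere 0 1) \<gamma> \<and> bounded_variation_on (circle_param \<gamma>) 0 1"

definition curve_image :: "(complex \<Rightarrow> complex) \<Rightarrow> complex set" where
  "curve_image \<gamma> = \<gamma> ` sphere 0 1"


section \<open>Riemann--Stieltjes integration along a curve\<close>

text \<open>The classical Riemann--Stieltjes integral of \<open>h\<close> against \<open>g\<close>: the gauges are constant, so
  the limit is taken as the mesh of the tagged division tends to zero.\<close>

definition has_RS_integral ::
    "(real \<Rightarrow> complex) \<Rightarrow> (real \<Rightarrow> complex) \<Rightarrow> real \<Rightarrow> real \<Rightarrow> complex \<Rightarrow> bool" where
  "has_RS_integral h g a b I \<longleftrightarrow>
     (\<forall>e>0. \<exists>\<delta>>0. \<forall>p. p tagged_division_of {a..b} \<and> (\<lambda>x. ball x \<delta>) fine p \<longrightarrow>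
        norm ((\<Sum>(x, k)\<in>p. h x * (g (Sup k) - g (Inf k))) - I) < e)"

definition has_curve_integral ::
    "(complex \<Rightarrow> complex) \<Rightarrow> complex \<Rightarrow> (complex \<Rightarrow> complex) \<Rightarrow> bool"
    (infixr \<open>has'_curve'_integral\<close> 50) where
  "(f has_curve_integral I) \<gamma> \<longleftrightarrow>
     has_RS_integral (\<lambda>t. f (circle_param \<gamma> t)) (circle_param \<gamma>) 0 1 I"

definition curve_integrable_on ::
    "(complex \<Rightarrow> complex) \<Rightarrow> (complex \<Rightarrow> complex) \<Rightarrow> bool"
    (infixl \<open>curve'_integrable'_on\<close> 50) where
  "f curve_integrable_on \<gamma> \<longleftrightarrow> (\<exists>I. (f has_curve_integral I) \<gamma>)"

definition curve_integral :: "(complex \<Rightarrow> complex) \<Rightarrow> (complex \<Rightarrow> complex) \<Rightarrow> complex" where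
  "curve_integral \<gamma> f = (THE I. (f has_curve_integral I) \<gamma>)"

definition curve_index :: "(complex \<Rightarrow> complex) \<Rightarrow> complex \<Rightarrow> complex" where
  "curve_index \<gamma> z = 1 / (2 * of_real pi * \<i>) * curve_integral \<gamma> (\<lambda>w. 1 / (w - z))"

definition index_domain :: "(complex \<Rightarrow> complex) \<Rightarrow> complex set" where
  "index_domain \<gamma> = {z. z \<notin> curve_image \<gamma> \<and> curve_index \<gamma> z \<noteq> 0}"


section \<open>The Cauchy--Riemann operator in the sense of distributions\<close>

text \<open>\<open>differentiable\<close> and \<open>frechet_derivative\<close> are understood over the reals, so the partial
  derivatives with respect to \<open>x\<close> and \<open>y\<close> are the values at the directions \<open>1\<close> and \<open>\<i>\<close>.\<close>

fun C_k :: "nat \<Rightarrow> (complex \<Rightarrow> complex) \<Rightarrow> bool" where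
  "C_k 0 \<phi> \<longleftrightarrow> continuous_on UNIV \<phi>"
| "C_k (Suc k) \<phi> \<longleftrightarrow> (\<forall>z. \<phi> differentiable (at z)) \<and>
     (\<forall>v. C_k k (\<lambda>z. frechet_derivative \<phi> (at z) v))"

definition test_function_on :: "complex set \<Rightarrow> (complex \<Rightarrow> complex) \<Rightarrow> bool" where
  "test_function_on D \<phi> \<longleftrightarrow> (\<forall>k. C_k k \<phi>) \<and>
     compact (closure {z. \<phi> z \<noteq> 0}) \<and> closure {z. \<phi> z \<noteq> 0} \<subseteq> D"

definition dbar :: "(complex \<Rightarrow> complex) \<Rightarrow> complex \<Rightarrow> complex" where
  "dbar \<phi> z = 1 / 2 * (frechet_derivative \<phi> (at z) 1 + \<i> * frechet_derivative \<phi> (at z) \<i>)"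

text \<open>The definition below is meant for open \<open>D\<close> and for \<open>f\<close> and \<open>g\<close> locally integrable on \<open>D\<close>.\<close>

definition has_distributional_dbar_on ::
    "(complex \<Rightarrow> complex) \<Rightarrow> (complex \<Rightarrow> complex) \<Rightarrow> complex set \<Rightarrow> bool" where
  "has_distributional_dbar_on f g D \<longleftrightarrow>
     (\<forall>\<phi>. test_function_on D \<phi> \<longrightarrow>
        (LINT z:D|lebesgue. g z * \<phi> z) = - (LINT z:D|lebesgue. f z * dbar \<phi> z))"

definition in_L2_on :: "(complex \<Rightarrow> complex) \<Rightarrow> complex set \<Rightarrow> bool" where
  "in_L2_on g D \<longleftrightarrow>
     set_borel_measurable lebesgue D g \<and> set_integrable lebesgue D (\<lambda>z. (norm (g z))\<^sup>2)"

end

(*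
Let u be the index of the curve, an integer-valued function locally constant off the curve, and let
L be the length. For an inscribed polygon, counting signed crossings of horizontal rays (and, after
a rotation, of vertical rays) expresses the index as a sum over edges. This gives the Green formula
for C^1 functions F, the isoperimetric bound |u|_2 <= L, and, since truncation is 1-Lipschitz, the
bound |int dbar F * T_N u| <= L * sup |F| for every truncation level N. All of this passes to the
limit curve.

For fixed N, the function T_N u multiplied by a cutoff at distance e from the curve is a test
function on D, and its gradient has L^1 norm at most C_N since the e-neighbourhood of the curve has
area O(e). Hence |int g * T_N u - int dbar F * T_N u| <= C_N * sup |F - f|. The constant C_N is not
uniform in N, but replacing F by better and better approximations of f and using the truncated bound
for the difference, it improves to L. Then N tends to infinity, and finally F tends to f.
*)
theory Submission
  imports Defs "HOL-Complex_Analysis.Complex_Analysis"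
begin

text \<open>The index carries the argument instead: it behaves like a function of bounded variation
  whose gradient has mass at most a multiple of the length. Integrals of a derivative against it are
  estimated by moving difference quotients onto the index, and truncation does not increase these
  differences. Truncation is forced by the cutoff: the gradient of the cutoff product has size of
  order N / e on a set of area of order e, and the index itself is known only to be square
  integrable. The constant \<open>C_N\<close> so obtained grows with N, so letting F tend to f and
  then N to infinity would fail. If F is within k of f and G is within d, the error for F is at most
  \<open>d * C_N + (d + k) * L\<close>. With N fixed, d tends to 0 and leaves \<open>k * L\<close>,
  which survives both limits.\<close>

section \<open>Smooth bump functions\<close>

text \<open>The base case asks nothing, so the last derivative need not be continuous;
  \<open>C_k_Re_Im_product\<close> therefore spends one level to reach \<open>C_k k\<close>.\<close>

fun D_k :: "nat \<Rightarrow> (real \<Rightarrow> real) \<Rightarrow> bool" where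
  "D_k 0 f \<longleftrightarrow> True"
| "D_k (Suc k) f \<longleftrightarrow> (\<exists>f'. (\<forall>x. (f has_real_derivative f' x) (at x)) \<and> D_k k f')"

lemma D_k_SucI:
  assumes "\<And>x. (f has_real_derivative f' x) (at x)" "D_k k f'"
  shows "D_k (Suc k) f"
  using assms by (auto intro!: exI[of _ f'])

lemma D_k_Suc: "D_k (Suc k) f \<Longrightarrow> D_k k f"
  by (induction k arbitrary: f) auto

lemma D_k_const: "D_k k (\<lambda>x. c)"
proof (induction k arbitrary: c)
  case (Suc k)
  show ?case using Suc[of 0] by (auto intro!: exI[of _ "\<lambda>x. 0"] derivative_eq_intros)
qed simp

lemma D_k_add: "D_k k f \<Longrightarrow> D_k k g \<Longrightarrow> D_k k (\<lambda>x. f x + g x)"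
proof (induction k arbitrary: f g)
  case (Suc k)
  then obtain f' g' where "\<forall>x. (f has_real_derivative f' x) (at x)" "D_k k f'"
    "\<forall>x. (g has_real_derivative g' x) (at x)" "D_k k g'" by auto
  then show ?case using Suc.IH[of f' g']
    by (auto intro!: exI[of _ "\<lambda>x. f' x + g' x"] derivative_intros)
qed simp

lemma D_k_mult: "D_k k f \<Longrightarrow> D_k k g \<Longrightarrow> D_k k (\<lambda>x. f x * g x)"
proof (induction k arbitrary: f g)
  case (Suc k)
  then obtain f' g' where *: "\<forall>x. (f has_real_derivative f' x) (at x)" "D_k k f'"
    "\<forall>x. (g has_real_derivative g' x) (at x)" "D_k k g'" by auto
  have "((\<lambda>x. f x * g x) has_real_derivative f' x * g x + g' x * f x) (at x)" for x
    using * by (auto intro!: derivative_eq_intros)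
  moreover have "D_k k (\<lambda>x. f' x * g x + g' x * f x)"
    using Suc.IH * Suc.prems by (intro D_k_add Suc.IH) (auto intro: D_k_Suc simp del: D_k.simps)
  ultimately show ?case by (rule D_k_SucI)
qed simp

lemma D_k_affine: "D_k k f \<Longrightarrow> D_k k (\<lambda>x. f (a * x + b))"
proof (induction k arbitrary: f)
  case (Suc k)
  then obtain f' where *: "\<And>x. (f has_real_derivative f' x) (at x)" "D_k k f'" by auto
  have "((\<lambda>x. f (a * x + b)) has_real_derivative a * f' (a * x + b)) (at x)" for x
    by (rule DERIV_cong[OF DERIV_chain2[OF *(1)]]) (auto intro!: derivative_eq_intros)
  moreover have "D_k k (\<lambda>x. a * f' (a * x + b))" using Suc.IH[OF *(2)] by (intro D_k_mult D_k_const)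
  ultimately show ?case by (rule D_k_SucI)
qed simp

lemma D_k_antiderivative:
  assumes "\<And>x. (f has_real_derivative f' x) (at x)" "\<And>k. D_k k f'"
  shows "D_k k f"
  using assms by (cases k) auto

text \<open>The polynomial parameter makes the family closed under differentiation, so that
  smoothness of exp(-1/x), extended by 0, becomes an induction on the order.\<close>

definition flat :: "real poly \<Rightarrow> real \<Rightarrow> real" where
  "flat p x = (if x > 0 then poly p (inverse x) * exp (- inverse x) else 0)"

lemma poly_exp_tendsto_0: "((\<lambda>y. poly p y * exp (- y)) \<longlongrightarrow> (0::real)) at_top"
proof -
  have "((\<lambda>y. \<Sum>i\<le>degree p. coeff p i * (y ^ i / exp y)) \<longlongrightarrow> (\<Sum>i\<le>degree p. coeff p i * 0)) at_top"
    by (intro tendsto_intros tendsto_power_div_exp_0)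
  then show ?thesis by (simp add: poly_altdef sum_distrib_right exp_minus divide_inverse mult.assoc)
qed

text \<open>With y = 1/x the derivative of p(y) exp(-y) is y^2 (p(y) - p'(y)) exp(-y), which
  explains the new polynomial. At 0 the difference quotient from the right is again y p(y) exp(-y),
  and exponential decay wins.\<close>

lemma flat_DERIV: "(flat p has_real_derivative flat ([:0, 0, 1:] * (p - pderiv p)) x) (at x)"
proof -
  consider "x > 0" | "x < 0" | "x = 0" by linarith
  then show ?thesis
  proof cases
    case 1
    have "((\<lambda>x. poly p (inverse x) * exp (- inverse x)) has_real_derivative
        flat ([:0, 0, 1:] * (p - pderiv p)) x) (at x)"
      using 1 by (auto intro!: derivative_eq_intros simp: flat_def field_simps power2_eq_square)
    moreover have "\<forall>\<^sub>F y in nhds x. flat p y = poly p (inverse y) * exp (- inverse y)"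
      using eventually_nhds_in_open[of "{0<..}" x] 1 by (auto elim!: eventually_mono simp: flat_def)
    ultimately show ?thesis by (subst DERIV_cong_ev) (auto)
  next
    case 2
    have "\<forall>\<^sub>F y in nhds x. flat p y = 0"
      using eventually_nhds_in_open[of "{..<0}" x] 2 by (auto elim!: eventually_mono simp: flat_def)
    then have "(flat p has_real_derivative 0) (at x)" by (subst DERIV_cong_ev) auto
    then show ?thesis using 2 by (simp add: flat_def)
  next
    case 3
    have "((\<lambda>h. flat p h / h) \<longlongrightarrow> 0) (at 0)"
      unfolding filterlim_at_split
    proof
      show "((\<lambda>h. flat p h / h) \<longlongrightarrow> 0) (at_left 0)"
        by (rule Lim_transform_eventually[OF tendsto_const])
          (auto simp: eventually_at_left_field flat_def intro!: exI[of _ "-1"])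
      have "((\<lambda>h. poly ([:0, 1:] * p) (inverse h) * exp (- inverse h)) \<longlongrightarrow> 0) (at_right (0::real))"
        using poly_exp_tendsto_0[of "[:0, 1:] * p"] filterlim_inverse_at_top_right
        by (rule filterlim_compose)
      then show "((\<lambda>h. flat p h / h) \<longlongrightarrow> 0) (at_right 0)"
        by (rule Lim_transform_eventually)
          (auto simp: eventually_at_right_field flat_def field_simps intro!: exI[of _ "1"])
    qed
    then show ?thesis using 3 by (simp add: has_field_derivative_iff flat_def)
  qed
qed

lemma flat_D_k: "D_k k (flat p)"
proof (induction k arbitrary: p)
  case (Suc k)
  then show ?case using flat_DERIV by auto
qed simp

definition bump01 :: "real \<Rightarrow> real" where
  "bump01 x = flat 1 x * flat 1 (1 - x)"

lemma bump01_D_k: "D_k k bump01"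
  using D_k_mult[OF flat_D_k[of k 1] D_k_affine[OF flat_D_k[of k 1], of "-1" 1]]
  by (simp add: bump01_def[abs_def])

lemma bump01_pos: "0 < x \<Longrightarrow> x < 1 \<Longrightarrow> bump01 x > 0"
  and bump01_nonneg: "bump01 x \<ge> 0"
  and bump01_zero: "x \<le> 0 \<or> 1 \<le> x \<Longrightarrow> bump01 x = 0"
  by (auto simp: bump01_def flat_def)

lemma bump01_continuous: "continuous_on S bump01"
proof -
  obtain f' where "\<And>x. (bump01 has_real_derivative f' x) (at x)" using bump01_D_k[of 1] by auto
  then show ?thesis by (meson DERIV_isCont continuous_at_imp_continuous_on)
qed

lemma sum_int_telescope:
  fixes f :: "int \<Rightarrow> 'a::ab_group_add"
  shows "(\<Sum>j\<in>{a..a + int n}. f j - f (j + 1)) = f a - f (a + int n + 1)"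
proof (induction n)
  case (Suc n)
  have "{a..a + int (Suc n)} = insert (a + int n + 1) {a..a + int n}" by auto
  then show ?case using Suc by (simp add: algebra_simps)
qed simp

text \<open>The integral of \<^const>\<open>bump01\<close> yields a smooth step, and the difference of two translates of
  a step is a bump whose integer translates telescope to \<open>1\<close>.\<close>

lemma partition_bump_exists:
  "\<exists>\<beta> \<beta>' :: real \<Rightarrow> real. (\<forall>k. D_k k \<beta>) \<and> (\<forall>x. (\<beta> has_real_derivative \<beta>' x) (at x)) \<and>
    (\<forall>x. 0 \<le> \<beta> x) \<and> (\<forall>x. x \<notin> {0<..<2} \<longrightarrow> \<beta> x = 0 \<and> \<beta>' x = 0) \<and>
    (\<forall>(M::nat) (x::real). \<bar>x\<bar> \<le> real M \<longrightarrow> (\<Sum>j\<in>{-int M - 1..int M}. \<beta> (x - of_int j)) = 1)"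
proof -
  \<comment> \<open>Starting the primitive at -1 leaves room to differentiate it on both sides of 0;
    \<open>bump01\<close> vanishes in between.\<close>
  define s where "s x = integral {-1..x} bump01" for x
  have s_deriv: "(s has_real_derivative bump01 x) (at x)" if "x > -1" for x
  proof -
    have "((\<lambda>u. integral {-1..u} bump01) has_real_derivative bump01 x) (at x within {-1..x+1})"
      using that by (intro integral_has_real_derivative bump01_continuous) auto
    then have "(s has_real_derivative bump01 x) (at x within {-1<..<x+1})"
      unfolding s_def[abs_def] by (rule DERIV_subset) auto
    then show ?thesis using that by (subst (asm) at_within_open) auto
  qed
  have s0: "s x = 0" if "x \<le> 0" for x
  proof -
    have "integral {-1..x} bump01 = integral {-1..x} (\<lambda>x. 0)"
      by (rule integral_cong) (use that in \<open>auto simp: bump01_zero\<close>)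
    then show ?thesis by (simp add: s_def)
  qed
  have s_cont: "continuous_on {0..x} s" for x
    using s_deriv by (intro DERIV_continuous_on[of _ _ bump01]) (auto intro: has_field_derivative_at_within)
  have s1: "s x = s 1" if "x \<ge> 1" for x
  proof (cases "x = 1")
    case False
    show ?thesis
    proof (rule DERIV_isconst_end[of 1 x s])
      show "1 < x" using that False by simp
      show "continuous_on {1..x} s" by (rule continuous_on_subset[OF s_cont[of x]]) auto
      show "(s has_real_derivative 0) (at y)" if "1 < y" "y < x" for y
        using s_deriv[of y] that by (simp add: bump01_zero)
    qed
  qed simp
  have s_mono: "s x \<le> s y" if "x \<le> y" for x y
    unfolding s_def using that
    by (intro integral_subset_le integrable_continuous_real bump01_continuous) (auto simp: bump01_nonneg)
  have s_pos: "s 1 > 0"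
  proof -
    have "s 0 < s 1"
    proof (rule DERIV_pos_imp_increasing_open[of 0 1 s])
      show "\<exists>y. (s has_real_derivative y) (at x) \<and> 0 < y" if "0 < x" "x < 1" for x
        using s_deriv[of x] bump01_pos[of x] that by auto
    qed (auto intro: s_cont)
    then show ?thesis by (simp add: s0)
  qed
  define \<sigma> where "\<sigma> x = (1 / s 1) * s x" for x
  have \<sigma>_deriv: "(\<sigma> has_real_derivative (1 / s 1) * bump01 x) (at x)" for x
  proof (cases "x > -1")
    case True
    then show ?thesis unfolding \<sigma>_def[abs_def] by (intro DERIV_cmult s_deriv)
  next
    case False
    have "\<forall>\<^sub>F y in nhds x. \<sigma> y = 0"
      using eventually_nhds_in_open[of "{..<0}" x] False by (auto elim!: eventually_mono simp: \<sigma>_def s0)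
    then have "(\<sigma> has_real_derivative 0) (at x)" by (subst DERIV_cong_ev) auto
    then show ?thesis using False by (simp add: bump01_zero)
  qed
  have \<sigma>_D_k: "D_k k \<sigma>" for k
    by (rule D_k_antiderivative[OF \<sigma>_deriv]) (intro D_k_mult D_k_const bump01_D_k)
  have \<sigma>01: "x \<le> 0 \<Longrightarrow> \<sigma> x = 0" "x \<ge> 1 \<Longrightarrow> \<sigma> x = 1" for x
    using s0[of x] s1[of x] s_pos by (auto simp: \<sigma>_def)
  have \<sigma>_mono: "x \<le> y \<Longrightarrow> \<sigma> x \<le> \<sigma> y" for x y
    using s_mono[of x y] s_pos by (simp add: \<sigma>_def divide_right_mono)
  \<comment> \<open>The step minus its translate by 1, spelled so that \<open>D_k_add\<close>,
    \<open>D_k_mult\<close> and \<open>D_k_affine\<close> match.\<close>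
  define \<beta> where "\<beta> x = \<sigma> x + (-1) * \<sigma> (1 * x + (-1))" for x
  define \<beta>' where "\<beta>' x = (1 / s 1) * bump01 x - (1 / s 1) * bump01 (x - 1)" for x
  have "D_k k \<beta>" for k
    unfolding \<beta>_def[abs_def] by (intro D_k_add D_k_mult D_k_const D_k_affine \<sigma>_D_k)
  moreover have "(\<beta> has_real_derivative \<beta>' x) (at x)" for x
    unfolding \<beta>_def[abs_def] \<beta>'_def
    by (rule derivative_eq_intros DERIV_chain2[OF \<sigma>_deriv] \<sigma>_deriv refl)+ simp
  moreover have "0 \<le> \<beta> x" for x using \<sigma>_mono[of "x - 1" x] by (simp add: \<beta>_def)
  moreover have "\<beta> x = 0 \<and> \<beta>' x = 0" if "x \<notin> {0<..<2}" for x
    using that by (auto simp: \<beta>_def \<beta>'_def \<sigma>01 bump01_zero)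
  moreover have "(\<Sum>j\<in>{-int M - 1..int M}. \<beta> (x - of_int j)) = 1" if "\<bar>x\<bar> \<le> real M" for M :: nat and x :: real
  proof -
    have "(\<Sum>j\<in>{-int M - 1..int M}. \<beta> (x - of_int j)) =
      (\<Sum>j\<in>{-int M - 1..(-int M - 1) + int (2 * M + 1)}. \<sigma> (x - of_int j) - \<sigma> (x - of_int (j + 1)))"
      by (intro sum.cong) (auto simp: \<beta>_def algebra_simps)
    \<comment> \<open>For \<open>\<bar>x\<bar> \<le> real M\<close> the first argument is at least 1
      and the second at most -1, so the ends of the telescope are 1 and 0.\<close>
    also have "\<dots> = \<sigma> (x - of_int (-int M - 1)) - \<sigma> (x - of_int ((-int M - 1) + int (2 * M + 1) + 1))"
      by (rule sum_int_telescope)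
    also have "\<dots> = 1"
      using that by (subst \<sigma>01(2), simp, subst \<sigma>01(1)) auto
    finally show ?thesis .
  qed
  ultimately show ?thesis by (intro exI[of _ \<beta>] exI[of _ \<beta>']) blast
qed

section \<open>Domination of increments by a variation function\<close>

text \<open>Any \<open>v\<close> whose increments dominate those of \<open>g\<close> may serve in
  place of the total variation. Length estimates become telescoping sums of \<open>v\<close>, and
  \<open>v 1 - v 0\<close> stands for the length.\<close>

definition variation_dominated :: "(real \<Rightarrow> complex) \<Rightarrow> (real \<Rightarrow> real) \<Rightarrow> bool" where
  "variation_dominated g v \<longleftrightarrow>
     (\<forall>s t. 0 \<le> s \<longrightarrow> s \<le> t \<longrightarrow> t \<le> 1 \<longrightarrow> norm (g t - g s) \<le> v t - v s)"

lemma variation_dominatedD: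
  "variation_dominated g v \<Longrightarrow> 0 \<le> s \<Longrightarrow> s \<le> t \<Longrightarrow> t \<le> 1 \<Longrightarrow> norm (g t - g s) \<le> v t - v s"
  by (simp add: variation_dominated_def)

lemma variation_dominated_mono:
  assumes "variation_dominated g v" "0 \<le> s" "s \<le> t" "t \<le> 1"
  shows "v s \<le> v t"
  using variation_dominatedD[OF assms] norm_ge_zero[of "g t - g s"] by linarith

text \<open>\<open>v t\<close> is the supremum of the variation sums over divisions of
  \<open>{0..t}\<close>; appending the cell \<open>{s..t}\<close> to a division of
  \<open>{0..s}\<close> gives the increment inequality.\<close>

lemma bounded_variation_imp_dominated:
  assumes "bounded_variation_on g 0 1"
  obtains v where "variation_dominated g v"
proof -
  define w where "w k = norm (g (Sup k) - g (Inf k))" for k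
  obtain B where B: "\<And>d. d division_of {0..1} \<Longrightarrow> (\<Sum>k\<in>d. w k) \<le> B"
    using assms unfolding bounded_variation_on_def w_def by blast
  have extend: "insert {s..t} d division_of {0..t}" if "d division_of {0..s}" "0 \<le> s" "s \<le> t" for d and s t :: real
  proof -
    have "{{s..t}} division_of {s..t}"
      using that by (metis atLeastatMost_empty_iff box_real(2) division_of_self leD)
    from division_disjoint_union[OF that(1) this] that show ?thesis
      by (simp add: ivl_disj_un_two_touch)
  qed
  have w_nonneg: "w k \<ge> 0" for k by (simp add: w_def)
  have bd: "(\<Sum>k\<in>d. w k) \<le> B" if "d division_of {0..s}" "0 \<le> s" "s \<le> 1" for d s
  proof -
    have f: "finite (insert {s..1} d)" using that by auto
    have "(\<Sum>k\<in>d. w k) \<le> (\<Sum>k\<in>insert {s..1} d. w k)"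
      by (rule sum_mono2[OF f]) (auto simp: w_nonneg)
    also have "\<dots> \<le> B" using B extend that by blast
    finally show ?thesis .
  qed
  define V where "V t = {(\<Sum>k\<in>d. w k) | d. d division_of {0..t}}" for t
  have ne: "V t \<noteq> {}" if "0 \<le> t" for t
    using that unfolding V_def by (auto intro!: exI[of _ "{{0..t}}"]) (metis atLeastatMost_empty_iff box_real(2) division_of_self leD)
  have bdd: "bdd_above (V t)" if "0 \<le> t" "t \<le> 1" for t
    using bd that unfolding V_def by (intro bdd_aboveI[of _ B]) auto
  have "norm (g t - g s) \<le> Sup (V t) - Sup (V s)" if st: "0 \<le> s" "s \<le> t" "t \<le> 1" for s t
  proof -
    have "x \<le> Sup (V t) - norm (g t - g s)" if "x \<in> V s" for x
    proof -
      obtain d where d: "d division_of {0..s}" "x = (\<Sum>k\<in>d. w k)"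
        using \<open>x \<in> V s\<close> unfolding V_def by auto
      have "(\<Sum>k\<in>d. w k) + norm (g t - g s) \<le> (\<Sum>k\<in>insert {s..t} d. w k)"
      \<comment> \<open>A cell that is already present must be degenerate; inserting it then changes
        nothing and the increment of \<open>g\<close> is 0.\<close>
      proof (cases "{s..t} \<in> d")
        case True
        then have "{s..t} \<subseteq> {0..s}" using d(1) by blast
        then have "s = t" using st by auto
        then show ?thesis using True by (simp add: insert_absorb)
      next
        case False
        have "w {s..t} = norm (g t - g s)" using st by (simp add: w_def)
        then show ?thesis using False d by (simp add: division_of_finite)
      qed
      also have "\<dots> \<le> Sup (V t)"
        using extend[OF d(1) st(1,2)] bdd[of t] st by (intro cSup_upper) (auto simp: V_def)
      finally show ?thesis using d by simp
    qed
    then have "Sup (V s) \<le> Sup (V t) - norm (g t - g s)"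
      using ne st by (intro cSup_least) auto
    then show ?thesis by simp
  qed
  then show ?thesis by (intro that[of "\<lambda>t. Sup (V t)"]) (simp add: variation_dominated_def)
qed

abbreviation RS_sum ::
    "(real \<Rightarrow> complex) \<Rightarrow> (real \<Rightarrow> complex) \<Rightarrow> (real \<times> real set) set \<Rightarrow> complex" where
  "RS_sum h g p \<equiv> \<Sum>(x, k)\<in>p. h x * (g (Sup k) - g (Inf k))"

section \<open>Existence of the Riemann--Stieltjes integral\<close>

text \<open>Both sums are rewritten over the common refinement, indexed by pairs of cells. On each
  pair the increment of \<open>g\<close> is the same and only the tags differ; the increments of
  \<open>v\<close> add up to \<open>v 1 - v 0\<close>.\<close>

lemma tagged_sum_compare:
  assumes v: "variation_dominated g v"
    and p: "p tagged_division_of {0..1}" and q: "q tagged_division_of {0..1}"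
    and e: "\<And>x k y l. (x, k) \<in> p \<Longrightarrow> (y, l) \<in> q \<Longrightarrow> k \<inter> l \<noteq> {} \<Longrightarrow> norm (h x - h y) \<le> (e::real)"
  shows "norm ((RS_sum h g p) -
    (RS_sum h g q)) \<le> e * (v 1 - v 0)"
proof -
  \<comment> \<open>A set with at most one element: an empty intersection contributes 0 instead of
    values of \<open>Sup\<close> and \<open>Inf\<close> at the empty set.\<close>
  define A where "A k l = {k \<inter> l} - {{}}" for k l :: "real set"
  define G where "G k l = (\<Sum>m\<in>A k l. g (Sup m) - g (Inf m))" for k l
  define W where "W k l = (\<Sum>m\<in>A k l. v (Sup m) - v (Inf m))" for k l
  have fin: "finite p" "finite q" using p q by auto
  have shape: "\<exists>a b. 0 \<le> a \<and> a \<le> b \<and> b \<le> 1 \<and> k = {a..b}" if xk: "(x, k) \<in> r" and r: "r tagged_division_of {0..1}" for x k and r :: "(real \<times> real set) set"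
  proof -
    obtain a b where "k = cbox a b" using tagged_division_ofD(4)[OF r xk] by auto
    moreover have "x \<in> k" "k \<subseteq> {0..1}" using tagged_division_ofD(2,3)[OF r xk] by auto
    ultimately show ?thesis by (intro exI[of _ a] exI[of _ b]) auto
  qed
  have split: "(\<Sum>(y,l)\<in>r. (\<Sum>m\<in>A k l. f (Sup m) - f (Inf m))) = f (Sup k) - f (Inf k)"
    if r: "r tagged_division_of {0..1}" and xk: "(x, k) \<in> r'" and r': "r' tagged_division_of {0..1}"
    for f :: "real \<Rightarrow> 'a::real_normed_vector" and r r' k x
  proof -
    obtain a b where ab: "0 \<le> a" "a \<le> b" "b \<le> 1" "k = {a..b}" using shape[OF xk r'] by blast
    \<comment> \<open>Clamping to \<open>k\<close> turns the sum over the pieces of \<open>k\<close>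
      into a telescoping sum of \<open>f \<circ> c\<close> over the whole division.\<close>
    define c where "c t = max a (min b t)" for t
    have eq: "(\<Sum>m\<in>A k l. f (Sup m) - f (Inf m)) = f (c (Sup l)) - f (c (Inf l))"
      if yl: "(y, l) \<in> r" for y l
    proof -
      obtain s t where st: "0 \<le> s" "s \<le> t" "t \<le> 1" "l = {s..t}"
        using shape[OF yl r] by blast
      show ?thesis
      proof (cases "k \<inter> l = {}")
        case True
        then have "t < a \<or> b < s" using ab st by (auto simp: max_def min_def split: if_splits)
        then show ?thesis using True ab st by (auto simp: A_def c_def)
      next
        case False
        then have *: "max a s \<le> min b t" using ab st by auto
        have "A k l = {{max a s..min b t}}" using False ab st by (auto simp: A_def)
        moreover have "c t = min b t" "c s = max a s" using * ab st by (auto simp: c_def)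
        ultimately show ?thesis using * st by simp
      qed
    qed
    have "(\<Sum>(y,l)\<in>r. (\<Sum>m\<in>A k l. f (Sup m) - f (Inf m))) = (\<Sum>(y,l)\<in>r. f (c (Sup l)) - f (c (Inf l)))"
      by (rule sum.cong) (auto simp: eq)
    also have "\<dots> = f (c 1) - f (c 0)"
      using additive_tagged_division_1[of 0 1 r "f \<circ> c"] r by simp
    also have "\<dots> = f b - f a" using ab by (auto simp: c_def)
    finally show ?thesis using ab by simp
  qed
  have A_comm: "A k l = A l k" for k l by (simp add: A_def Int_commute)
  have p_sum: "(\<Sum>(x,k)\<in>p. h x * (g (Sup k) - g (Inf k))) = (\<Sum>(x,k)\<in>p. \<Sum>(y,l)\<in>q. h x * G k l)"
  proof (rule sum.cong[OF refl], clarify)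
    fix x k assume "(x, k) \<in> p"
    then show "h x * (g (Sup k) - g (Inf k)) = (\<Sum>(y,l)\<in>q. h x * G k l)"
      using split[OF q _ p, of x k g]
      by (simp add: G_def[symmetric] case_prod_unfold flip: sum_distrib_left)
  qed
  have q_sum: "(\<Sum>(x,k)\<in>q. h x * (g (Sup k) - g (Inf k))) = (\<Sum>(x,k)\<in>p. \<Sum>(y,l)\<in>q. h y * G k l)"
  proof -
    have "(\<Sum>(x,k)\<in>q. h x * (g (Sup k) - g (Inf k))) = (\<Sum>(y,l)\<in>q. \<Sum>(x,k)\<in>p. h y * G k l)"
    proof (rule sum.cong[OF refl], clarify)
      fix x k assume "(x, k) \<in> q"
      then show "h x * (g (Sup k) - g (Inf k)) = (\<Sum>(y,l)\<in>p. h x * G l k)"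
        using split[OF p _ q, of x k g]
        by (simp add: G_def[symmetric] A_comm[of k] case_prod_unfold flip: sum_distrib_left)
    qed
    also have "\<dots> = (\<Sum>(x,k)\<in>p. \<Sum>(y,l)\<in>q. h y * G k l)"
      by (simp add: case_prod_unfold, rule sum.swap)
    finally show ?thesis .
  qed
  have pw: "norm (h x * G k l - h y * G k l) \<le> e * W k l" if xk: "(x, k) \<in> p" and yl: "(y, l) \<in> q" for x k y l
  proof (cases "k \<inter> l = {}")
    case True
    then show ?thesis by (simp add: G_def W_def A_def)
  next
    case False
    obtain a b where ab: "0 \<le> a" "a \<le> b" "b \<le> 1" "k = {a..b}" using shape[OF xk p] by blast
    obtain s t where st: "0 \<le> s" "s \<le> t" "t \<le> 1" "l = {s..t}" using shape[OF yl q] by blast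
    have *: "max a s \<le> min b t" using False ab st by auto
    have "A k l = {{max a s..min b t}}" using False ab st by (auto simp: A_def)
    then have GW: "norm (G k l) \<le> W k l"
      using variation_dominatedD[OF v, of "max a s" "min b t"] * ab st by (simp add: G_def W_def)
    have "norm (h x * G k l - h y * G k l) = norm (h x - h y) * norm (G k l)"
      by (simp add: norm_mult flip: left_diff_distrib)
    also have "\<dots> \<le> e * W k l"
      using e[OF xk yl False] GW by (intro mult_mono order_trans[OF norm_ge_zero e[OF xk yl False]]) auto
    finally show ?thesis .
  qed
  have "norm (RS_sum h g p - (RS_sum h g q))
    = norm (\<Sum>(x,k)\<in>p. \<Sum>(y,l)\<in>q. (h x * G k l - h y * G k l))"
    unfolding p_sum q_sum by (simp add: case_prod_unfold sum_subtractf)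
  also have "\<dots> \<le> (\<Sum>(x,k)\<in>p. \<Sum>(y,l)\<in>q. e * W k l)"
    unfolding case_prod_unfold by (intro sum_norm_le) (auto intro: pw)
  also have "\<dots> = e * (\<Sum>(x,k)\<in>p. \<Sum>(y,l)\<in>q. W k l)"
    by (simp add: case_prod_unfold sum_distrib_left)
  also have "(\<Sum>(x,k)\<in>p. \<Sum>(y,l)\<in>q. W k l) = (\<Sum>(x,k)\<in>p. v (Sup k) - v (Inf k))"
    by (rule sum.cong[OF refl]) (auto simp: W_def split[OF q _ p])
  also have "\<dots> = v 1 - v 0"
    using additive_tagged_division_1[of 0 1 p v] p by simp
  finally show ?thesis .
qed

definition fine_tagged :: "real \<Rightarrow> (real \<times> real set) set \<Rightarrow> bool" where
  "fine_tagged \<delta> p \<longleftrightarrow> p tagged_division_of {0..1} \<and> (\<lambda>x. ball x \<delta>) fine p"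

lemma fine_tagged_exists: "\<delta> > 0 \<Longrightarrow> \<exists>p. fine_tagged \<delta> p"
  using fine_division_exists_real[OF gauge_ball, of \<delta> 0 1] unfolding fine_tagged_def by metis

lemma fine_tagged_mono: "fine_tagged \<delta> p \<Longrightarrow> \<delta> \<le> \<delta>' \<Longrightarrow> fine_tagged \<delta>' p"
  unfolding fine_tagged_def fine_def using subset_ball by blast

lemma has_RS_integral_alt:
  "has_RS_integral h g 0 1 I \<longleftrightarrow> (\<forall>e>0. \<exists>\<delta>>0. \<forall>p. fine_tagged \<delta> p \<longrightarrow>
     norm (RS_sum h g p - I) < e)"
  by (simp add: has_RS_integral_def fine_tagged_def)

lemma has_RS_integral_unique:
  assumes "has_RS_integral h g 0 1 I" "has_RS_integral h g 0 1 J"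
  shows "I = J"
proof (rule ccontr)
  assume "I \<noteq> J"
  then have e: "norm (I - J) / 2 > 0" by simp
  obtain d1 where d1: "d1 > 0" "\<And>p. fine_tagged d1 p \<Longrightarrow>
     norm (RS_sum h g p - I) < norm (I - J) / 2"
    using assms(1) e unfolding has_RS_integral_alt by blast
  obtain d2 where d2: "d2 > 0" "\<And>p. fine_tagged d2 p \<Longrightarrow>
     norm (RS_sum h g p - J) < norm (I - J) / 2"
    using assms(2) e unfolding has_RS_integral_alt by blast
  obtain p where p: "fine_tagged (min d1 d2) p" using fine_tagged_exists d1 d2 by (meson min_less_iff_conj)
  then have "fine_tagged d1 p" "fine_tagged d2 p" by (auto elim: fine_tagged_mono)
  from d1(2)[OF this(1)] d2(2)[OF this(2)] show False
    using norm_triangle_ineq4[of "(RS_sum h g p) - J" "(RS_sum h g p) - I"] by simp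
qed

lemma fine_tagged_compare:
  assumes v: "variation_dominated g v" and h: "continuous_on {0..1} h" and e: "e > 0"
  obtains \<delta> where "\<delta> > 0" "\<And>p q. fine_tagged \<delta> p \<Longrightarrow> fine_tagged \<delta> q \<Longrightarrow>
     norm (RS_sum h g p - (RS_sum h g q)) < e"
proof -
  define L where "L = v 1 - v 0"
  have L: "L \<ge> 0" using variation_dominated_mono[OF v, of 0 1] by (simp add: L_def)
  have uc: "uniformly_continuous_on {0..1} h" using h by (intro compact_uniformly_continuous) auto
  define e' where "e' = e / (L + 1)"
  have e': "e' > 0" "e' * L < e" using e L by (auto simp: e'_def field_simps)
  obtain \<delta> where \<delta>: "\<delta> > 0" "\<And>x y. x \<in> {0..1} \<Longrightarrow> y \<in> {0..1} \<Longrightarrow> dist x y < \<delta> \<Longrightarrow> dist (h x) (h y) < e'"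
    using uc e'(1) unfolding uniformly_continuous_on_def by (metis dist_commute)
  show thesis
  \<comment> \<open>Tags of two overlapping cells are within \<open>\<delta>/2\<close> of a common
    point, hence within \<open>\<delta>\<close> of each other.\<close>
  proof (rule that[of "\<delta>/2"])
    show "\<delta>/2 > 0" using \<delta> by simp
    fix p q assume pq: "fine_tagged (\<delta>/2) p" "fine_tagged (\<delta>/2) q"
    have p: "p tagged_division_of {0..1}" "(\<lambda>x. ball x (\<delta>/2)) fine p" and
      q: "q tagged_division_of {0..1}" "(\<lambda>x. ball x (\<delta>/2)) fine q"
      using pq by (auto simp: fine_tagged_def)
    have close: "norm (h x - h y) \<le> e'" if xk: "(x, k) \<in> p" and yl: "(y, l) \<in> q" and "k \<inter> l \<noteq> {}" for x k y l
    proof -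
      obtain z where "z \<in> k" "z \<in> l" using \<open>k \<inter> l \<noteq> {}\<close> by blast
      then have "dist x z < \<delta>/2" "dist y z < \<delta>/2" using fineD[OF p(2) xk] fineD[OF q(2) yl] by auto
      then have "dist x y < \<delta>" by (metis dist_triangle_half_l dist_commute)
      moreover have "x \<in> {0..1}" "y \<in> {0..1}"
        using tagged_division_ofD(2,3)[OF p(1) xk] tagged_division_ofD(2,3)[OF q(1) yl] by auto
      ultimately show ?thesis using \<delta>(2)[of x y] by (simp add: dist_norm)
    qed
    have "norm (RS_sum h g p - (RS_sum h g q)) \<le> e' * (v 1 - v 0)"
      by (rule tagged_sum_compare[OF v p(1) q(1)]) (rule close)
    with e'(2) show "norm (RS_sum h g p - (RS_sum h g q)) < e"
      by (simp add: L_def)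
  qed
qed

text \<open>Completeness: sums along one sequence of divisions with mesh tending to 0 are Cauchy,
  and \<open>fine_tagged_compare\<close> ties every other fine division to their limit.\<close>

lemma has_RS_integral_exists:
  assumes v: "variation_dominated g v" and h: "continuous_on {0..1} h"
  shows "\<exists>I. has_RS_integral h g 0 1 I"
proof -
  define S where "S p = (RS_sum h g p)" for p
  define p where "p n = (SOME p. fine_tagged (inverse (real (Suc n))) p)" for n
  have p: "fine_tagged (inverse (real (Suc n))) (p n)" for n
    unfolding p_def by (rule someI_ex) (simp add: fine_tagged_exists)
  have p_fine: "\<exists>N. \<forall>n\<ge>N. fine_tagged \<delta> (p n)" if "\<delta> > 0" for \<delta>
  proof -
    obtain N where N: "inverse (real (Suc N)) < \<delta>" using reals_Archimedean[OF \<open>\<delta> > 0\<close>] by blast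
    have "inverse (real (Suc n)) \<le> \<delta>" if "n \<ge> N" for n
    proof -
      have "inverse (real (Suc n)) \<le> inverse (real (Suc N))" using that by (intro le_imp_inverse_le) auto
      then show ?thesis using N by linarith
    qed
    then show ?thesis using p fine_tagged_mono by blast
  qed
  have "Cauchy (\<lambda>n. S (p n))"
  proof (rule metric_CauchyI)
    fix e :: real assume "e > 0"
    obtain \<delta> where \<delta>: "\<delta> > 0" "\<And>p q. fine_tagged \<delta> p \<Longrightarrow> fine_tagged \<delta> q \<Longrightarrow> norm (S p - S q) < e"
      unfolding S_def using fine_tagged_compare[OF v h \<open>e > 0\<close>] by blast
    then show "\<exists>M. \<forall>m\<ge>M. \<forall>n\<ge>M. dist (S (p m)) (S (p n)) < e"
      using p_fine[OF \<delta>(1)] by (metis dist_norm)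
  qed
  then have "convergent (\<lambda>n. S (p n))" by (rule Cauchy_convergent)
  then obtain I where I: "(\<lambda>n. S (p n)) \<longlonglongrightarrow> I" unfolding convergent_def by (rule exE)
  have "has_RS_integral h g 0 1 I"
    unfolding has_RS_integral_alt S_def[symmetric]
  proof (intro allI impI)
    fix e :: real assume "e > 0"
    obtain \<delta> where \<delta>: "\<delta> > 0" "\<And>p q. fine_tagged \<delta> p \<Longrightarrow> fine_tagged \<delta> q \<Longrightarrow> norm (S p - S q) < e/2"
      unfolding S_def using fine_tagged_compare[OF v h half_gt_zero[OF \<open>e > 0\<close>]] by blast
    obtain N where N: "\<forall>n\<ge>N. fine_tagged \<delta> (p n)" using p_fine[OF \<delta>(1)] by blast
    have "norm (S q - I) \<le> e/2" if q: "fine_tagged \<delta> q" for q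
    proof (rule tendsto_upperbound[OF tendsto_norm[OF tendsto_diff[OF tendsto_const I]]])
      show "\<forall>\<^sub>F n in sequentially. norm (S q - S (p n)) \<le> e/2"
        using \<delta>(2)[OF q] N by (auto simp: eventually_sequentially intro!: exI[of _ N] less_imp_le)
    qed simp
    then show "\<exists>\<delta>>0. \<forall>p. fine_tagged \<delta> p \<longrightarrow> norm (S p - I) < e"
      using \<delta>(1) \<open>e > 0\<close> by (intro exI[of _ \<delta>]) fastforce
  qed
  then show ?thesis by blast
qed

lemma has_RS_integral_bound:
  assumes I: "has_RS_integral h g 0 1 I" and v: "variation_dominated g v"
    and h: "\<And>x. x \<in> {0..1} \<Longrightarrow> norm (h x) \<le> C"
  shows "norm I \<le> C * (v 1 - v 0)"
proof (rule field_le_epsilon)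
  fix e :: real assume "e > 0"
  obtain \<delta> where \<delta>: "\<delta> > 0" "\<And>p. fine_tagged \<delta> p \<Longrightarrow> norm (RS_sum h g p - I) < e"
    using I \<open>e > 0\<close> unfolding has_RS_integral_alt by blast
  obtain p where p: "fine_tagged \<delta> p" using fine_tagged_exists \<delta> by blast
  then have pt: "p tagged_division_of {0..1}" by (simp add: fine_tagged_def)
  have "norm (RS_sum h g p) \<le> (\<Sum>(x, k)\<in>p. C * (v (Sup k) - v (Inf k)))"
  proof (rule sum_norm_le, clarify)
    fix x k assume xk: "(x, k) \<in> p"
    obtain a b where "k = cbox a b" using tagged_division_ofD(4)[OF pt xk] by blast
    moreover have x: "x \<in> k" "k \<subseteq> {0..1}" using tagged_division_ofD(2,3)[OF pt xk] by auto
    ultimately have ab: "0 \<le> a" "a \<le> b" "b \<le> 1" "k = {a..b}" by auto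
    have "norm (h x) \<le> C" using h x by auto
    moreover have "0 \<le> C" using calculation norm_ge_zero[of "h x"] by linarith
    ultimately show "norm (h x * (g (Sup k) - g (Inf k))) \<le> C * (v (Sup k) - v (Inf k))"
      using variation_dominatedD[OF v ab(1-3)] ab
      by (auto simp: norm_mult intro!: mult_mono)
  qed
  also have "\<dots> = C * (\<Sum>(x, k)\<in>p. v (Sup k) - v (Inf k))"
    by (simp add: case_prod_unfold sum_distrib_left)
  also have "\<dots> = C * (v 1 - v 0)"
    using additive_tagged_division_1[of 0 1 p v] pt by simp
  finally show "norm I \<le> C * (v 1 - v 0) + e"
    using \<delta>(2)[OF p] norm_triangle_sub[of I "\<Sum>(x, k)\<in>p. h x * (g (Sup k) - g (Inf k))"]
    by (simp add: norm_minus_commute)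
qed

lemma has_RS_integral_diff:
  assumes "has_RS_integral h g 0 1 I" "has_RS_integral k g 0 1 J"
  shows "has_RS_integral (\<lambda>x. h x - k x) g 0 1 (I - J)"
  unfolding has_RS_integral_alt
proof (intro allI impI)
  fix e :: real assume e: "e > 0"
  obtain d1 where d1: "d1 > 0" "\<And>p. fine_tagged d1 p \<Longrightarrow>
     norm (RS_sum h g p - I) < e/2"
    using assms(1) e unfolding has_RS_integral_alt by (meson half_gt_zero)
  obtain d2 where d2: "d2 > 0" "\<And>p. fine_tagged d2 p \<Longrightarrow>
     norm (RS_sum k g p - J) < e/2"
    using assms(2) e unfolding has_RS_integral_alt by (meson half_gt_zero)
  have "norm ((\<Sum>(x, l)\<in>p. (h x - k x) * (g (Sup l) - g (Inf l))) - (I - J)) < e" if "fine_tagged (min d1 d2) p" for p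
  proof -
    have "fine_tagged d1 p" "fine_tagged d2 p" using that by (auto elim: fine_tagged_mono)
    from d1(2)[OF this(1)] d2(2)[OF this(2)]
    have "norm ((RS_sum h g p - I) - (RS_sum k g p - J)) < e"
      using norm_triangle_ineq4[of "(RS_sum h g p) - I" "(RS_sum k g p) - J"]
      by linarith
    moreover have "(\<Sum>(x, l)\<in>p. (h x - k x) * (g (Sup l) - g (Inf l))) - (I - J) =
      (RS_sum h g p - I) - (RS_sum k g p - J)"
      by (simp add: case_prod_unfold left_diff_distrib sum_subtractf)
    ultimately show ?thesis by (simp only:)
  qed
  then show "\<exists>\<delta>>0. \<forall>p. fine_tagged \<delta> p \<longrightarrow> norm ((\<Sum>(x, l)\<in>p. (h x - k x) * (g (Sup l) - g (Inf l))) - (I - J)) < e"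
    using d1(1) d2(1) by (intro exI[of _ "min d1 d2"]) auto
qed

lemma fine_tagged_tag: "fine_tagged \<delta> p \<Longrightarrow> (x, k) \<in> p \<Longrightarrow> x \<in> {0..1}"
  unfolding fine_tagged_def using tagged_division_ofD(2,3)[of p "{0..1}" x k] by blast

lemma has_RS_integral_cong:
  assumes "has_RS_integral h g 0 1 I" and "\<And>t. t \<in> {0..1} \<Longrightarrow> h t = k t"
  shows "has_RS_integral k g 0 1 I"
proof -
  have "(RS_sum k g p) = (RS_sum h g p)"
    if "fine_tagged \<delta> p" for \<delta> p
    by (intro sum.cong refl) (use assms(2) fine_tagged_tag[OF that] in auto)
  then show ?thesis using assms(1) by (simp add: has_RS_integral_alt cong: imp_cong)
qed

section \<open>Inscribed polygons\<close>

definition polygon_integral :: "(nat \<Rightarrow> complex) \<Rightarrow> nat \<Rightarrow> (complex \<Rightarrow> complex) \<Rightarrow> complex" where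
  "polygon_integral p n F = (\<Sum>i<n. contour_integral (linepath (p i) (p (Suc i))) F)"

definition inscribed :: "(real \<Rightarrow> complex) \<Rightarrow> nat \<Rightarrow> nat \<Rightarrow> complex" where
  "inscribed g n i = g (real i / real n)"

definition uniform_division :: "nat \<Rightarrow> (real \<times> real set) set" where
  "uniform_division n = (\<lambda>i. (real i / real n, {real i / real n..real (Suc i) / real n})) ` {..<n}"

lemma uniform_division_tagged:
  assumes "n > 0"
  shows "uniform_division n tagged_division_of {0..1}"
proof -
  let ?c = "\<lambda>i. (real i / real n, {real i / real n..real (Suc i) / real n})"
  have single: "{?c i} tagged_division_of {real i / real n..real (Suc i) / real n}" for i
    using tagged_division_of_self_real[of "real i / real n" "real i / real n" "real (Suc i) / real n"] assms
    by (auto simp: divide_right_mono)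
  have "?c ` {..<Suc m} tagged_division_of {0..real (Suc m) / real n}" for m
  proof (induction m)
    case 0
    show ?case using single[of 0] by (simp add: lessThan_Suc)
  next
    case (Suc m)
    have "interior {0..real (Suc m) / real n} \<inter> interior {real (Suc m) / real n..real (Suc (Suc m)) / real n} = {}"
      by auto
    from tagged_division_Un[OF Suc single this]
    have "?c ` {..<Suc m} \<union> {?c (Suc m)} tagged_division_of
       {0..real (Suc m) / real n} \<union> {real (Suc m) / real n..real (Suc (Suc m)) / real n}" .
    also have "?c ` {..<Suc m} \<union> {?c (Suc m)} = ?c ` {..<Suc (Suc m)}"
      by (auto simp: lessThan_Suc)
    also have "{0..real (Suc m) / real n} \<union> {real (Suc m) / real n..real (Suc (Suc m)) / real n}
       = {0..real (Suc (Suc m)) / real n}"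
      by (intro ivl_disj_un_two_touch) (auto simp: divide_right_mono)
    finally show ?case .
  qed
  from this[of "n - 1"] assms show ?thesis by (simp add: uniform_division_def)
qed

lemma uniform_division_sum:
  assumes "n > 0"
  shows "(RS_sum h g (uniform_division n)) =
    (\<Sum>i<n. h (real i / real n) * (g (real (Suc i) / real n) - g (real i / real n)))"
proof -
  have inj: "inj_on (\<lambda>i. (real i / real n, {real i / real n..real (Suc i) / real n})) {..<n}"
    using assms by (auto simp: inj_on_def)
  have "real i / real n \<le> real (Suc i) / real n" for i by (simp add: divide_right_mono)
  then show ?thesis unfolding uniform_division_def
    by (subst sum.reindex[OF inj]) simp
qed

lemma uniform_division_fine:
  assumes "n > 0" "1 / real n < \<delta>"
  shows "fine_tagged \<delta> (uniform_division n)"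
proof -
  have "dist (real i / real n) t < \<delta>" if "real i / real n \<le> t" "t \<le> (1 + real i) / real n" for i t
  proof -
    have "dist (real i / real n) t \<le> 1 / real n" using that by (auto simp: dist_real_def add_divide_distrib)
    then show ?thesis using assms by simp
  qed
  then show ?thesis unfolding fine_tagged_def using uniform_division_tagged[OF assms(1)]
    by (auto simp: fine_def uniform_division_def)
qed

lemma inscribed_length:
  assumes v: "variation_dominated g v"
  shows "i < n \<Longrightarrow> norm (inscribed g n (Suc i) - inscribed g n i) \<le> v (real (Suc i) / real n) - v (real i / real n)"
    and "(\<Sum>i<n. norm (inscribed g n (Suc i) - inscribed g n i)) \<le> v 1 - v 0"
proof -
  show *: "norm (inscribed g n (Suc i) - inscribed g n i) \<le> v (real (Suc i) / real n) - v (real i / real n)"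
    if "i < n" for i
    unfolding inscribed_def using that by (intro variation_dominatedD[OF v]) (auto simp: divide_right_mono)
  have "(\<Sum>i<n. norm (inscribed g n (Suc i) - inscribed g n i)) \<le>
     (\<Sum>i<n. v (real (Suc i) / real n) - v (real i / real n))"
    by (intro sum_mono *) auto
  also have "\<dots> = v (real n / real n) - v (real 0 / real n)"
    using sum_lessThan_telescope[of "\<lambda>i. v (real i / real n)" n] by simp
  also have "\<dots> \<le> v 1 - v 0" using variation_dominated_mono[OF v, of 0 1] by (cases "n = 0") auto
  finally show "(\<Sum>i<n. norm (inscribed g n (Suc i) - inscribed g n i)) \<le> v 1 - v 0" .
qed

lemma eventually_inverse_less: "\<delta> > 0 \<Longrightarrow> \<forall>\<^sub>F n in sequentially. n > 0 \<and> 1 / real n < \<delta>"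
  by (intro eventually_conj eventually_gt_at_top) real_asymp

lemma inscribed_close:
  assumes g: "continuous_on {0..1} g" and d: "d > 0"
  shows "\<forall>\<^sub>F n in sequentially. \<forall>i<n. \<forall>w\<in>closed_segment (inscribed g n i) (inscribed g n (Suc i)).
    norm (w - inscribed g n i) < d"
proof -
  have "uniformly_continuous_on {0..1} g" using g by (intro compact_uniformly_continuous) auto
  then obtain \<delta> where \<delta>: "\<delta> > 0" "\<And>x y. x \<in> {0..1} \<Longrightarrow> y \<in> {0..1} \<Longrightarrow> dist y x < \<delta> \<Longrightarrow> dist (g y) (g x) < d"
    using d unfolding uniformly_continuous_on_def by meson
  show ?thesis
    using eventually_inverse_less[OF \<delta>(1)]
  proof (eventually_elim, intro allI impI ballI)
    fix n i w assume n: "n > 0 \<and> 1 / real n < \<delta>" and i: "i < n" and w: "w \<in> closed_segment (inscribed g n i) (inscribed g n (Suc i))"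
    have "norm (w - inscribed g n i) \<le> norm (inscribed g n (Suc i) - inscribed g n i)"
      using segment_bound(1)[OF w] by (simp add: norm_minus_commute)
    also have "\<dots> < d"
    proof -
      have "real i / real n \<in> {0..1}" "real (Suc i) / real n \<in> {0..1}" using n i by auto
      moreover have "dist (real (Suc i) / real n) (real i / real n) < \<delta>"
        using n by (simp add: dist_real_def add_divide_distrib)
      ultimately show ?thesis using \<delta>(2) unfolding inscribed_def by (simp only: dist_norm)
    qed
    finally show "norm (w - inscribed g n i) < d" .
  qed
qed

text \<open>On a short edge \<open>F\<close> stays within \<open>e1\<close> of its value at the
  first vertex, so the edge integral differs from one term of a Riemann-Stieltjes sum by at most
  \<open>e1\<close> times the edge length; the edge lengths add up to at most
  \<open>v 1 - v 0\<close>.\<close>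

lemma polygon_integral_tendsto:
  assumes v: "variation_dominated g v" and g: "continuous_on {0..1} g"
    and F: "continuous_on UNIV F" and I: "has_RS_integral (\<lambda>t. F (g t)) g 0 1 I"
  shows "(\<lambda>n. polygon_integral (inscribed g n) n F) \<longlonglongrightarrow> I"
proof (rule LIMSEQ_I)
  fix e :: real assume e: "e > 0"
  define L where "L = v 1 - v 0"
  have L: "L \<ge> 0" using variation_dominated_mono[OF v, of 0 1] by (simp add: L_def)
  define e1 where "e1 = e / (2 * (L + 1))"
  have e1: "e1 > 0" "e1 * L < e/2" using e L by (auto simp: e1_def field_simps)
  \<comment> \<open>Edges are chords and leave the curve; uniform continuity is taken on a ball,
    which is convex and so contains them.\<close>
  obtain R where R: "\<And>t. t \<in> {0..1} \<Longrightarrow> norm (g t) \<le> R"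
    using compact_imp_bounded[OF compact_continuous_image[OF g compact_Icc]] unfolding bounded_iff by blast
  have "uniformly_continuous_on (cball 0 R) F"
    using F by (intro compact_uniformly_continuous) (auto elim: continuous_on_subset)
  then obtain d where d: "d > 0" "\<And>x y. x \<in> cball 0 R \<Longrightarrow> y \<in> cball 0 R \<Longrightarrow> dist y x < d \<Longrightarrow> dist (F y) (F x) < e1"
    using e1 unfolding uniformly_continuous_on_def by meson
  obtain \<delta> where \<delta>: "\<delta> > 0" "\<And>p. fine_tagged \<delta> p \<Longrightarrow> norm ((RS_sum (\<lambda>t. F (g t)) g p) - I) < e/2"
    using I half_gt_zero[OF e] unfolding has_RS_integral_alt by blast
  have "\<forall>\<^sub>F n in sequentially. norm (polygon_integral (inscribed g n) n F - I) < e"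
    using inscribed_close[OF g d(1)] eventually_inverse_less[OF \<delta>(1)]
  proof eventually_elim
    fix n
    assume close: "\<forall>i<n. \<forall>w\<in>closed_segment (inscribed g n i) (inscribed g n (Suc i)). norm (w - inscribed g n i) < d"
      and n: "n > 0 \<and> 1 / real n < \<delta>"
    let ?p = "inscribed g n"
    define S where "S = (\<Sum>i<n. F (?p i) * (?p (Suc i) - ?p i))"
    have S: "norm (S - I) < e/2"
    proof -
      have "norm ((RS_sum (\<lambda>t. F (g t)) g (uniform_division n)) - I) < e/2"
        using n by (intro \<delta>(2) uniform_division_fine) auto
      moreover have "(RS_sum (\<lambda>t. F (g t)) g (uniform_division n)) = S"
        using n uniform_division_sum[of n "\<lambda>t. F (g t)" g] by (simp add: S_def inscribed_def)
      ultimately show ?thesis by simp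
    qed
    have edge: "norm (contour_integral (linepath (?p i) (?p (Suc i))) F - F (?p i) * (?p (Suc i) - ?p i))
       \<le> e1 * norm (?p (Suc i) - ?p i)" if i: "i < n" for i
    proof -
      have Fi: "F contour_integrable_on linepath (?p i) (?p (Suc i))"
        using F by (intro contour_integrable_continuous_linepath) (auto elim: continuous_on_subset)
      have "contour_integral (linepath (?p i) (?p (Suc i))) F - F (?p i) * (?p (Suc i) - ?p i)
        = contour_integral (linepath (?p i) (?p (Suc i))) (\<lambda>w. F w - F (?p i))"
        using Fi by (subst contour_integral_diff) auto
      also have "norm \<dots> \<le> e1 * norm (?p (Suc i) - ?p i)"
      proof (rule contour_integral_bound_linepath)
        show "(\<lambda>w. F w - F (?p i)) contour_integrable_on linepath (?p i) (?p (Suc i))"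
          using Fi by (intro contour_integrable_diff) auto
        fix w assume w: "w \<in> closed_segment (?p i) (?p (Suc i))"
        have pc: "?p i \<in> cball 0 R" "?p (Suc i) \<in> cball 0 R"
          using i by (auto simp: inscribed_def intro!: R)
        then have "w \<in> cball 0 R" using w closed_segment_subset[OF pc convex_cball] by blast
        then show "norm (F w - F (?p i)) \<le> e1"
          using d(2)[of "?p i" w] pc close i w by (simp add: dist_norm less_imp_le)
      qed (use e1 in simp)
      finally show ?thesis .
    qed
    have "norm (polygon_integral ?p n F - S) \<le> (\<Sum>i<n. e1 * norm (?p (Suc i) - ?p i))"
      unfolding polygon_integral_def S_def sum_subtractf[symmetric] by (intro sum_norm_le edge) auto
    also have "\<dots> \<le> e1 * L"
      using inscribed_length(2)[OF v, of n] e1(1) by (simp add: L_def flip: sum_distrib_left)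
    finally have "norm (polygon_integral ?p n F - S) < e/2" using e1(2) by simp
    then show "norm (polygon_integral ?p n F - I) < e"
      using S norm_triangle_lt[of "polygon_integral ?p n F - S" "S - I" e] by simp
  qed
  then show "\<exists>N. \<forall>n\<ge>N. norm (polygon_integral (inscribed g n) n F - I) < e"
    by (simp add: eventually_sequentially)
qed

lemma eventually_inscribed_avoids:
  assumes g: "continuous_on {0..1} g" and z: "z \<notin> g ` {0..1}"
  obtains d where "d > 0" "\<And>t. t \<in> {0..1} \<Longrightarrow> 2 * d \<le> norm (g t - z)"
    "\<forall>\<^sub>F n in sequentially. \<forall>i<n. \<forall>w\<in>closed_segment (inscribed g n i) (inscribed g n (Suc i)). d \<le> norm (w - z)"
proof -
  have "closed (g ` {0..1})" using compact_continuous_image[OF g compact_Icc] compact_imp_closed by blast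
  then obtain e where e: "e > 0" "\<And>y. y \<in> g ` {0..1} \<Longrightarrow> e \<le> dist z y"
    using separate_point_closed[of "g ` {0..1}" z] z by blast
  show thesis
  proof (rule that[of "e/2"])
    show "e/2 > 0" using e by simp
    show far: "2 * (e/2) \<le> norm (g t - z)" if "t \<in> {0..1}" for t
      using e(2)[of "g t"] that by (simp add: dist_norm norm_minus_commute)
    show "\<forall>\<^sub>F n in sequentially. \<forall>i<n. \<forall>w\<in>closed_segment (inscribed g n i) (inscribed g n (Suc i)). e/2 \<le> norm (w - z)"
      using inscribed_close[OF g half_gt_zero[OF e(1)]]
    proof (eventually_elim, intro allI impI ballI)
      fix n i w assume *: "\<forall>i<n. \<forall>w\<in>closed_segment (inscribed g n i) (inscribed g n (Suc i)). norm (w - inscribed g n i) < e/2"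
        and i: "i < n" and w: "w \<in> closed_segment (inscribed g n i) (inscribed g n (Suc i))"
      have "norm (w - inscribed g n i) < e/2" using * i w by blast
      moreover have "e \<le> norm (inscribed g n i - z)" using far[of "real i / real n"] i by (simp add: inscribed_def)
      ultimately show "e/2 \<le> norm (w - z)"
        using norm_triangle_ineq4[of "w - z" "w - inscribed g n i"] by simp
    qed
  qed
qed

lemma polygon_kernel_tendsto:
  assumes v: "variation_dominated g v" and g: "continuous_on {0..1} g" and z: "z \<notin> g ` {0..1}"
    and I: "has_RS_integral (\<lambda>t. 1 / (g t - z)) g 0 1 I"
  shows "(\<lambda>n. polygon_integral (inscribed g n) n (\<lambda>w. 1 / (w - z))) \<longlonglongrightarrow> I"
proof -
  obtain d where d: "d > 0" "\<And>t. t \<in> {0..1} \<Longrightarrow> 2 * d \<le> norm (g t - z)"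
    and ev: "\<forall>\<^sub>F n in sequentially. \<forall>i<n. \<forall>w\<in>closed_segment (inscribed g n i) (inscribed g n (Suc i)). d \<le> norm (w - z)"
    using eventually_inscribed_avoids[OF g z] by blast
  \<comment> \<open>The kernel \<open>1 / (w - z)\<close> is \<open>cnj (w - z)\<close> over the
    squared modulus. Keeping the modulus above \<open>d\<close> makes it continuous on the plane
    without changing it on the curve or on the late polygons.\<close>
  define F where "F w = cnj (w - z) / of_real (max (norm (w - z)) d)^2" for w
  have F_eq: "F w = 1 / (w - z)" if "d \<le> norm (w - z)" for w
  proof -
    have "w - z \<noteq> 0" using that d by auto
    then show ?thesis using that complex_norm_square[of "w - z"] by (simp add: F_def max_def field_simps)
  qed
  have F: "continuous_on UNIV F" unfolding F_def using d(1)
    by (intro continuous_intros) (auto simp: max_def)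
  have "has_RS_integral (\<lambda>t. F (g t)) g 0 1 I"
  proof -
    have "1 / (g t - z) = F (g t)" if "t \<in> {0..1}" for t
      using F_eq[of "g t"] d(2)[OF that] d(1) by simp
    then show ?thesis by (rule has_RS_integral_cong[OF I])
  qed
  from polygon_integral_tendsto[OF v g F this]
  have lim: "(\<lambda>n. polygon_integral (inscribed g n) n F) \<longlonglongrightarrow> I" .
  have "\<forall>\<^sub>F n in sequentially. polygon_integral (inscribed g n) n F = polygon_integral (inscribed g n) n (\<lambda>w. 1 / (w - z))"
    using ev
  proof eventually_elim
    case (elim n)
    show ?case unfolding polygon_integral_def
      by (intro sum.cong refl contour_integral_eq) (use elim F_eq in auto)
  qed
  from Lim_transform_eventually[OF lim this] show ?thesis .
qed

lemma exp_contour_integral_linepath: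
  assumes "z \<notin> closed_segment a b"
  shows "exp (contour_integral (linepath a b) (\<lambda>w. 1 / (w - z))) = (b - z) / (a - z)"
proof -
  have "a \<noteq> z" using assms by auto
  moreover have "contour_integral (linepath a b) (\<lambda>w. 1 / (w - z)) = 2 * pi * \<i> * winding_number (linepath a b) z"
    using assms by (subst winding_number_valid_path) auto
  ultimately show ?thesis using winding_number_exp_2pi[of "linepath a b" z] assms by (simp add: field_simps)
qed

text \<open>Exponentiation turns the sum of edge integrals into a telescoping product of quotients
  of \<open>p i - z\<close>, which is 1 for a closed polygon.\<close>

lemma polygon_index_Ints:
  assumes "\<And>i. i < n \<Longrightarrow> z \<notin> closed_segment (p i) (p (Suc i))" and "p n = p 0"
  shows "polygon_integral p n (\<lambda>w. 1 / (w - z)) / (2 * of_real pi * \<i>) \<in> \<int>"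
proof (cases "n = 0")
  case True
  then show ?thesis by (simp add: polygon_integral_def)
next
  case False
  have "p m \<noteq> z \<and> exp (polygon_integral p m (\<lambda>w. 1 / (w - z))) = (p m - z) / (p 0 - z)" if "m \<le> n" for m
    using that
  proof (induction m)
    case 0
    have "p 0 \<noteq> z" using assms(1)[of 0] False by auto
    then show ?case by (simp add: polygon_integral_def)
  next
    case (Suc m)
    then have "z \<notin> closed_segment (p m) (p (Suc m))" using assms by simp
    moreover from this have "p (Suc m) \<noteq> z" by auto
    ultimately show ?case using Suc
      by (simp add: polygon_integral_def exp_add exp_contour_integral_linepath)
  qed
  from this[of n] this[of 0] have "exp (polygon_integral p n (\<lambda>w. 1 / (w - z))) = 1" using assms(2) by simp
  then obtain k :: int where "Re (polygon_integral p n (\<lambda>w. 1 / (w - z))) = 0"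
    "Im (polygon_integral p n (\<lambda>w. 1 / (w - z))) = of_int (2 * k) * pi"
    unfolding exp_eq_1 by blast
  then have "polygon_integral p n (\<lambda>w. 1 / (w - z)) = 2 * of_real pi * \<i> * of_int k"
    by (simp add: complex_eq_iff)
  then show ?thesis by simp
qed

section \<open>Lebesgue measure on the complex plane\<close>

lemma Complex_measurable [measurable]:
  "(\<lambda>(x, y). Complex x y) \<in> borel_measurable (lborel \<Otimes>\<^sub>M lborel)"
proof -
  have "continuous_on UNIV (\<lambda>p::real \<times> real. Complex (fst p) (snd p))"
    unfolding Complex_eq by (intro continuous_intros)
  then have "(\<lambda>p::real \<times> real. Complex (fst p) (snd p)) \<in> borel_measurable (borel :: (real \<times> real) measure)"
    by (rule borel_measurable_continuous_onI)
  then show ?thesis by (simp add: lborel_prod case_prod_unfold)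
qed

text \<open>Boxes determine Lebesgue measure, and the preimage of a box is a product of intervals.
  This is the bridge to Fubini.\<close>

lemma lborel_complex_eq_distr:
  "(lborel :: complex measure) = distr (lborel \<Otimes>\<^sub>M lborel) borel (\<lambda>(x, y). Complex x y)"
proof (rule lborel_eqI)
  fix l u :: complex
  assume "\<And>b. b \<in> Basis \<Longrightarrow> l \<bullet> b \<le> u \<bullet> b"
  from this[of 1] this[of \<i>] have le: "Re l \<le> Re u" "Im l \<le> Im u"
    by (auto simp: Basis_complex_def)
  have "(\<lambda>(x, y). Complex x y) -` box l u = {Re l<..<Re u} \<times> {Im l<..<Im u}"
    by (auto simp: box_Complex_eq in_box_complex_iff)
  then have "emeasure (distr (lborel \<Otimes>\<^sub>M lborel) borel (\<lambda>(x, y). Complex x y)) (box l u) =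
     emeasure (lborel \<Otimes>\<^sub>M lborel) ({Re l<..<Re u} \<times> {Im l<..<Im u})"
    by (subst emeasure_distr) (auto simp: space_pair_measure)
  also have "\<dots> = ennreal (Re u - Re l) * ennreal (Im u - Im l)"
    using le by (subst lborel.emeasure_pair_measure_Times) auto
  also have "\<dots> = (\<Prod>b\<in>Basis. (u - l) \<bullet> b)"
    using le by (simp add: Basis_complex_def ennreal_mult)
  finally show "emeasure (distr (lborel \<Otimes>\<^sub>M lborel) borel (\<lambda>(x, y). Complex x y)) (box l u) = (\<Prod>b\<in>Basis. (u - l) \<bullet> b)" .
qed simp

lemma nn_integral_complex:
  fixes f :: "complex \<Rightarrow> ennreal"
  assumes [measurable]: "f \<in> borel_measurable borel"
  shows "(\<integral>\<^sup>+z. f z \<partial>lborel) = (\<integral>\<^sup>+y. \<integral>\<^sup>+x. f (Complex x y) \<partial>lborel \<partial>lborel)"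
proof -
  have [measurable]: "(\<lambda>p. f (case p of (x, y) \<Rightarrow> Complex x y)) \<in> borel_measurable (lborel \<Otimes>\<^sub>M lborel)"
    by measurable
  have "(\<integral>\<^sup>+z. f z \<partial>lborel) = (\<integral>\<^sup>+p. f (case p of (x, y) \<Rightarrow> Complex x y) \<partial>(lborel \<Otimes>\<^sub>M lborel))"
    unfolding lborel_complex_eq_distr by (rule nn_integral_distr) auto
  then show ?thesis
    using lborel_pair.nn_integral_snd[of "\<lambda>p. f (case p of (x, y) \<Rightarrow> Complex x y)"] by simp
qed

lemma integrable_complex_iff:
  fixes f :: "complex \<Rightarrow> 'a::{banach, second_countable_topology}"
  assumes [measurable]: "f \<in> borel_measurable borel"
  shows "integrable lborel f \<longleftrightarrow> integrable (lborel \<Otimes>\<^sub>M lborel) (\<lambda>(x, y). f (Complex x y))"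
  unfolding lborel_complex_eq_distr
  by (subst integrable_distr_eq) (auto simp: case_prod_unfold)

lemma integral_complex:
  fixes f :: "complex \<Rightarrow> complex"
  assumes "integrable lborel f"
  shows "(LINT z|lborel. f z) = (LINT y|lborel. LINT x|lborel. f (Complex x y))"
proof -
  have m[measurable]: "f \<in> borel_measurable borel" using assms by (auto dest: borel_measurable_integrable)
  have "(LINT z|lborel. f z) = (LINT p|(lborel \<Otimes>\<^sub>M lborel). f (case p of (x, y) \<Rightarrow> Complex x y))"
    unfolding lborel_complex_eq_distr by (rule integral_distr) auto
  also have "\<dots> = (LINT p|(lborel \<Otimes>\<^sub>M lborel). (case p of (x, y) \<Rightarrow> f (Complex x y)))"
    by (simp add: case_prod_unfold)
  also have "\<dots> = (LINT y|lborel. LINT x|lborel. f (Complex x y))"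
    using assms integrable_complex_iff[OF m] by (intro lborel_pair.integral_snd[symmetric]) simp
  finally show ?thesis .
qed

text \<open>Multiplication by \<open>\<i>\<close> carries boxes to boxes with the two sides
  exchanged. Through this rotation, facts about vertical derivatives and vertical rays are deduced
  from the horizontal case.\<close>

lemma lborel_rotate: "distr lborel borel ((*) \<i>) = (lborel :: complex measure)"
proof (rule lborel_eqI[symmetric])
  fix l u :: complex
  assume "\<And>b. b \<in> Basis \<Longrightarrow> l \<bullet> b \<le> u \<bullet> b"
  from this[of 1] this[of \<i>] have le: "Re l \<le> Re u" "Im l \<le> Im u"
    by (auto simp: Basis_complex_def)
  have [measurable]: "((*) \<i>) \<in> borel_measurable borel"
    by (intro borel_measurable_continuous_onI continuous_intros)
  have "((*) \<i>) -` box l u = box (Complex (Im l) (- Re u)) (Complex (Im u) (- Re l))"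
    by (auto simp: in_box_complex_iff)
  then show "emeasure (distr lborel borel ((*) \<i>)) (box l u) = (\<Prod>b\<in>Basis. (u - l) \<bullet> b)"
    using le by (subst emeasure_distr) (auto simp: emeasure_lborel_box_eq Basis_complex_def mult.commute)
qed simp

lemma integral_rotate:
  fixes f :: "complex \<Rightarrow> 'a::{banach, second_countable_topology}"
  assumes [measurable]: "f \<in> borel_measurable borel"
  shows "(LINT z|lborel. f (\<i> * z)) = (LINT z|lborel. f z)"
  by (subst (2) lborel_rotate[symmetric], subst integral_distr) auto

lemma nn_integral_rotate:
  assumes [measurable]: "f \<in> borel_measurable borel"
  shows "(\<integral>\<^sup>+z. f (\<i> * z) \<partial>lborel) = (\<integral>\<^sup>+z. f z \<partial>lborel)"
  by (subst (2) lborel_rotate[symmetric], subst nn_integral_distr) auto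

lemma integral_translate:
  fixes f :: "complex \<Rightarrow> 'a::{banach, second_countable_topology}"
  assumes [measurable]: "f \<in> borel_measurable borel"
  shows "(LINT z|lborel. f (c + z)) = (LINT z|lborel. f z)"
  by (subst (2) lborel_distr_plus[symmetric, of c], subst integral_distr) auto

lemma integrable_translate:
  fixes f :: "complex \<Rightarrow> 'a::{banach, second_countable_topology}"
  assumes "integrable lborel f"
  shows "integrable lborel (\<lambda>z. f (c + z))"
proof -
  have [measurable]: "f \<in> borel_measurable borel" using assms by (auto dest: borel_measurable_integrable)
  show ?thesis using assms by (subst (asm) lborel_distr_plus[symmetric, of c], subst (asm) integrable_distr_eq) auto
qed

lemma AE_lborel_notin:
  fixes S :: "'a::euclidean_space set"
  assumes "closed S" "negligible S"
  shows "AE z in lborel. z \<notin> S"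
proof (rule AE_not_in)
  show "S \<in> null_sets lborel"
    using assms by (auto simp: negligible_iff_null_sets null_sets_def)
qed

lemma integrable_bounded_support:
  fixes f :: "'a::euclidean_space \<Rightarrow> 'b::{banach, second_countable_topology}"
  assumes [measurable]: "f \<in> borel_measurable borel" and "\<And>z. norm (f z) \<le> M"
    and "\<And>z. norm z > R \<Longrightarrow> f z = 0"
  shows "integrable lborel f"
proof (rule Bochner_Integration.integrable_bound)
  show "integrable lborel (\<lambda>z. M * indicator (cball 0 R) z :: real)"
    by (intro integrable_mult_right integrable_real_indicator) (auto intro: emeasure_bounded_finite[OF bounded_cball, unfolded infinity_ennreal_def])
  have "norm (f z) \<le> norm (M * indicator (cball 0 R) z :: real)" for z
    using assms(2)[of z] assms(3)[of z] by (cases "norm z > R") auto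
  then show "AE z in lborel. norm (f z) \<le> norm (M * indicator (cball 0 R) z :: real)" by simp
qed simp

section \<open>Compactly supported functions of class C^1\<close>

text \<open>The partial derivatives are carried as data, so that sums, products and rotations act on
  triples and no derivative has to be recomputed from \<open>frechet_derivative\<close>.\<close>

definition C1c :: "(complex \<Rightarrow> complex) \<Rightarrow> (complex \<Rightarrow> complex) \<Rightarrow> (complex \<Rightarrow> complex) \<Rightarrow> bool" where
  "C1c F Fx Fy \<longleftrightarrow> (\<forall>z. (F has_derivative (\<lambda>h. of_real (Re h) * Fx z + of_real (Im h) * Fy z)) (at z)) \<and>
     continuous_on UNIV Fx \<and> continuous_on UNIV Fy \<and>
     (\<exists>R. \<forall>z. norm z > R \<longrightarrow> F z = 0 \<and> Fx z = 0 \<and> Fy z = 0)"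

lemma C1c_continuous:
  assumes "C1c F Fx Fy"
  shows "continuous_on UNIV F" "continuous_on UNIV Fx" "continuous_on UNIV Fy"
proof -
  show "continuous_on UNIV F"
    using assms unfolding C1c_def by (intro continuous_at_imp_continuous_on ballI has_derivative_continuous) blast
qed (use assms in \<open>auto simp: C1c_def\<close>)

lemma continuous_compact_support_bounded:
  fixes f :: "'a::euclidean_space \<Rightarrow> 'b::real_normed_vector"
  assumes "continuous_on UNIV f" "\<And>z. norm z > R \<Longrightarrow> f z = 0"
  obtains M where "M > 0" "\<And>z. norm (f z) \<le> M"
proof -
  have "bounded (f ` cball 0 R)"
    using assms(1) by (intro compact_imp_bounded compact_continuous_image) (auto elim: continuous_on_subset)
  then obtain M where M: "M > 0" "\<And>z. z \<in> cball 0 R \<Longrightarrow> norm (f z) \<le> M"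
    unfolding bounded_pos by blast
  have "norm (f z) \<le> M" for z
    using M assms(2)[of z] by (cases "norm z > R") auto
  then show thesis using that M(1) by blast
qed

lemma C1c_bounds:
  assumes "C1c F Fx Fy"
  obtains R M where "M > 0" "R > 0" "\<And>z. norm (F z) \<le> M" "\<And>z. norm (Fx z) \<le> M" "\<And>z. norm (Fy z) \<le> M"
    "\<And>z. norm z > R \<Longrightarrow> F z = 0" "\<And>z. norm z > R \<Longrightarrow> Fx z = 0" "\<And>z. norm z > R \<Longrightarrow> Fy z = 0"
proof -
  obtain R where R: "\<And>z. norm z > R \<Longrightarrow> F z = 0 \<and> Fx z = 0 \<and> Fy z = 0"
    using assms unfolding C1c_def by blast
  obtain M1 where "M1 > 0" "\<And>z. norm (F z) \<le> M1"
    using continuous_compact_support_bounded[of F R] C1c_continuous(1)[OF assms] R by metis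
  moreover obtain M2 where "M2 > 0" "\<And>z. norm (Fx z) \<le> M2"
    using continuous_compact_support_bounded[of Fx R] C1c_continuous(2)[OF assms] R by metis
  moreover obtain M3 where "M3 > 0" "\<And>z. norm (Fy z) \<le> M3"
    using continuous_compact_support_bounded[of Fy R] C1c_continuous(3)[OF assms] R by metis
  ultimately show thesis
    using R by (intro that[of "max M1 (max M2 M3)" "max 1 R"]) (auto simp: less_max_iff_disj le_max_iff_disj)
qed

lemma C1c_measurable [measurable_dest]:
  assumes "C1c F Fx Fy"
  shows "F \<in> borel_measurable borel" "Fx \<in> borel_measurable borel" "Fy \<in> borel_measurable borel"
  using C1c_continuous[OF assms] by (auto intro: borel_measurable_continuous_onI)

lemma C1c_integrable_mult:
  assumes "C1c F Fx Fy" and [measurable]: "v \<in> borel_measurable borel" and "\<And>z. norm (v z) \<le> N"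
  shows "integrable lborel (\<lambda>z. F z * v z)" "integrable lborel (\<lambda>z. Fx z * v z)" "integrable lborel (\<lambda>z. Fy z * v z)"
proof -
  note [measurable] = C1c_measurable[OF assms(1)]
  obtain R M where *: "M > 0" "R > 0" "\<And>z. norm (F z) \<le> M" "\<And>z. norm (Fx z) \<le> M" "\<And>z. norm (Fy z) \<le> M"
    "\<And>z. norm z > R \<Longrightarrow> F z = 0" "\<And>z. norm z > R \<Longrightarrow> Fx z = 0" "\<And>z. norm z > R \<Longrightarrow> Fy z = 0"
    using C1c_bounds[OF assms(1)] by metis
  show "integrable lborel (\<lambda>z. F z * v z)"
    using * assms(3) by (intro integrable_bounded_support[of _ "M * N" R]) (auto simp: norm_mult intro!: mult_mono)
  show "integrable lborel (\<lambda>z. Fx z * v z)"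
    using * assms(3) by (intro integrable_bounded_support[of _ "M * N" R]) (auto simp: norm_mult intro!: mult_mono)
  show "integrable lborel (\<lambda>z. Fy z * v z)"
    using * assms(3) by (intro integrable_bounded_support[of _ "M * N" R]) (auto simp: norm_mult intro!: mult_mono)
qed

lemma C1c_partial_x:
  assumes "C1c F Fx Fy"
  shows "((\<lambda>x. F (Complex x y)) has_vector_derivative Fx (Complex x y)) (at x within S)"
proof -
  have c: "((\<lambda>x. Complex x y) has_derivative (\<lambda>h. of_real h)) (at x within S)"
    unfolding Complex_eq by (auto intro!: derivative_eq_intros)
  have F: "(F has_derivative (\<lambda>h. of_real (Re h) * Fx (Complex x y) + of_real (Im h) * Fy (Complex x y))) (at (Complex x y))"
    using assms by (simp add: C1c_def)
  from has_derivative_compose[OF c F] show ?thesis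
    unfolding has_vector_derivative_def by (simp add: scaleR_conv_of_real)
qed

text \<open>Chain rule: moving along 1 before the rotation is moving along \<open>\<i>\<close> after
  it, and moving along \<open>\<i>\<close> becomes moving along -1.\<close>

lemma C1c_rotate:
  assumes "C1c F Fx Fy"
  shows "C1c (\<lambda>z. F (\<i> * z)) (\<lambda>z. Fy (\<i> * z)) (\<lambda>z. - Fx (\<i> * z))"
  unfolding C1c_def
proof (intro conjI allI)
  fix z
  have c: "((\<lambda>z. \<i> * z) has_derivative (\<lambda>h. \<i> * h)) (at z)" by (auto intro!: derivative_eq_intros)
  have F: "(F has_derivative (\<lambda>h. of_real (Re h) * Fx (\<i> * z) + of_real (Im h) * Fy (\<i> * z))) (at (\<i> * z))"
    using assms by (simp add: C1c_def)
  from has_derivative_compose[OF c F] show "((\<lambda>z. F (\<i> * z)) has_derivative (\<lambda>h. of_real (Re h) * Fy (\<i> * z) + of_real (Im h) * - Fx (\<i> * z))) (at z)"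
    by (rule has_derivative_eq_rhs) (auto simp: fun_eq_iff algebra_simps)
next
  have c: "continuous_on UNIV (\<lambda>z::complex. \<i> * z)" by (intro continuous_intros)
  show "continuous_on UNIV (\<lambda>z. Fy (\<i> * z))"
    by (rule continuous_on_compose2[OF C1c_continuous(3)[OF assms] c]) simp
  show "continuous_on UNIV (\<lambda>z. - Fx (\<i> * z))"
    by (rule continuous_on_minus, rule continuous_on_compose2[OF C1c_continuous(2)[OF assms] c]) simp
  obtain R where R: "\<And>z. norm z > R \<Longrightarrow> F z = 0 \<and> Fx z = 0 \<and> Fy z = 0"
    using assms unfolding C1c_def by blast
  show "\<exists>R. \<forall>z. R < norm z \<longrightarrow> F (\<i> * z) = 0 \<and> Fy (\<i> * z) = 0 \<and> - Fx (\<i> * z) = 0"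
    using R by (intro exI[of _ R]) (simp add: norm_mult)
qed

section \<open>Crossing numbers of polygons\<close>

definition edge_abscissa :: "complex \<Rightarrow> complex \<Rightarrow> real \<Rightarrow> real" where
  "edge_abscissa a b y = Re a + (y - Im a) * (Re b - Re a) / (Im b - Im a)"

text \<open>A downward edge counts +1 because a counterclockwise loop passes downwards through the
  ray to the left of an inner point. Heights of endpoints get 0; they matter only on a null
  set.\<close>

definition edge_side :: "complex \<Rightarrow> complex \<Rightarrow> real \<Rightarrow> real" where
  "edge_side a b y = (if Im b < y \<and> y < Im a then 1 else if Im a < y \<and> y < Im b then -1 else 0)"

text \<open>Signed crossing of the leftward horizontal ray from \<open>z\<close> by the edge from \<open>a\<close> to \<open>b\<close>; this
  matches the branch cut of \<^const>\<open>Ln\<close>.\<close>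

definition crossing :: "complex \<Rightarrow> complex \<Rightarrow> complex \<Rightarrow> real" where
  "crossing a b z = (if edge_abscissa a b (Im z) < Re z then edge_side a b (Im z) else 0)"

definition crossings :: "(nat \<Rightarrow> complex) \<Rightarrow> nat \<Rightarrow> complex \<Rightarrow> real" where
  "crossings p n z = (\<Sum>i<n. crossing (p i) (p (Suc i)) z)"

lemma contour_integral_linepath_eq:
  "contour_integral (linepath a b) f = (b - a) * integral {0..1} (\<lambda>t. f (linepath a b t))"
proof -
  have "contour_integral (linepath a b) f = integral {0..1} (\<lambda>t. f (linepath a b t) * (b - a))"
    by (simp add: contour_integral_integral)
  then show ?thesis by (simp add: integral_mult_left mult.commute)
qed

lemma linepath_Im_eq:
  assumes "t \<in> {0..1}" "Im (linepath a b t) = y" "Im a \<noteq> y"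
  shows "Im b \<noteq> Im a" "Re (linepath a b t) = edge_abscissa a b y"
proof -
  have e: "Im a + t * (Im b - Im a) = y" using assms(2) by (simp add: linepath_def algebra_simps)
  then show *: "Im b \<noteq> Im a" using assms(3) by auto
  have "t = (y - Im a) / (Im b - Im a)" using e * by (simp add: field_simps)
  moreover have "Re (linepath a b t) = Re a + t * (Re b - Re a)" by (simp add: linepath_def algebra_simps)
  ultimately show "Re (linepath a b t) = edge_abscissa a b y" by (simp add: edge_abscissa_def)
qed

lemma edge_abscissa_in_segment:
  assumes "edge_side a b y \<noteq> 0"
  shows "Complex (edge_abscissa a b y) y \<in> closed_segment a b"
proof -
  define t where "t = (y - Im a) / (Im b - Im a)"
  have ne: "Im b \<noteq> Im a" and "t \<in> {0..1}"
    using assms by (auto simp: edge_side_def t_def divide_simps split: if_splits)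
  moreover have "linepath a b t = Complex (edge_abscissa a b y) y"
  proof -
    have "t * (Im b - Im a) = y - Im a" using ne by (simp add: t_def)
    moreover have "Re (linepath a b t) = Re a + t * (Re b - Re a)" "Im (linepath a b t) = Im a + t * (Im b - Im a)"
      by (simp_all add: linepath_def algebra_simps)
    ultimately show ?thesis by (simp add: complex_eq_iff edge_abscissa_def t_def)
  qed
  ultimately show ?thesis unfolding linepath_image_01[symmetric] by (metis imageI)
qed

text \<open>If the edge avoids the cut of \<open>Ln (w - z)\<close>, that function is a primitive
  along it. Otherwise the edge attains the height \<open>Im z\<close> only once, to the left of
  \<open>z\<close>; it then avoids the opposite ray and \<open>Ln (z - w)\<close> is a primitive.
  Returning to \<open>Ln (w - z)\<close> at the two ends produces the jump.\<close>

lemma contour_integral_linepath_crossing: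
  assumes a: "Im a \<noteq> Im z" and b: "Im b \<noteq> Im z" and z: "z \<notin> closed_segment a b"
  shows "contour_integral (linepath a b) (\<lambda>w. 1 / (w - z)) =
     Ln (b - z) - Ln (a - z) + 2 * of_real pi * \<i> * of_real (crossing a b z)"
proof (cases "\<exists>w\<in>closed_segment a b. w - z \<in> \<real>\<^sub>\<le>\<^sub>0")
  case False
  have "contour_integral (linepath a b) (\<lambda>w. 1 / (w - z)) = Ln (pathfinish (linepath a b) - z) - Ln (pathstart (linepath a b) - z)"
    by (rule contour_integral_unique, rule contour_integral_primitive[where S = "closed_segment a b"])
      (use False in \<open>auto intro!: derivative_eq_intros simp: divide_inverse\<close>)
  moreover have "crossing a b z = 0"
  proof (rule ccontr)
    assume "crossing a b z \<noteq> 0"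
    then have *: "edge_abscissa a b (Im z) < Re z" "edge_side a b (Im z) \<noteq> 0" by (auto simp: crossing_def split: if_splits)
    then have "Complex (edge_abscissa a b (Im z)) (Im z) - z \<in> \<real>\<^sub>\<le>\<^sub>0" by (simp add: complex_nonpos_Reals_iff)
    then show False using False edge_abscissa_in_segment[OF *(2)] by blast
  qed
  ultimately show ?thesis by simp
next
  case True
  then obtain t where t: "t \<in> {0..1}" "linepath a b t - z \<in> \<real>\<^sub>\<le>\<^sub>0"
    unfolding linepath_image_01[symmetric] by blast
  then have imt: "Im (linepath a b t) = Im z" and "Re (linepath a b t) \<le> Re z" by (auto simp: complex_nonpos_Reals_iff)
  moreover have "linepath a b t \<noteq> z" using z t(1) unfolding linepath_image_01[symmetric] by blast
  ultimately have "Re (linepath a b t) < Re z" by (simp add: complex_eq_iff)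
  then have less: "edge_abscissa a b (Im z) < Re z" using linepath_Im_eq[OF t(1) imt a] by simp
  have away: "z - w \<notin> \<real>\<^sub>\<le>\<^sub>0" if w: "w \<in> closed_segment a b" for w
  proof
    assume w0: "z - w \<in> \<real>\<^sub>\<le>\<^sub>0"
    obtain s where s: "s \<in> {0..1}" "w = linepath a b s" using w unfolding linepath_image_01[symmetric] by blast
    with w0 have "Im (linepath a b s) = Im z" "Re (linepath a b s) \<ge> Re z" by (auto simp: complex_nonpos_Reals_iff)
    then show False using linepath_Im_eq[OF s(1) _ a] less by simp
  qed
  have "contour_integral (linepath a b) (\<lambda>w. 1 / (w - z)) = Ln (z - pathfinish (linepath a b)) - Ln (z - pathstart (linepath a b))"
  proof (rule contour_integral_unique, rule contour_integral_primitive[where S = "closed_segment a b"])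
    fix w assume w: "w \<in> closed_segment a b"
    have "w \<noteq> z" using w z by auto
    then show "((\<lambda>w. Ln (z - w)) has_field_derivative 1 / (w - z)) (at w within closed_segment a b)"
      using away[OF w] by (auto intro!: derivative_eq_intros simp: divide_simps)
  qed auto
  then have 1: "contour_integral (linepath a b) (\<lambda>w. 1 / (w - z)) = Ln (- (b - z)) - Ln (- (a - z))" by simp
  \<comment> \<open>The edge reaches the height \<open>Im z\<close> at which neither endpoint lies,
    so the endpoints are strictly on opposite sides and the two branch corrections have opposite
    signs.\<close>
  have side: "Im a < Im z \<and> Im z < Im b \<or> Im b < Im z \<and> Im z < Im a"
  proof -
    have *: "Im z = (1 - t) * Im a + t * Im b" using imt by (simp add: linepath_def)
    have "\<not> (Im a < Im z \<and> Im b < Im z)" "\<not> (Im z < Im a \<and> Im z < Im b)"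
      using convex_bound_lt[of "Im a" "Im z" "Im b" "1 - t" t] convex_bound_lt[of "- Im a" "- Im z" "- Im b" "1 - t" t] t(1) *
      by (auto simp: algebra_simps)
    then show ?thesis using a b by linarith
  qed
  have ab: "a \<noteq> z" "b \<noteq> z" using a b by auto
  show ?thesis
    using side
  proof
    assume s: "Im a < Im z \<and> Im z < Im b"
    then have "crossing a b z = -1" using less by (simp add: crossing_def edge_side_def)
    moreover have "Ln (- (a - z)) = Ln (a - z) + \<i> * pi" "Ln (- (b - z)) = Ln (b - z) - \<i> * pi"
      using s ab Ln_minus[of "a - z"] Ln_minus[of "b - z"] by auto
    ultimately show ?thesis unfolding 1 by simp
  next
    assume s: "Im b < Im z \<and> Im z < Im a"
    then have "crossing a b z = 1" using less by (simp add: crossing_def edge_side_def)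
    moreover have "Ln (- (a - z)) = Ln (a - z) - \<i> * pi" "Ln (- (b - z)) = Ln (b - z) + \<i> * pi"
      using s ab Ln_minus[of "a - z"] Ln_minus[of "b - z"] by auto
    ultimately show ?thesis unfolding 1 by simp
  qed
qed

text \<open>Around a closed polygon the \<open>Ln\<close> terms telescope away and only the
  crossings remain.\<close>

lemma polygon_integral_crossings:
  assumes "p n = p 0" "\<And>i. i \<le> n \<Longrightarrow> Im (p i) \<noteq> Im z" "\<And>i. i < n \<Longrightarrow> z \<notin> closed_segment (p i) (p (Suc i))"
  shows "polygon_integral p n (\<lambda>w. 1 / (w - z)) = 2 * of_real pi * \<i> * of_real (crossings p n z)"
proof -
  have "polygon_integral p n (\<lambda>w. 1 / (w - z)) =
     (\<Sum>i<n. Ln (p (Suc i) - z) - Ln (p i - z)) + (\<Sum>i<n. 2 * of_real pi * \<i> * of_real (crossing (p i) (p (Suc i)) z))"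
    unfolding polygon_integral_def sum.distrib[symmetric]
    by (intro sum.cong refl contour_integral_linepath_crossing) (use assms in auto)
  then show ?thesis
    using assms(1) sum_lessThan_telescope[of "\<lambda>i. Ln (p i - z)" n]
    by (simp add: crossings_def sum_distrib_left)
qed

lemma negligible_closed_segment: "negligible (closed_segment a (b::complex))"
  using negligible_convex_interior[of "closed_segment a b"] interior_closed_segment_ge2[of a b] by simp

lemma negligible_Im: "negligible {z. Im z = c}"
  using negligible_standard_hyperplane[of \<i> c] by (simp add: Basis_complex_def)

lemma AE_polygon_crossings:
  assumes "p n = p 0"
  shows "AE z in lborel. polygon_integral p n (\<lambda>w. 1 / (w - z)) = 2 * of_real pi * \<i> * of_real (crossings p n z)"
proof -
  have "AE z in lborel. \<forall>i\<in>{..n}. z \<notin> {z. Im z = Im (p i)}"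
    by (intro AE_finite_allI AE_lborel_notin negligible_Im closed_Collect_eq continuous_intros) simp
  moreover have "AE z in lborel. \<forall>i\<in>{..<n}. z \<notin> closed_segment (p i) (p (Suc i))"
    by (intro AE_finite_allI AE_lborel_notin negligible_closed_segment closed_segment) simp
  ultimately show ?thesis
    by eventually_elim (rule polygon_integral_crossings[where p = p, OF assms], force+)
qed

lemma crossing_measurable [measurable]: "crossing a b \<in> borel_measurable borel"
  unfolding crossing_def[abs_def] edge_abscissa_def edge_side_def by measurable

lemma crossings_measurable [measurable]: "crossings p n \<in> borel_measurable borel"
  unfolding crossings_def[abs_def] by measurable

lemma crossing_le_1: "\<bar>crossing a b z\<bar> \<le> 1"
  by (simp add: crossing_def edge_side_def)

lemma crossings_le: "\<bar>crossings p n z\<bar> \<le> real n"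
  unfolding crossings_def
  by (rule order_trans[OF sum_abs], rule order_trans[OF sum_bounded_above[of _ _ 1]]) (auto simp: crossing_le_1)

text \<open>On a horizontal line that meets the edge, the crossing number is the indicator of the
  half-line to the right of the edge. Integrating \<open>Fx\<close> over it leaves minus the value
  of \<open>F\<close> on the edge, and the height is then reparametrised along the edge.\<close>

lemma edge_integral_down:
  assumes F: "C1c F Fx Fy" and ab: "Im b < Im a"
  shows "(LINT z|lborel. Fx z * of_real (crossing a b z)) =
    of_real (Im b - Im a) * integral {0..1} (\<lambda>t. F (linepath a b t))"
proof -
  note [measurable] = C1c_measurable[OF F]
  obtain R where R: "\<And>z. norm z > R \<Longrightarrow> F z = 0" "\<And>z. norm z > R \<Longrightarrow> Fx z = 0"
    using C1c_bounds[OF F] by metis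
  have Fx_slice: "continuous_on S (\<lambda>x. Fx (Complex x y))" for S y
    unfolding Complex_eq by (rule continuous_on_compose2[OF C1c_continuous(2)[OF F]]) (auto intro!: continuous_intros)
  let ?X = "edge_abscissa a b"
  have inner: "(LINT x|lborel. Fx (Complex x y) * of_real (crossing a b (Complex x y))) =
     (if Im b < y \<and> y < Im a then - F (Complex (?X y) y) else 0)" for y
  proof (cases "Im b < y \<and> y < Im a")
    case True
    \<comment> \<open>A right end beyond the support of \<open>F\<close>, and never left of the
      edge, so that the interval is ordered.\<close>
    define R' where "R' = max (R + 1) (?X y)"
    have big: "norm (Complex x y) > R" if "x \<ge> R'" for x
      using that abs_Re_le_cmod[of "Complex x y"] unfolding R'_def by simp linarith
    have m: "(\<lambda>x. Fx (Complex x y)) \<in> borel_measurable borel"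
      by (rule borel_measurable_continuous_onI) (rule Fx_slice)
    have m2: "(\<lambda>x. crossing a b (Complex x y)) \<in> borel_measurable borel"
      unfolding crossing_def complex.sel by measurable
    have "(LINT x|lborel. Fx (Complex x y) * of_real (crossing a b (Complex x y))) =
       (LINT x|lborel. indicator {?X y..R'} x *\<^sub>R Fx (Complex x y))"
    proof (rule integral_cong_AE)
      show "AE x in lborel. Fx (Complex x y) * of_real (crossing a b (Complex x y)) = indicator {?X y..R'} x *\<^sub>R Fx (Complex x y)"
        using AE_lborel_singleton[of "?X y"]
      proof eventually_elim
        fix x assume "x \<noteq> ?X y"
        then show "Fx (Complex x y) * of_real (crossing a b (Complex x y)) = indicator {?X y..R'} x *\<^sub>R Fx (Complex x y)"
          using True R(2)[OF big, of x] by (cases "x \<ge> R'") (auto simp: crossing_def edge_side_def indicator_def)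
      qed
    qed (use m m2 in measurable)
    also have "\<dots> = F (Complex R' y) - F (Complex (?X y) y)"
      by (rule integral_FTC_atLeastAtMost) (auto simp: R'_def Fx_slice intro: C1c_partial_x[OF F])
    also have "F (Complex R' y) = 0" using R(1) big by simp
    finally show ?thesis using True by simp
  next
    case False
    then have "crossing a b (Complex x y) = 0" for x using ab by (auto simp: crossing_def edge_side_def)
    then show ?thesis using False by auto
  qed
  define c where "c = Im b - Im a"
  have c: "c < 0" "c \<noteq> 0" using ab by (auto simp: c_def)
  have on_edge: "Complex (?X (Im a + c * s)) (Im a + c * s) = linepath a b s" for s
  proof -
    have "(c * s) * (Re b - Re a) / c = s * (Re b - Re a)" using c(2) by simp
    then have "?X (Im a + c * s) = Re a + s * (Re b - Re a)" by (simp add: edge_abscissa_def flip: c_def)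
    then show ?thesis by (simp add: complex_eq_iff linepath_def c_def algebra_simps)
  qed
  have F_path: "continuous_on S (\<lambda>t. F (linepath a b t))" for S
    by (rule continuous_on_compose2[OF C1c_continuous(1)[OF F]]) auto
  have between: "Im b < Im a + c * s \<and> Im a + c * s < Im a \<longleftrightarrow> 0 < s \<and> s < 1" for s
  proof -
    have "Im b < Im a + c * s \<longleftrightarrow> c * 1 < c * s" by (auto simp: c_def)
    also have "\<dots> \<longleftrightarrow> s < 1" using c(1) mult_less_cancel_left_neg by blast
    finally show ?thesis using c(1) by (auto simp: mult_less_0_iff)
  qed
  have "(LINT z|lborel. Fx z * of_real (crossing a b z)) =
     (LINT y|lborel. LINT x|lborel. Fx (Complex x y) * of_real (crossing a b (Complex x y)))"
    by (intro integral_complex C1c_integrable_mult(2)[OF F, of _ 1]) (auto simp: crossing_le_1)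
  also have "\<dots> = (LINT y|lborel. (if Im b < y \<and> y < Im a then - F (Complex (?X y) y) else 0))"
    by (simp add: inner)
  \<comment> \<open>Substitution \<open>y = Im a + c * s\<close>, under which the edge point at
    height \<open>y\<close> is \<open>linepath a b s\<close>.\<close>
  also have "\<dots> = \<bar>c\<bar> *\<^sub>R (LINT s|lborel. (if 0 < s \<and> s < 1 then - F (linepath a b s) else 0))"
    by (subst lborel_integral_real_affine[OF c(2), of _ "Im a"]) (simp only: on_edge between)
  also have "(LINT s|lborel. (if 0 < s \<and> s < 1 then - F (linepath a b s) else 0)) =
     (LINT s|lborel. - (indicator {0..1} s *\<^sub>R F (linepath a b s)))"
  proof (rule integral_cong_AE)
    have "AE s in lborel. s \<noteq> (0::real)" "AE s in lborel. s \<noteq> (1::real)" by (rule AE_lborel_singleton)+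
    then show "AE s in lborel. (if 0 < s \<and> s < 1 then - F (linepath a b s) else 0) = - (indicator {0..1} s *\<^sub>R F (linepath a b s))"
      by eventually_elim (auto simp: indicator_def)
    have [measurable]: "(\<lambda>t. F (linepath a b t)) \<in> borel_measurable borel"
      by (rule borel_measurable_continuous_onI) (rule F_path)
    show "(\<lambda>s. if 0 < s \<and> s < 1 then - F (linepath a b s) else 0) \<in> borel_measurable lborel" by measurable
    show "(\<lambda>s. - (indicator {0..1} s *\<^sub>R F (linepath a b s))) \<in> borel_measurable lborel" by measurable
  qed
  also have "\<dots> = - integral {0..1} (\<lambda>t. F (linepath a b t))"
  proof -
    have "set_integrable lborel {0..1} (\<lambda>t. F (linepath a b t))"
      unfolding set_integrable_def by (intro borel_integrable_compact F_path) simp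
    from set_borel_integral_eq_integral(2)[OF this] show ?thesis
      by (simp add: set_lebesgue_integral_def)
  qed
  finally show ?thesis using c(1) by (simp add: c_def scaleR_conv_of_real algebra_simps)
qed

text \<open>Reversing an upward edge negates both sides.\<close>

lemma edge_integral:
  assumes F: "C1c F Fx Fy"
  shows "(LINT z|lborel. Fx z * of_real (crossing a b z)) =
    of_real (Im b - Im a) * integral {0..1} (\<lambda>t. F (linepath a b t))"
proof (cases "Im b" "Im a" rule: linorder_cases)
  case less
  then show ?thesis by (rule edge_integral_down[OF F])
next
  case equal
  then have "crossing a b z = 0" for z by (simp add: crossing_def edge_side_def)
  then show ?thesis using equal by simp
next
  case greater
  have "edge_abscissa a b y = edge_abscissa b a y" for y
    using greater by (simp add: edge_abscissa_def divide_simps) (simp add: algebra_simps)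
  then have "crossing a b z = - crossing b a z" for z by (simp add: crossing_def edge_side_def)
  then have "(LINT z|lborel. Fx z * of_real (crossing a b z)) = - (LINT z|lborel. Fx z * of_real (crossing b a z))"
    by simp
  also have "\<dots> = of_real (Im b - Im a) * integral {0..1} (\<lambda>t. F (linepath b a t))"
    using edge_integral_down[OF F greater] by (simp add: algebra_simps)
  also have "integral {0..1} (\<lambda>t. F (linepath b a t)) = integral {0..1} (\<lambda>t. F (linepath a b t))"
  proof -
    have "contour_integral (linepath b a) F = - contour_integral (linepath a b) F"
      using contour_integral_reversepath[of "linepath a b" F] by simp
    moreover have "a \<noteq> b" using greater by auto
    ultimately show ?thesis by (simp add: contour_integral_linepath_eq minus_mult_left)
  qed
  finally show ?thesis .
qed

section \<open>Truncation, shifts and variation of crossing numbers\<close>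

definition polygon_length :: "(nat \<Rightarrow> complex) \<Rightarrow> nat \<Rightarrow> real" where
  "polygon_length p n = (\<Sum>i<n. norm (p (Suc i) - p i))"

definition truncate :: "real \<Rightarrow> real \<Rightarrow> real" where
  "truncate N x = max (- N) (min N x)"

lemma truncate_bound: "N \<ge> 0 \<Longrightarrow> \<bar>truncate N x\<bar> \<le> N"
  and truncate_lipschitz: "\<bar>truncate N x - truncate N y\<bar> \<le> \<bar>x - y\<bar>"
  and truncate_le: "N \<ge> 0 \<Longrightarrow> \<bar>truncate N x\<bar> \<le> \<bar>x\<bar>"
  by (auto simp: truncate_def)

lemma truncate_eq: "\<bar>x\<bar> \<le> N \<Longrightarrow> truncate N x = x"
  by (auto simp: truncate_def)

lemma truncate_measurable [measurable]: "truncate N \<in> borel_measurable borel"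
  unfolding truncate_def[abs_def] by measurable

text \<open>The error lives where \<open>\<bar>x\<bar>\<close> exceeds \<open>N\<close>, and there
  \<open>\<bar>x\<bar>\<close> is at most \<open>x\<^sup>2 / N\<close>. An L^2 bound thus gives an
  L^1 error of order 1 / N.\<close>

lemma truncate_error: "N > 0 \<Longrightarrow> \<bar>x - truncate N x\<bar> \<le> x\<^sup>2 / N"
proof (cases "\<bar>x\<bar> \<le> N")
  case False
  assume N: "N > 0"
  have "\<bar>x - truncate N x\<bar> \<le> \<bar>x\<bar>" using False N by (auto simp: truncate_def)
  also have "\<dots> \<le> x\<^sup>2 / N"
    using False N mult_right_mono[of N "\<bar>x\<bar>" "\<bar>x\<bar>"]
    by (simp add: field_simps power2_eq_square flip: abs_mult) 
  finally show ?thesis .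
qed (simp add: truncate_eq)

text \<open>A shift by \<open>h\<close> changes the count only between the edge and its translate to
  the left by \<open>h\<close>, a sheared strip whose area is the right-hand side.\<close>

lemma crossing_shift_integral:
  assumes h: "h > 0"
  shows "(\<integral>\<^sup>+z. ennreal \<bar>crossing a b (of_real h + z) - crossing a b z\<bar> \<partial>lborel) \<le> ennreal (h * \<bar>Im b - Im a\<bar>)"
proof -
  let ?X = "edge_abscissa a b"
  define lo hi where "lo = min (Im a) (Im b)" and "hi = max (Im a) (Im b)"
  have "\<bar>crossing a b (of_real h + z) - crossing a b z\<bar> \<le>
      indicator {lo<..<hi} (Im z) * indicator {?X (Im z) - h..?X (Im z)} (Re z)" for z
    using h by (auto simp: crossing_def edge_side_def lo_def hi_def indicator_def)
  then have "(\<integral>\<^sup>+z. ennreal \<bar>crossing a b (of_real h + z) - crossing a b z\<bar> \<partial>lborel) \<le>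
     (\<integral>\<^sup>+z. ennreal (indicator {lo<..<hi} (Im z) * indicator {?X (Im z) - h..?X (Im z)} (Re z)) \<partial>lborel)"
    by (intro nn_integral_mono ennreal_leI)
  also have "\<dots> = (\<integral>\<^sup>+y. \<integral>\<^sup>+x. ennreal (indicator {lo<..<hi} y * indicator {?X y - h..?X y} x) \<partial>lborel \<partial>lborel)"
  proof (subst nn_integral_complex)
    have "(\<lambda>z. indicator {lo<..<hi} (Im z) * (if ?X (Im z) - h \<le> Re z \<and> Re z \<le> ?X (Im z) then 1 else 0 :: real)) \<in> borel_measurable borel"
      unfolding edge_abscissa_def by measurable
    moreover have "(if ?X (Im z) - h \<le> Re z \<and> Re z \<le> ?X (Im z) then 1 else 0) = (indicator {?X (Im z) - h..?X (Im z)} (Re z) :: real)" for z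
      by simp
    ultimately show "(\<lambda>z. ennreal (indicator {lo<..<hi} (Im z) * indicator {?X (Im z) - h..?X (Im z)} (Re z))) \<in> borel_measurable borel"
      by (simp only: measurable_ennreal[THEN measurable_compose[rotated]])
  qed simp
  also have "\<dots> = (\<integral>\<^sup>+y. ennreal h * indicator {lo<..<hi} y \<partial>lborel)"
  proof (rule nn_integral_cong)
    fix y :: real
    have "(\<integral>\<^sup>+x. ennreal (indicator {lo<..<hi} y * indicator {?X y - h..?X y} x) \<partial>lborel) =
       (\<integral>\<^sup>+x. indicator {lo<..<hi} y * indicator {?X y - h..?X y} x \<partial>lborel)"
      by (intro nn_integral_cong) (auto simp: indicator_def)
    also have "\<dots> = indicator {lo<..<hi} y * emeasure lborel {?X y - h..?X y}"
      by (subst nn_integral_cmult_indicator) auto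
    finally show "(\<integral>\<^sup>+x. ennreal (indicator {lo<..<hi} y * indicator {?X y - h..?X y} x) \<partial>lborel) = ennreal h * indicator {lo<..<hi} y"
      using h by (simp add: mult.commute)
  qed
  also have "\<dots> = ennreal h * ennreal (hi - lo)"
    by (subst nn_integral_cmult_indicator) (auto simp: lo_def hi_def)
  also have "\<dots> = ennreal (h * \<bar>Im b - Im a\<bar>)"
    using h by (auto simp: ennreal_mult[symmetric] lo_def hi_def max_def min_def abs_if intro!: arg_cong[where f = ennreal])
  finally show ?thesis .
qed

lemma sum_abs_Im_le_length: "(\<Sum>i<n. \<bar>Im (p (Suc i)) - Im (p i)\<bar>) \<le> polygon_length p n"
  unfolding polygon_length_def by (intro sum_mono) (metis abs_Im_le_cmod minus_complex.sel(2))

lemma crossings_shift_integral: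
  assumes h: "h > 0"
  shows "(\<integral>\<^sup>+z. ennreal \<bar>crossings p n (of_real h + z) - crossings p n z\<bar> \<partial>lborel) \<le> ennreal (h * polygon_length p n)"
proof -
  let ?d = "\<lambda>i z. \<bar>crossing (p i) (p (Suc i)) (of_real h + z) - crossing (p i) (p (Suc i)) z\<bar>"
  have "\<bar>crossings p n (of_real h + z) - crossings p n z\<bar> \<le> (\<Sum>i<n. ?d i z)" for z
    unfolding crossings_def sum_subtractf[symmetric] by (rule sum_abs)
  then have "(\<integral>\<^sup>+z. ennreal \<bar>crossings p n (of_real h + z) - crossings p n z\<bar> \<partial>lborel) \<le> (\<integral>\<^sup>+z. (\<Sum>i<n. ennreal (?d i z)) \<partial>lborel)"
    by (intro nn_integral_mono) (simp add: sum_ennreal ennreal_leI)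
  also have "\<dots> = (\<Sum>i<n. \<integral>\<^sup>+z. ennreal (?d i z) \<partial>lborel)"
    by (rule nn_integral_sum) measurable
  also have "\<dots> \<le> (\<Sum>i<n. ennreal (h * \<bar>Im (p (Suc i)) - Im (p i)\<bar>))"
    by (intro sum_mono crossing_shift_integral h)
  also have "\<dots> = ennreal (h * (\<Sum>i<n. \<bar>Im (p (Suc i)) - Im (p i)\<bar>))"
    using h by (subst sum_ennreal) (auto simp: sum_distrib_left)
  also have "\<dots> \<le> ennreal (h * polygon_length p n)"
    using h sum_abs_Im_le_length by (intro ennreal_leI mult_left_mono) auto
  finally show ?thesis .
qed

lemma C1c_lipschitz:
  assumes F: "C1c F Fx Fy" and M: "\<And>z. norm (Fx z) \<le> M" "\<And>z. norm (Fy z) \<le> M"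
  shows "norm (F z - F w) \<le> 2 * M * norm (z - w)"
proof (rule differentiable_bound[where S = UNIV and f' = "\<lambda>z h. of_real (Re h) * Fx z + of_real (Im h) * Fy z"])
  fix z
  show "(F has_derivative (\<lambda>h. of_real (Re h) * Fx z + of_real (Im h) * Fy z)) (at z within UNIV)"
    using F by (simp add: C1c_def)
  show "onorm (\<lambda>h. of_real (Re h) * Fx z + of_real (Im h) * Fy z) \<le> 2 * M"
  proof (rule onorm_le)
    fix h
    have "norm (of_real (Re h) * Fx z + of_real (Im h) * Fy z) \<le> \<bar>Re h\<bar> * norm (Fx z) + \<bar>Im h\<bar> * norm (Fy z)"
      by (rule order_trans[OF norm_triangle_ineq]) (simp add: norm_mult)
    also have "\<dots> \<le> norm h * M + norm h * M"
      by (intro add_mono mult_mono abs_Re_le_cmod abs_Im_le_cmod M) auto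
    finally show "norm (of_real (Re h) * Fx z + of_real (Im h) * Fy z) \<le> 2 * M * norm h" by simp
  qed
qed auto

text \<open>The quotient is taken backwards: after a translation of the variable, the shift falls on
  the other factor of the integrand as a forward shift.\<close>

lemma C1c_difference_quotient:
  assumes F: "C1c F Fx Fy"
  shows "(\<lambda>n. (F z - F (z - of_real (1 / real (Suc n)))) / of_real (1 / real (Suc n))) \<longlonglongrightarrow> Fx z"
proof -
  have "(F has_derivative (\<lambda>h. of_real (Re h) * Fx z + of_real (Im h) * Fy z)) (at z)"
    using F by (simp add: C1c_def)
  then have lim: "((\<lambda>h. norm (F (z + h) - F z - (of_real (Re h) * Fx z + of_real (Im h) * Fy z)) / norm h) \<longlongrightarrow> 0) (at 0)"
    unfolding has_derivative_at by blast
  let ?h = "\<lambda>n. - of_real (1 / real (Suc n)) :: complex"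
  have "(\<lambda>n. 1 / real (Suc n)) \<longlonglongrightarrow> 0" by real_asymp
  then have "?h \<longlonglongrightarrow> - of_real 0" by (intro tendsto_intros)
  then have "filterlim ?h (at 0) sequentially"
    by (auto simp: filterlim_at simp del: of_real_divide)
  from filterlim_compose[OF lim this]
  have "(\<lambda>n. norm ((F z - F (z - of_real (1 / real (Suc n)))) / of_real (1 / real (Suc n)) - Fx z)) \<longlonglongrightarrow> 0"
  proof (rule Lim_transform_eventually, intro always_eventually allI)
    fix n
    define r where "r = 1 / real (Suc n)"
    have r: "r > 0" by (simp add: r_def)
    have "norm (F (z + - of_real r) - F z - (of_real (Re (- of_real r)) * Fx z + of_real (Im (- of_real r)) * Fy z)) / norm (- of_real r :: complex)
       = norm ((F (z - of_real r) - F z + of_real r * Fx z) / of_real r)"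
      using r by (simp add: norm_divide)
    also have "(F (z - of_real r) - F z + of_real r * Fx z) / of_real r = - ((F z - F (z - of_real r)) / of_real r - Fx z)"
      using r by (simp add: field_simps)
    finally show "norm (F (z + - of_real (1 / real (Suc n))) - F z - (of_real (Re (- of_real (1 / real (Suc n)))) * Fx z + of_real (Im (- of_real (1 / real (Suc n)))) * Fy z)) / norm (- of_real (1 / real (Suc n)) :: complex)
        = norm ((F z - F (z - of_real (1 / real (Suc n)))) / of_real (1 / real (Suc n)) - Fx z)"
      unfolding r_def[symmetric] by (simp only: norm_minus_cancel)
  qed
  then show ?thesis using tendsto_norm_zero_iff LIM_zero_cancel by blast
qed

text \<open>Discrete integration by parts. \<open>Fx\<close> is the limit of difference quotients,
  the shift is moved to \<open>v\<close>, and the bound \<open>h * V\<close> cancels the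
  \<open>h\<close> in the denominator. Thus \<open>V\<close> acts as the total variation of
  \<open>v\<close> in the horizontal direction, and \<open>N\<close> does not enter the
  estimate.\<close>

lemma integral_partial_bound:
  assumes F: "C1c F Fx Fy" and v[measurable]: "v \<in> borel_measurable borel" and N: "\<And>z. \<bar>v z\<bar> \<le> N"
    and V: "V \<ge> 0" "\<And>h. h > 0 \<Longrightarrow> (\<integral>\<^sup>+z. ennreal \<bar>v (of_real h + z) - v z\<bar> \<partial>lborel) \<le> ennreal (h * V)"
    and M: "\<And>z. norm (F z) \<le> M"
  shows "norm (LINT z|lborel. Fx z * of_real (v z)) \<le> M * V"
proof -
  note [measurable] = C1c_measurable[OF F]
  have M0: "M \<ge> 0" using M[of 0] norm_ge_zero order_trans by blast
  obtain R K where RK: "K > 0" "R > 0" "\<And>z. norm (Fx z) \<le> K" "\<And>z. norm (Fy z) \<le> K" "\<And>z. norm z > R \<Longrightarrow> F z = 0"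
    using C1c_bounds[OF F] by metis
  have N0: "N \<ge> 0" using N[of 0] by linarith
  define r where "r n = 1 / real (Suc n)" for n
  have r: "r n > 0" "r n \<le> 1" for n by (auto simp: r_def)
  define Q where "Q n z = (F z - F (z - of_real (r n))) / of_real (r n) * of_real (v z)" for n z
  have Q[measurable]: "Q n \<in> borel_measurable borel" for n unfolding Q_def[abs_def] by measurable
  have lim: "(\<lambda>n. LINT z|lborel. Q n z) \<longlonglongrightarrow> (LINT z|lborel. Fx z * of_real (v z))"
  \<comment> \<open>The quotients are bounded by the Lipschitz constant \<open>2 * K\<close>, and
    shifts of at most 1 keep them supported in the ball of radius \<open>R + 1\<close>.\<close>
  proof (rule integral_dominated_convergence[where w = "\<lambda>z. 2 * K * N * indicator (cball 0 (R + 1)) z"])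
    show "integrable lborel (\<lambda>z::complex. 2 * K * N * indicator (cball 0 (R + 1)) z :: real)"
      by (intro integrable_mult_right integrable_real_indicator) (auto intro: emeasure_bounded_finite[OF bounded_cball, unfolded infinity_ennreal_def])
    show "AE z in lborel. (\<lambda>n. Q n z) \<longlonglongrightarrow> Fx z * of_real (v z)"
      unfolding Q_def r_def by (intro always_eventually allI tendsto_intros C1c_difference_quotient[OF F])
    fix n
    have "norm (Q n z) \<le> 2 * K * N * indicator (cball 0 (R + 1)) z" for z
    proof (cases "norm z > R + 1")
      case True
      then have "norm (z - of_real (r n)) > R"
        using norm_triangle_ineq2[of z "of_real (r n)"] r[of n] by simp
      then show ?thesis using True RK(5) by (simp add: Q_def)
    next
      case False
      have "norm (F z - F (z - of_real (r n))) \<le> 2 * K * r n"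
        using C1c_lipschitz[OF F RK(3,4), of z "z - of_real (r n)"] r[of n] by simp
      then have "norm ((F z - F (z - of_real (r n))) / of_real (r n)) \<le> 2 * K"
        using r[of n] by (simp add: norm_divide field_simps)
      then have "norm (Q n z) \<le> 2 * K * N"
        unfolding Q_def norm_mult using N[of z] RK(1) by (intro mult_mono) auto
      then show ?thesis using False by simp
    qed
    then show "AE z in lborel. norm (Q n z) \<le> 2 * K * N * indicator (cball 0 (R + 1)) z" by simp
  qed auto
  have "norm (LINT z|lborel. Q n z) \<le> M * V" for n
  proof -
    have i1: "integrable lborel (\<lambda>z. F z * of_real (v z))"
      using N by (intro C1c_integrable_mult(1)[OF F, of _ N]) auto
    have i2: "integrable lborel (\<lambda>z. F z * of_real (v (of_real (r n) + z)))"
      using N by (intro C1c_integrable_mult(1)[OF F, of _ N]) auto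
    have i3: "integrable lborel (\<lambda>z. F (z - of_real (r n)) * of_real (v z))"
      using integrable_translate[OF i2, of "- of_real (r n)"] by simp
    have shift: "(LINT z|lborel. F (z - of_real (r n)) * of_real (v z)) = (LINT z|lborel. F z * of_real (v (of_real (r n) + z)))"
      using integral_translate[of "\<lambda>z. F z * of_real (v (of_real (r n) + z))" "- of_real (r n)"] by simp
    have "(LINT z|lborel. Q n z) = (LINT z|lborel. (F z * of_real (v z) - F (z - of_real (r n)) * of_real (v z)) / of_real (r n))"
      by (intro Bochner_Integration.integral_cong) (auto simp: Q_def left_diff_distrib)
    also have "\<dots> = ((LINT z|lborel. F z * of_real (v z)) - (LINT z|lborel. F (z - of_real (r n)) * of_real (v z))) / of_real (r n)"
      using i1 i3 by simp
    also have "\<dots> = (LINT z|lborel. F z * of_real (v z) - F z * of_real (v (of_real (r n) + z))) / of_real (r n)"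
      unfolding shift using i1 i2 by simp
    finally have eq: "(LINT z|lborel. Q n z) = (LINT z|lborel. F z * of_real (v z) - F z * of_real (v (of_real (r n) + z))) / of_real (r n)" .
    have "ennreal (norm (LINT z|lborel. F z * of_real (v z) - F z * of_real (v (of_real (r n) + z)))) \<le>
       (\<integral>\<^sup>+z. ennreal (norm (F z * of_real (v z) - F z * of_real (v (of_real (r n) + z)))) \<partial>lborel)"
      using i1 i2 by (intro integral_norm_bound_ennreal) auto
    also have "\<dots> \<le> (\<integral>\<^sup>+z. ennreal M * ennreal \<bar>v (of_real (r n) + z) - v z\<bar> \<partial>lborel)"
    proof (intro nn_integral_mono)
      fix z
      have "norm (F z * of_real (v z) - F z * of_real (v (of_real (r n) + z))) = norm (F z) * \<bar>v (of_real (r n) + z) - v z\<bar>"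
        by (simp add: norm_mult abs_minus_commute flip: right_diff_distrib of_real_diff)
      also have "\<dots> \<le> M * \<bar>v (of_real (r n) + z) - v z\<bar>" by (intro mult_right_mono M) auto
      finally show "ennreal (norm (F z * of_real (v z) - F z * of_real (v (of_real (r n) + z)))) \<le> ennreal M * ennreal \<bar>v (of_real (r n) + z) - v z\<bar>"
        using M0 by (simp add: ennreal_mult[symmetric] ennreal_leI)
    qed
    also have "\<dots> = ennreal M * (\<integral>\<^sup>+z. ennreal \<bar>v (of_real (r n) + z) - v z\<bar> \<partial>lborel)"
      by (intro nn_integral_cmult) measurable
    also have "\<dots> \<le> ennreal M * ennreal (r n * V)"
      by (intro mult_left_mono V r) auto
    also have "\<dots> = ennreal (r n * (M * V))"
      using M0 V(1) r[of n] by (simp add: ennreal_mult[symmetric] algebra_simps)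
    finally have "norm (LINT z|lborel. F z * of_real (v z) - F z * of_real (v (of_real (r n) + z))) \<le> r n * (M * V)"
      using M0 V(1) r[of n] by (subst (asm) ennreal_le_iff) auto
    then show ?thesis using r[of n] by (simp add: eq norm_divide divide_le_eq mult.commute)
  qed
  then show ?thesis by (intro tendsto_upperbound[OF tendsto_norm[OF lim]]) auto
qed

lemma linepath_rotate: "linepath (- (\<i> * a)) (- (\<i> * b)) t = - (\<i> * linepath a b t)"
  by (simp add: linepath_def algebra_simps scaleR_conv_of_real)

lemma polygon_integral_rotate:
  "polygon_integral (\<lambda>i. - (\<i> * p i)) n (\<lambda>w. 1 / (w - z)) = polygon_integral p n (\<lambda>w. 1 / (w - \<i> * z))"
proof -
  have "(- (\<i> * b) - - (\<i> * a)) * (1 / (- (\<i> * w) - z)) = (b - a) * (1 / (w - \<i> * z))" for a b w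
  proof -
    have "- (\<i> * b) - - (\<i> * a) = - \<i> * (b - a)" "- (\<i> * w) - z = - \<i> * (w - \<i> * z)" by (simp_all add: algebra_simps)
    then show ?thesis by (simp only: times_divide_eq_right mult_1_right mult_divide_mult_cancel_left[of "- \<i>"]) simp
  qed
  then have "contour_integral (linepath (- (\<i> * a)) (- (\<i> * b))) (\<lambda>w. 1 / (w - z)) = contour_integral (linepath a b) (\<lambda>w. 1 / (w - \<i> * z))" for a b
    unfolding contour_integral_linepath_eq integral_mult_right[symmetric] linepath_rotate by simp
  then show ?thesis by (simp add: polygon_integral_def)
qed

lemma AE_rotate:
  assumes "AE z in lborel. P (z::complex)"
  shows "AE z in lborel. P (\<i> * z)"
proof -
  have [measurable]: "((*) \<i>) \<in> borel_measurable borel"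
    by (intro borel_measurable_continuous_onI continuous_intros)
  show ?thesis
    using assms by (subst (asm) lborel_rotate[symmetric]) (rule AE_distrD[rotated], auto)
qed

text \<open>Almost everywhere both counts equal the same index, by
  \<open>polygon_integral_rotate\<close>; crossings of horizontal and of vertical rays are thereby
  compared without geometry.\<close>

lemma AE_crossings_rotate:
  assumes p: "p n = p 0"
  shows "AE z in lborel. crossings p n (\<i> * z) = crossings (\<lambda>i. - (\<i> * p i)) n z"
  using AE_rotate[OF AE_polygon_crossings[of p, OF p]] AE_polygon_crossings[of "\<lambda>i. - (\<i> * p i)" n] p
  by (simp add: polygon_integral_rotate) (erule (1) eventually_elim2, simp)

lemma integral_Fy_rotate:
  assumes F: "C1c F Fx Fy" and p: "p n = p 0" and [measurable]: "T \<in> borel_measurable borel"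
  shows "(LINT z|lborel. Fy z * of_real (T (crossings p n z))) =
     (LINT z|lborel. Fy (\<i> * z) * of_real (T (crossings (\<lambda>i. - (\<i> * p i)) n z)))"
proof -
  note [measurable] = C1c_measurable[OF F]
  have "(LINT z|lborel. Fy z * of_real (T (crossings p n z))) = (LINT z|lborel. Fy (\<i> * z) * of_real (T (crossings p n (\<i> * z))))"
    by (rule integral_rotate[symmetric]) measurable
  also have "\<dots> = (LINT z|lborel. Fy (\<i> * z) * of_real (T (crossings (\<lambda>i. - (\<i> * p i)) n z)))"
    using AE_crossings_rotate[of p, OF p] by (intro integral_cong_AE) (auto elim!: eventually_mono)
  finally show ?thesis .
qed

lemma polygon_length_rotate: "polygon_length (\<lambda>i. - (\<i> * p i)) n = polygon_length p n"
proof -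
  have "norm (- (\<i> * b) - - (\<i> * a)) = norm (- \<i> * (b - a))" for a b :: complex
    by (simp add: algebra_simps)
  then show ?thesis by (simp add: polygon_length_def norm_mult)
qed

text \<open>Truncation is 1-Lipschitz, so the shift estimate for the crossing numbers passes to
  their truncation with a constant that is free of \<open>N\<close>. The vertical derivative is
  reduced to the horizontal one by rotation.\<close>

lemma polygon_truncated_bound:
  assumes F: "C1c F Fx Fy" and p: "p n = p 0" and M: "\<And>z. norm (F z) \<le> M" and N: "N \<ge> 0"
  shows "norm (LINT z|lborel. Fx z * of_real (truncate N (crossings p n z))) \<le> M * polygon_length p n"
    and "norm (LINT z|lborel. Fy z * of_real (truncate N (crossings p n z))) \<le> M * polygon_length p n"
proof -
  have x: "norm (LINT z|lborel. Fx z * of_real (truncate N (crossings p n z))) \<le> M * polygon_length p n"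
    if F: "C1c F Fx Fy" and M: "\<And>z. norm (F z) \<le> M" for F Fx Fy p
  proof (rule integral_partial_bound[OF F _ truncate_bound[OF N] _ _ M])
    show "0 \<le> polygon_length p n" by (simp add: polygon_length_def sum_nonneg)
    show "(\<integral>\<^sup>+z. ennreal \<bar>truncate N (crossings p n (of_real h + z)) - truncate N (crossings p n z)\<bar> \<partial>lborel) \<le> ennreal (h * polygon_length p n)"
      if "h > 0" for h
      by (rule order_trans[OF nn_integral_mono crossings_shift_integral[OF that]]) (intro ennreal_leI truncate_lipschitz)
  qed measurable
  show "norm (LINT z|lborel. Fx z * of_real (truncate N (crossings p n z))) \<le> M * polygon_length p n"
    by (rule x[OF F M])
  show "norm (LINT z|lborel. Fy z * of_real (truncate N (crossings p n z))) \<le> M * polygon_length p n"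
    using x[OF C1c_rotate[OF F] M, of "\<lambda>i. - (\<i> * p i)"] integral_Fy_rotate[OF F p]
    unfolding polygon_length_rotate by simp
qed

text \<open>The factor \<open>\<i> * Fx z - Fy z\<close> is \<open>2 * \<i> * dbar F z\<close>. The
  first part integrates to F dy along the edges, the second, after rotation, to -F dx; they combine
  to F dz.\<close>

lemma polygon_green:
  assumes F: "C1c F Fx Fy" and p: "p n = p 0"
  shows "(LINT z|lborel. (\<i> * Fx z - Fy z) * of_real (crossings p n z)) = polygon_integral p n F"
proof -
  have x: "(LINT z|lborel. Fx z * of_real (crossings p n z)) =
     (\<Sum>i<n. of_real (Im (p (Suc i)) - Im (p i)) * integral {0..1} (\<lambda>t. F (linepath (p i) (p (Suc i)) t)))"
    if F: "C1c F Fx Fy" for F Fx Fy p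
  proof -
    have "(LINT z|lborel. Fx z * of_real (crossings p n z)) =
       (LINT z|lborel. (\<Sum>i<n. Fx z * of_real (crossing (p i) (p (Suc i)) z)))"
      by (simp add: crossings_def sum_distrib_left)
    also have "\<dots> = (\<Sum>i<n. LINT z|lborel. Fx z * of_real (crossing (p i) (p (Suc i)) z))"
      by (intro Bochner_Integration.integral_sum C1c_integrable_mult(2)[OF F, of _ 1]) (auto simp: crossing_le_1)
    finally show ?thesis by (simp add: edge_integral[OF F])
  qed
  have y: "(LINT z|lborel. Fy z * of_real (crossings p n z)) =
     (\<Sum>i<n. - of_real (Re (p (Suc i)) - Re (p i)) * integral {0..1} (\<lambda>t. F (linepath (p i) (p (Suc i)) t)))"
    using integral_Fy_rotate[OF F p, of "\<lambda>x. x"] x[OF C1c_rotate[OF F], of "\<lambda>i. - (\<i> * p i)"]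
    by (simp add: linepath_rotate)
  have i: "integrable lborel (\<lambda>z. Fx z * of_real (crossings p n z))" "integrable lborel (\<lambda>z. Fy z * of_real (crossings p n z))"
    by (intro C1c_integrable_mult[OF F, of _ "real n"]; simp add: crossings_le)+
  have "(LINT z|lborel. (\<i> * Fx z - Fy z) * of_real (crossings p n z)) =
    \<i> * (LINT z|lborel. Fx z * of_real (crossings p n z)) - (LINT z|lborel. Fy z * of_real (crossings p n z))"
    using i by (simp add: left_diff_distrib mult.assoc)
  also have "\<dots> = (\<Sum>i<n. (p (Suc i) - p i) * integral {0..1} (\<lambda>t. F (linepath (p i) (p (Suc i)) t)))"
    unfolding x[OF F] y sum_distrib_left sum_subtractf[symmetric]
  proof (rule sum.cong[OF refl])
    fix i
    have e: "p (Suc i) - p i = \<i> * of_real (Im (p (Suc i)) - Im (p i)) + of_real (Re (p (Suc i)) - Re (p i))"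
      by (simp add: complex_eq_iff)
    show "\<i> * (of_real (Im (p (Suc i)) - Im (p i)) * integral {0..1} (\<lambda>t. F (linepath (p i) (p (Suc i)) t))) -
       - of_real (Re (p (Suc i)) - Re (p i)) * integral {0..1} (\<lambda>t. F (linepath (p i) (p (Suc i)) t)) =
       (p (Suc i) - p i) * integral {0..1} (\<lambda>t. F (linepath (p i) (p (Suc i)) t))"
      unfolding e by (simp only: distrib_right mult.assoc diff_minus_eq_add minus_mult_left[symmetric])
  qed
  finally show ?thesis by (simp add: polygon_integral_def contour_integral_linepath_eq)
qed

text \<open>Integrating over all heights counts each edge with its vertical extent.\<close>

lemma nn_integral_sides_le:
  "(\<integral>\<^sup>+y. ennreal (\<Sum>i<n. \<bar>edge_side (p i) (p (Suc i)) y\<bar>) \<partial>lborel) \<le> ennreal (polygon_length p n)"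
proof -
  have "(\<integral>\<^sup>+y. ennreal (\<Sum>i<n. \<bar>edge_side (p i) (p (Suc i)) y\<bar>) \<partial>lborel) =
     (\<Sum>i<n. \<integral>\<^sup>+y. ennreal \<bar>edge_side (p i) (p (Suc i)) y\<bar> \<partial>lborel)"
    unfolding edge_side_def by (simp add: sum_ennreal[symmetric] del: sum_ennreal) (rule nn_integral_sum, measurable)
  also have "\<dots> = (\<Sum>i<n. ennreal \<bar>Im (p (Suc i)) - Im (p i)\<bar>)"
  proof (rule sum.cong[OF refl])
    fix i
    let ?lo = "min (Im (p i)) (Im (p (Suc i)))" and ?hi = "max (Im (p i)) (Im (p (Suc i)))"
    have "(\<integral>\<^sup>+y. ennreal \<bar>edge_side (p i) (p (Suc i)) y\<bar> \<partial>lborel) = (\<integral>\<^sup>+y. indicator {?lo<..<?hi} y \<partial>lborel)"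
      by (intro nn_integral_cong) (auto simp: edge_side_def indicator_def)
    also have "\<dots> = ennreal (?hi - ?lo)" by simp
    finally show "(\<integral>\<^sup>+y. ennreal \<bar>edge_side (p i) (p (Suc i)) y\<bar> \<partial>lborel) = ennreal \<bar>Im (p (Suc i)) - Im (p i)\<bar>"
      by (simp add: max_def min_def abs_if split: if_splits)
  qed
  also have "\<dots> = ennreal (\<Sum>i<n. \<bar>Im (p (Suc i)) - Im (p i)\<bar>)" by (simp add: sum_ennreal)
  also have "\<dots> \<le> ennreal (polygon_length p n)" by (intro ennreal_leI sum_abs_Im_le_length)
  finally show ?thesis .
qed

text \<open>The crossing number at \<open>z\<close> is at most the number of edges met by the horizontal line through
  \<open>z\<close>, and after rotation also of those met by the vertical line; the product of the two bounds
  separates the variables.\<close>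

lemma polygon_isoperimetric:
  assumes p: "p n = p 0"
  shows "(\<integral>\<^sup>+z. ennreal ((crossings p n z)\<^sup>2) \<partial>lborel) \<le> ennreal ((polygon_length p n)\<^sup>2)"
proof -
  define A where "A p y = (\<Sum>i<n. \<bar>edge_side (p i) (p (Suc i)) y\<bar>)" for p y
  have A_meas[measurable]: "A p \<in> borel_measurable borel" for p
    unfolding A_def[abs_def] edge_side_def by measurable
  have A0: "A p y \<ge> 0" for p y by (simp add: A_def sum_nonneg)
  have A: "\<bar>crossings p n z\<bar> \<le> A p (Im z)" for p z
    unfolding crossings_def A_def by (rule order_trans[OF sum_abs sum_mono]) (simp add: crossing_def)
  \<comment> \<open>The polygon turned back by a quarter. At the point \<open>\<i> * z\<close> one
    factor of the square is bounded through \<open>?q\<close> and \<open>Im z\<close>, the other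
    through \<open>p\<close> and \<open>Re z\<close>.\<close>
  let ?q = "\<lambda>i. - (\<i> * p i)"
  have "(\<integral>\<^sup>+z. ennreal ((crossings p n z)\<^sup>2) \<partial>lborel) = (\<integral>\<^sup>+z. ennreal ((crossings p n (\<i> * z))\<^sup>2) \<partial>lborel)"
    by (rule nn_integral_rotate[symmetric]) measurable
  also have "\<dots> \<le> (\<integral>\<^sup>+z. ennreal (A ?q (Im z)) * ennreal (A p (Re z)) \<partial>lborel)"
  proof (rule nn_integral_mono_AE)
    show "AE z in lborel. ennreal ((crossings p n (\<i> * z))\<^sup>2) \<le> ennreal (A ?q (Im z)) * ennreal (A p (Re z))"
      using AE_crossings_rotate[of p, OF p]
    proof eventually_elim
      fix z assume "crossings p n (\<i> * z) = crossings ?q n z"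
      then have "(crossings p n (\<i> * z))\<^sup>2 = \<bar>crossings ?q n z\<bar> * \<bar>crossings p n (\<i> * z)\<bar>"
        by (simp add: power2_eq_square flip: abs_mult)
      also have "\<dots> \<le> A ?q (Im z) * A p (Im (\<i> * z))"
        by (intro mult_mono A A0) auto
      finally show "ennreal ((crossings p n (\<i> * z))\<^sup>2) \<le> ennreal (A ?q (Im z)) * ennreal (A p (Re z))"
        by (simp add: ennreal_mult[symmetric] A0 ennreal_leI)
    qed
  qed
  also have "\<dots> = (\<integral>\<^sup>+y. \<integral>\<^sup>+x. ennreal (A ?q y) * ennreal (A p x) \<partial>lborel \<partial>lborel)"
    by (subst nn_integral_complex) auto
  also have "\<dots> = (\<integral>\<^sup>+y. ennreal (A ?q y) \<partial>lborel) * (\<integral>\<^sup>+x. ennreal (A p x) \<partial>lborel)"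
    by (simp add: nn_integral_cmult nn_integral_multc)
  also have "\<dots> \<le> ennreal (polygon_length ?q n) * ennreal (polygon_length p n)"
    unfolding A_def by (intro mult_mono nn_integral_sides_le) auto
  also have "\<dots> = ennreal ((polygon_length p n)\<^sup>2)"
    unfolding polygon_length_rotate
    by (subst ennreal_mult[symmetric]) (auto simp: polygon_length_def sum_nonneg power2_eq_square)
  finally show ?thesis .
qed

section \<open>The index of a closed rectifiable curve\<close>

locale rectifiable_loop =
  fixes g :: "real \<Rightarrow> complex" and v :: "real \<Rightarrow> real"
  assumes dominated: "variation_dominated g v"
    and cont: "continuous_on {0..1} g"
    and closed_loop: "g 0 = g 1"
begin

definition L :: real where "L = v 1 - v 0"

definition trace :: "complex set" where "trace = g ` {0..1}"

text \<open>This is \<open>curve_index\<close> with its definitions unfolded, so the two agree by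
  rewriting once \<open>g\<close> is a \<open>circle_param\<close>.\<close>

definition index :: "complex \<Rightarrow> complex" where
  "index z = 1 / (2 * of_real pi * \<i>) * (THE I. has_RS_integral (\<lambda>t. 1 / (g t - z)) g 0 1 I)"

text \<open>A real, total version of the index. The value 0 on the null set \<open>trace\<close>
  lets bounds by \<open>\<bar>wind z\<bar>\<close> hold at every point for functions that vanish on
  the curve.\<close>

definition wind :: "complex \<Rightarrow> real" where
  "wind z = (if z \<in> trace then 0 else Re (index z))"

lemma L_nonneg: "L \<ge> 0"
  using variation_dominated_mono[OF dominated, of 0 1] by (simp add: L_def)

lemma compact_trace: "compact trace"
  unfolding trace_def by (intro compact_continuous_image cont compact_Icc)

lemma closed_trace: "closed trace"
  by (intro compact_imp_closed compact_trace)

lemma trace_nonempty: "trace \<noteq> {}"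
  by (simp add: trace_def)

lemma kernel_integral:
  assumes "z \<notin> trace"
  shows "has_RS_integral (\<lambda>t. 1 / (g t - z)) g 0 1 (2 * of_real pi * \<i> * index z)"
proof -
  have "continuous_on {0..1} (\<lambda>t. 1 / (g t - z))"
    using assms cont by (intro continuous_intros) (auto simp: trace_def)
  from has_RS_integral_exists[OF dominated this]
  obtain I where I: "has_RS_integral (\<lambda>t. 1 / (g t - z)) g 0 1 I" by blast
  then have "(THE I. has_RS_integral (\<lambda>t. 1 / (g t - z)) g 0 1 I) = I"
    by (intro the_equality) (auto intro: has_RS_integral_unique)
  then show ?thesis using I by (simp add: index_def)
qed

lemma inscribed_closed: "inscribed g n n = inscribed g n 0"
  using closed_loop by (cases "n = 0") (auto simp: inscribed_def)

lemma inscribed_length_le: "polygon_length (inscribed g n) n \<le> L"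
  using inscribed_length(2)[OF dominated] by (simp add: polygon_length_def L_def)

lemma polygon_index_tendsto:
  assumes "z \<notin> trace"
  shows "(\<lambda>n. polygon_integral (inscribed g n) n (\<lambda>w. 1 / (w - z)) / (2 * of_real pi * \<i>)) \<longlonglongrightarrow> index z"
proof -
  have "(\<lambda>n. polygon_integral (inscribed g n) n (\<lambda>w. 1 / (w - z))) \<longlonglongrightarrow> 2 * of_real pi * \<i> * index z"
    using assms by (intro polygon_kernel_tendsto[OF dominated cont] kernel_integral) (simp_all add: trace_def)
  from tendsto_divide[OF this tendsto_const, of "2 * of_real pi * \<i>"] show ?thesis by simp
qed

text \<open>A limit of indices of inscribed polygons, which are integers as soon as the edges avoid
  \<open>z\<close>.\<close>

lemma index_Ints:
  assumes "z \<notin> trace"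
  shows "index z \<in> \<int>"
proof -
  obtain d where d: "d > 0"
    "\<forall>\<^sub>F n in sequentially. \<forall>i<n. \<forall>w\<in>closed_segment (inscribed g n i) (inscribed g n (Suc i)). d \<le> norm (w - z)"
    using eventually_inscribed_avoids[OF cont, of z] assms unfolding trace_def by blast
  have "\<forall>\<^sub>F n in sequentially. polygon_integral (inscribed g n) n (\<lambda>w. 1 / (w - z)) / (2 * of_real pi * \<i>) \<in> \<int>"
    using d(2)
  proof eventually_elim
    case (elim n)
    show ?case
      by (rule polygon_index_Ints[where p = "inscribed g n", OF _ inscribed_closed]) (use elim d(1) in force)
  qed
  then show ?thesis
    using polygon_index_tendsto[OF assms] closed_Ints by (intro Lim_in_closed_set[of "\<int>"]) auto
qed

lemma index_lipschitz:
  assumes "d > 0" "\<And>t. t \<in> {0..1} \<Longrightarrow> d \<le> norm (g t - z)" "\<And>t. t \<in> {0..1} \<Longrightarrow> d \<le> norm (g t - z')"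
  shows "norm (index z - index z') \<le> L / d\<^sup>2 * norm (z - z')"
proof -
  have nt: "z \<notin> trace" "z' \<notin> trace" using assms by (force simp: trace_def)+
  have "norm (2 * of_real pi * \<i> * index z - 2 * of_real pi * \<i> * index z') \<le> (norm (z - z') / d\<^sup>2) * (v 1 - v 0)"
  proof (rule has_RS_integral_bound[OF has_RS_integral_diff[OF kernel_integral[OF nt(1)] kernel_integral[OF nt(2)]] dominated])
    fix t :: real assume t: "t \<in> {0..1}"
    have "norm (g t - z) > 0" "norm (g t - z') > 0" using assms(1) assms(2)[OF t] assms(3)[OF t] by linarith+
    then have ne: "g t - z \<noteq> 0" "g t - z' \<noteq> 0" by auto
    then have "1 / (g t - z) - 1 / (g t - z') = (z - z') / ((g t - z) * (g t - z'))"
      by (simp add: diff_frac_eq)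
    then have "norm (1 / (g t - z) - 1 / (g t - z')) = norm (z - z') / (norm (g t - z) * norm (g t - z'))"
      by (simp add: norm_divide norm_mult)
    also have "\<dots> \<le> norm (z - z') / d\<^sup>2"
      unfolding power2_eq_square using assms(1) assms(2)[OF t] assms(3)[OF t]
      by (intro divide_left_mono mult_mono mult_pos_pos) auto
    finally show "norm (1 / (g t - z) - 1 / (g t - z')) \<le> norm (z - z') / d\<^sup>2" .
  qed
  also have "2 * of_real pi * \<i> * index z - 2 * of_real pi * \<i> * index z' = 2 * of_real pi * \<i> * (index z - index z')"
    by (simp add: algebra_simps)
  finally have *: "2 * pi * norm (index z - index z') \<le> L / d\<^sup>2 * norm (z - z')"
    by (simp add: norm_mult L_def mult.commute)
  have "norm (index z - index z') \<le> 2 * pi * norm (index z - index z')"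
    using mult_right_mono[of 1 "2 * pi" "norm (index z - index z')"] pi_gt3 by simp
  with * show ?thesis by linarith
qed

lemma trace_separated:
  assumes "z \<notin> trace"
  obtains d where "d > 0" "\<And>t. t \<in> {0..1} \<Longrightarrow> d \<le> norm (g t - z)"
proof -
  obtain d where "d > 0" "\<And>w. w \<in> trace \<Longrightarrow> d \<le> dist z w"
    using separate_point_closed[OF closed_trace assms] by blast
  then show thesis using that[of d] by (metis dist_norm norm_minus_commute imageI trace_def)
qed

lemma index_continuous: "continuous_on (- trace) index"
proof (rule continuous_at_imp_continuous_on, clarify)
  fix z assume z: "z \<notin> trace"
  obtain d where d: "d > 0" "\<And>t. t \<in> {0..1} \<Longrightarrow> d \<le> norm (g t - z)" using trace_separated[OF z] by blast
  have "\<forall>\<^sub>F z' in at z. norm (index z' - index z) \<le> L / (d/2)\<^sup>2 * norm (z' - z)"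
    using eventually_at_ball[OF half_gt_zero[OF d(1)], of z UNIV]
  proof eventually_elim
    case (elim z')
    show ?case
    proof (rule index_lipschitz)
      fix t :: real assume t: "t \<in> {0..1}"
      show "d/2 \<le> norm (g t - z)" using d t by fastforce
      show "d/2 \<le> norm (g t - z')"
        using d(2)[OF t] elim norm_triangle_sub[of "g t - z" "g t - z'"] by (simp add: dist_norm norm_minus_commute)
    qed (use d in simp)
  qed
  then have "((\<lambda>z'. index z' - index z) \<longlongrightarrow> 0) (at z)"
    by (rule Lim_null_comparison) (use d in \<open>auto intro!: tendsto_eq_intros\<close>)
  then show "isCont index z" unfolding isCont_def by (rule LIM_zero_cancel)
qed

text \<open>A continuous function whose distinct values are at least 1 apart cannot vary on a
  connected set.\<close>

lemma index_constant:
  assumes "connected S" "S \<inter> trace = {}" "z \<in> S" "w \<in> S"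
  shows "index z = index w"
proof -
  have "index constant_on S"
  proof (rule continuous_discrete_range_constant[OF assms(1)])
    show "continuous_on S index" using assms(2) by (intro continuous_on_subset[OF index_continuous]) auto
    fix x assume x: "x \<in> S"
    show "\<exists>e>0. \<forall>y. y \<in> S \<and> index y \<noteq> index x \<longrightarrow> e \<le> norm (index y - index x)"
    proof (intro exI[of _ 1] conjI allI impI)
      fix y assume y: "y \<in> S \<and> index y \<noteq> index x"
      then have "index y - index x \<in> \<int>" using x assms(2) by (intro Ints_diff index_Ints) auto
      then obtain k :: int where "index y - index x = of_int k" by (auto elim: Ints_cases)
      then show "1 \<le> norm (index y - index x)" using y by (cases "k = 0") auto
    qed simp
  qed
  then show ?thesis using assms(3,4) unfolding constant_on_def by metis
qed

lemma wind_index: "z \<notin> trace \<Longrightarrow> of_real (wind z) = index z"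
  using index_Ints[of z] by (auto simp: wind_def elim!: Ints_cases)

lemma wind_Ints: "wind z \<in> \<int>"
  using index_Ints[of z] by (auto simp: wind_def elim!: Ints_cases)

lemma wind_constant:
  "connected S \<Longrightarrow> S \<inter> trace = {} \<Longrightarrow> z \<in> S \<Longrightarrow> w \<in> S \<Longrightarrow> wind z = wind w"
  using index_constant[of S z w] by (auto simp: wind_def)

text \<open>Integrality: a nonzero value has modulus at least 1. This turns the L^2 bound into
  integrability over the whole plane.\<close>

lemma wind_abs_le_square: "\<bar>wind z\<bar> \<le> (wind z)\<^sup>2"
proof -
  obtain k :: int where k: "wind z = of_int k" using wind_Ints[of z] by (auto elim: Ints_cases)
  have "\<bar>k\<bar> * 1 \<le> \<bar>k\<bar> * \<bar>k\<bar>" by (cases "k = 0") (simp, intro mult_left_mono, auto)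
  then have "\<bar>k\<bar> \<le> k\<^sup>2" by (simp add: power2_eq_square)
  then have "real_of_int \<bar>k\<bar> \<le> real_of_int (k\<^sup>2)" by (simp only: of_int_le_iff)
  then show ?thesis by (simp add: k)
qed

text \<open>At distance \<open>L + 1\<close> the kernel integral has modulus at most
  \<open>L / (L + 1)\<close>, so the index is an integer of modulus less than 1.\<close>

lemma index_far:
  assumes "\<And>t. t \<in> {0..1} \<Longrightarrow> L + 1 \<le> norm (g t - z)"
  shows "z \<notin> trace" "index z = 0"
proof -
  show z: "z \<notin> trace" using assms L_nonneg by (force simp: trace_def)
  have "norm (2 * of_real pi * \<i> * index z) \<le> (1 / (L + 1)) * (v 1 - v 0)"
  proof (rule has_RS_integral_bound[OF kernel_integral[OF z] dominated])
    fix t :: real assume "t \<in> {0..1}"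
    from assms[OF this] L_nonneg show "norm (1 / (g t - z)) \<le> 1 / (L + 1)"
      by (auto simp: norm_divide intro!: divide_left_mono mult_pos_pos)
  qed
  also have "\<dots> < 1" using L_nonneg by (simp add: L_def[symmetric])
  finally have *: "2 * pi * norm (index z) < 1" by (simp add: norm_mult)
  have "norm (index z) \<le> 2 * pi * norm (index z)"
    using mult_right_mono[of 1 "2 * pi" "norm (index z)"] pi_gt3 by simp
  with * have "norm (index z) < 1" by linarith
  moreover obtain k :: int where "index z = of_int k" using index_Ints[OF z] by (auto elim: Ints_cases)
  ultimately show "index z = 0" by simp
qed

lemma bounded_index:
  obtains R where "R > 0" "\<And>z. norm z > R \<Longrightarrow> z \<notin> trace \<and> index z = 0"
proof -
  obtain B where B: "\<And>w. w \<in> trace \<Longrightarrow> norm w \<le> B" "B > 0"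
    using compact_imp_bounded[OF compact_trace] unfolding bounded_pos by blast
  have far: "z \<notin> trace \<and> index z = 0" if "norm z > B + L + 1" for z
  proof -
    have "L + 1 \<le> norm (g t - z)" if "t \<in> {0..1}" for t
    proof -
      have "norm (g t) \<le> B" using B(1) that by (simp add: trace_def)
      then show ?thesis using \<open>norm z > B + L + 1\<close> norm_triangle_ineq2[of z "g t"] by (simp add: norm_minus_commute)
    qed
    then show ?thesis using index_far[of z] by blast
  qed
  then show thesis using that[of "B + L + 1"] B(2) L_nonneg by simp
qed

text \<open>The curve is cut where \<open>v\<close> has grown by \<open>e\<close>, so each piece has
  variation at most \<open>e\<close> and fits in one ball around any of its points.\<close>

lemma trace_cover:
  assumes e: "e > 0"
  obtains m c where "real m \<le> L / e + 1" "trace \<subseteq> (\<Union>j<m. cball (c j) e)"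
proof -
  \<comment> \<open>Cells are level bands of \<open>v\<close>, which may jump; a band can be empty,
    and then its \<open>c j\<close> is an arbitrary centre that covers nothing relevant.\<close>
  define cell where "cell j = {t \<in> {0..1}. v 0 + real j * e \<le> v t \<and> v t \<le> v 0 + (real j + 1) * e}" for j :: nat
  define m where "m = nat \<lfloor>L / e\<rfloor> + 1"
  define c where "c j = g (SOME t. t \<in> cell j)" for j
  have "g t \<in> (\<Union>j<m. cball (c j) e)" if t: "t \<in> {0..1}" for t
  proof -
    define x where "x = (v t - v 0) / e"
    define j where "j = nat \<lfloor>x\<rfloor>"
    have vt: "v 0 \<le> v t" "v t \<le> v 1" using t variation_dominated_mono[OF dominated] by auto
    then have x: "0 \<le> x" "x \<le> L / e" using e by (auto simp: x_def L_def divide_right_mono)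
    have jx: "real j \<le> x" "x \<le> real j + 1" using x(1) by (auto simp: j_def of_nat_nat)
    have "x * e = v t - v 0" using e by (simp add: x_def)
    then have "t \<in> cell j" using jx e t mult_right_mono[OF jx(1), of e] mult_right_mono[OF jx(2), of e] by (auto simp: cell_def)
    then have s: "(SOME t. t \<in> cell j) \<in> cell j" (is "?s \<in> _") by (rule someI)
    have close: "norm (g b - g a) \<le> e" if "a \<in> cell j" "b \<in> cell j" "a \<le> b" for a b
      using variation_dominatedD[OF dominated, of a b] that by (auto simp: cell_def algebra_simps)
    have "norm (g t - g ?s) \<le> e"
      using close[of t ?s] close[of ?s t] s \<open>t \<in> cell j\<close> by (cases "t \<le> ?s") (auto simp: norm_minus_commute)
    moreover have "j < m" using floor_mono[OF x(2)] by (simp add: j_def m_def nat_less_iff le_imp_less_Suc nat_mono)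
    ultimately show ?thesis by (auto simp: c_def dist_norm norm_minus_commute)
  qed
  then have "trace \<subseteq> (\<Union>j<m. cball (c j) e)" unfolding trace_def by blast
  moreover have "real m \<le> L / e + 1" using L_nonneg e by (simp add: m_def of_nat_nat)
  ultimately show thesis by (intro that)
qed

text \<open>Doubling the radius in \<open>trace_cover\<close> covers the neighbourhood by at most
  \<open>L / e + 1\<close> discs of area \<open>4 * pi * e\<^sup>2\<close>; for
  \<open>e \<le> 1\<close> the total is linear in \<open>e\<close>. This rate is what the cutoff
  needs.\<close>

lemma neighbourhood_measure:
  assumes e: "0 < e" "e \<le> 1"
  shows "emeasure lborel {z. infdist z trace \<le> e} \<le> ennreal (4 * pi * (L + 1) * e)"
proof -
  obtain m c where mc: "real m \<le> L / e + 1" "trace \<subseteq> (\<Union>j<m. cball (c j) e)" using trace_cover[OF e(1)] by blast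
  have "{z. infdist z trace \<le> e} \<subseteq> (\<Union>j<m. cball (c j) (2 * e))"
  proof clarify
    fix z assume z: "infdist z trace \<le> e"
    obtain w where w: "w \<in> trace" "infdist z trace = dist z w"
      using infdist_attains_inf[OF closed_trace trace_nonempty] by blast
    obtain j where "j < m" "dist (c j) w \<le> e" using mc(2) w(1) by auto
    then show "z \<in> (\<Union>j<m. cball (c j) (2 * e))"
      using z w(2) dist_triangle[of "c j" z w] by (force simp: dist_commute)
  qed
  then have "emeasure lborel {z. infdist z trace \<le> e} \<le> emeasure lborel (\<Union>j<m. cball (c j) (2 * e))"
    by (rule emeasure_mono) auto
  also have "\<dots> \<le> (\<Sum>j<m. emeasure lborel (cball (c j) (2 * e)))"
    by (rule emeasure_subadditive_finite) auto
  also have "\<dots> = (\<Sum>j<m. ennreal (pi * (2 * e)\<^sup>2))"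
    using e by (simp add: emeasure_cball unit_ball_vol_2)
  also have "\<dots> = ennreal (real m * (pi * (2 * e)\<^sup>2))"
    using e by (simp add: ennreal_of_nat_eq_real_of_nat ennreal_mult[symmetric])
  also have "\<dots> \<le> ennreal (4 * pi * (L + 1) * e)"
  proof (rule ennreal_leI)
    have "real m * e \<le> L + 1 * e" using mult_right_mono[OF mc(1), of e] e by (simp add: distrib_right)
    then have "real m * e \<le> L + 1" using e by simp
    then have "(real m * e) * (4 * pi * e) \<le> (L + 1) * (4 * pi * e)" using e by (intro mult_right_mono) auto
    then show "real m * (pi * (2 * e)\<^sup>2) \<le> 4 * pi * (L + 1) * e" by (simp add: power2_eq_square algebra_simps)
  qed
  finally show ?thesis .
qed

lemma trace_null: "trace \<in> null_sets lborel"
proof -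
  have "emeasure lborel trace = 0"
  proof (rule ccontr)
    assume n: "emeasure lborel trace \<noteq> 0"
    define C where "C = 4 * pi * (L + 1)"
    have C: "C > 0" using L_nonneg by (simp add: C_def)
    have le: "emeasure lborel trace \<le> ennreal (C * e)" if "0 < e" "e \<le> 1" for e
    proof -
      have "emeasure lborel trace \<le> emeasure lborel {z. infdist z trace \<le> e}"
        using that by (intro emeasure_mono) (auto intro!: borel_closed closed_Collect_le continuous_intros)
      then show ?thesis using neighbourhood_measure[OF that] by (simp add: C_def)
    qed
    obtain r where r: "emeasure lborel trace = ennreal r" "r > 0"
      using le[of 1] n by (cases "emeasure lborel trace") (auto simp: top_unique)
    have "ennreal r \<le> ennreal (C * min 1 (r / (2 * C)))"
      using le[of "min 1 (r / (2 * C))"] r C by simp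
    then have "r \<le> C * min 1 (r / (2 * C))" using C r(2) by (subst (asm) ennreal_le_iff) auto
    also have "\<dots> \<le> C * (r / (2 * C))" using C by (intro mult_left_mono) auto
    finally show False using C r(2) by simp
  qed
  then show ?thesis using closed_trace by auto
qed

lemma AE_not_trace: "AE z in lborel. z \<notin> trace"
  by (rule AE_not_in[OF trace_null])

lemma wind_measurable [measurable]: "wind \<in> borel_measurable borel"
proof -
  have "(\<lambda>z. if z \<in> - trace then Re (index z) else 0) \<in> borel_measurable borel"
    using closed_trace by (intro borel_measurable_continuous_on_if)
      (auto intro!: continuous_intros index_continuous)
  moreover have "wind = (\<lambda>z. if z \<in> - trace then Re (index z) else 0)" by (auto simp: wind_def)
  ultimately show ?thesis by simp
qed

abbreviation cr :: "nat \<Rightarrow> complex \<Rightarrow> real" where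
  "cr n \<equiv> crossings (inscribed g n) n"

lemma crossings_tendsto: "AE z in lborel. (\<lambda>n. cr n z) \<longlonglongrightarrow> wind z"
proof -
  have "AE z in lborel. \<forall>n. polygon_integral (inscribed g n) n (\<lambda>w. 1 / (w - z)) = 2 * of_real pi * \<i> * of_real (cr n z)"
    unfolding AE_all_countable by (intro allI AE_polygon_crossings inscribed_closed)
  with AE_not_trace show ?thesis
  proof eventually_elim
    case (elim z)
    then have "(\<lambda>n. of_real (cr n z) :: complex) \<longlonglongrightarrow> index z"
      using polygon_index_tendsto[of z] by simp
    then have "(\<lambda>n. of_real (cr n z) :: complex) \<longlonglongrightarrow> of_real (wind z)" using wind_index elim by simp
    then show ?case by (simp only: tendsto_of_real_iff)
  qed
qed

lemma crossings_square: "(\<integral>\<^sup>+z. ennreal ((cr n z)\<^sup>2) \<partial>lborel) \<le> ennreal (L\<^sup>2)"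
proof -
  have "(\<integral>\<^sup>+z. ennreal ((cr n z)\<^sup>2) \<partial>lborel) \<le> ennreal ((polygon_length (inscribed g n) n)\<^sup>2)"
    by (rule polygon_isoperimetric[where p = "inscribed g n", OF inscribed_closed])
  also have "\<dots> \<le> ennreal (L\<^sup>2)"
    using inscribed_length_le by (intro ennreal_leI power_mono) (auto simp: polygon_length_def sum_nonneg)
  finally show ?thesis .
qed

text \<open>Fatou's lemma along the inscribed polygons, whose isoperimetric bounds are
  uniform.\<close>

lemma wind_square: "(\<integral>\<^sup>+z. ennreal ((wind z)\<^sup>2) \<partial>lborel) \<le> ennreal (L\<^sup>2)"
proof -
  have "(\<integral>\<^sup>+z. ennreal ((wind z)\<^sup>2) \<partial>lborel) = (\<integral>\<^sup>+z. liminf (\<lambda>n. ennreal ((cr n z)\<^sup>2)) \<partial>lborel)"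
    using crossings_tendsto
  proof (intro nn_integral_cong_AE, eventually_elim)
    case (elim z)
    then have "(\<lambda>n. ennreal ((cr n z)\<^sup>2)) \<longlonglongrightarrow> ennreal ((wind z)\<^sup>2)" by (intro tendsto_ennrealI tendsto_power)
    then show ?case by (metis lim_imp_Liminf trivial_limit_sequentially)
  qed
  also have "\<dots> \<le> liminf (\<lambda>n. \<integral>\<^sup>+z. ennreal ((cr n z)\<^sup>2) \<partial>lborel)"
    by (rule nn_integral_liminf) measurable
  also have "\<dots> \<le> ennreal (L\<^sup>2)"
    by (rule Liminf_le[OF sequentially_bot]) (intro always_eventually allI crossings_square)
  finally show ?thesis .
qed

lemma wind_square_integrable: "integrable lborel (\<lambda>z. (wind z)\<^sup>2)"
  using wind_square by (intro integrableI_bounded) (auto simp: le_less_trans)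

lemma wind_integrable: "integrable lborel wind"
  using wind_abs_le_square by (intro Bochner_Integration.integrable_bound[OF wind_square_integrable]) auto

lemma truncation_error:
  fixes G :: "complex \<Rightarrow> complex"
  assumes [measurable]: "G \<in> borel_measurable borel" and G: "\<And>z. norm (G z) \<le> K"
    and [measurable]: "u \<in> borel_measurable borel" and u: "(\<integral>\<^sup>+z. ennreal ((u z)\<^sup>2) \<partial>lborel) \<le> ennreal (L\<^sup>2)"
    and i: "integrable lborel (\<lambda>z. G z * of_real (u z))" "integrable lborel (\<lambda>z. G z * of_real (truncate N (u z)))"
    and N: "N > 0"
  shows "norm ((LINT z|lborel. G z * of_real (u z)) - (LINT z|lborel. G z * of_real (truncate N (u z)))) \<le> K / N * L\<^sup>2"
proof -
  have K: "K \<ge> 0" using G[of 0] norm_ge_zero order_trans by blast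
  have "ennreal (norm (LINT z|lborel. G z * of_real (u z) - G z * of_real (truncate N (u z)))) \<le>
      (\<integral>\<^sup>+z. ennreal (norm (G z * of_real (u z) - G z * of_real (truncate N (u z)))) \<partial>lborel)"
    using i by (intro integral_norm_bound_ennreal) auto
  also have "\<dots> \<le> (\<integral>\<^sup>+z. ennreal (K / N) * ennreal ((u z)\<^sup>2) \<partial>lborel)"
  proof (intro nn_integral_mono)
    fix z
    have "norm (G z * of_real (u z) - G z * of_real (truncate N (u z))) = norm (G z) * \<bar>u z - truncate N (u z)\<bar>"
      by (simp add: norm_mult flip: right_diff_distrib of_real_diff)
    also have "\<dots> \<le> K * ((u z)\<^sup>2 / N)" by (intro mult_mono G truncate_error N K) auto
    finally show "ennreal (norm (G z * of_real (u z) - G z * of_real (truncate N (u z)))) \<le> ennreal (K / N) * ennreal ((u z)\<^sup>2)"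
      using K N by (simp add: ennreal_mult[symmetric] ennreal_leI)
  qed
  also have "\<dots> = ennreal (K / N) * (\<integral>\<^sup>+z. ennreal ((u z)\<^sup>2) \<partial>lborel)"
    by (intro nn_integral_cmult) measurable
  also have "\<dots> \<le> ennreal (K / N) * ennreal (L\<^sup>2)" by (intro mult_left_mono u) auto
  also have "\<dots> = ennreal (K / N * L\<^sup>2)" using K N by (simp add: ennreal_mult[symmetric])
  finally show ?thesis using i K N by (subst (asm) ennreal_le_iff) auto
qed

text \<open>Truncation supplies the dominating function: the crossing numbers themselves are bounded
  pointwise only by the number of edges.\<close>

lemma truncated_tendsto:
  fixes G :: "complex \<Rightarrow> complex"
  assumes [measurable]: "G \<in> borel_measurable borel" and G: "\<And>z. norm (G z) \<le> K" "\<And>z. norm z > R \<Longrightarrow> G z = 0"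
    and N: "N > 0"
  shows "(\<lambda>n. LINT z|lborel. G z * of_real (truncate N (cr n z))) \<longlonglongrightarrow> (LINT z|lborel. G z * of_real (truncate N (wind z)))"
proof (rule integral_dominated_convergence[where w = "\<lambda>z. K * N * indicator (cball 0 R) z"])
  have K: "K \<ge> 0" using G(1)[of 0] norm_ge_zero order_trans by blast
  show "integrable lborel (\<lambda>z::complex. K * N * indicator (cball 0 R) z :: real)"
    by (intro integrable_mult_right integrable_real_indicator) (auto intro: emeasure_bounded_finite[OF bounded_cball, unfolded infinity_ennreal_def])
  show "AE z in lborel. (\<lambda>n. G z * of_real (truncate N (cr n z))) \<longlonglongrightarrow> G z * of_real (truncate N (wind z))"
    using crossings_tendsto unfolding truncate_def
    by eventually_elim (intro tendsto_intros)
  fix n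
  have "norm (G z * of_real (truncate N (cr n z))) \<le> K * N * indicator (cball 0 R) z" for z
  proof (cases "norm z > R")
    case True
    then show ?thesis using G(2) by simp
  next
    case False
    have "norm (G z * of_real (truncate N (cr n z))) \<le> K * N"
      unfolding norm_mult using G(1)[of z] truncate_bound[of N "cr n z"] N K by (intro mult_mono) auto
    then show ?thesis using False by simp
  qed
  then show "AE z in lborel. norm (G z * of_real (truncate N (cr n z))) \<le> K * N * indicator (cball 0 R) z" by simp
qed measurable

text \<open>The limit in \<open>polygon_green\<close> is taken after truncation. The truncation
  errors for the polygons and for the limit are each at most \<open>2 * K / N * L\<^sup>2\<close>,
  uniformly in the number of edges, and vanish as \<open>N\<close> grows.\<close>

lemma green:
  assumes F: "C1c F Fx Fy" and I: "has_RS_integral (\<lambda>t. F (g t)) g 0 1 I"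
  shows "(LINT z|lborel. (\<i> * Fx z - Fy z) * of_real (wind z)) = I"
proof -
  note [measurable] = C1c_measurable[OF F]
  define G where "G z = \<i> * Fx z - Fy z" for z
  have G_meas[measurable]: "G \<in> borel_measurable borel" unfolding G_def[abs_def] by measurable
  obtain R K where RK: "K > 0" "R > 0" "\<And>z. norm (Fx z) \<le> K" "\<And>z. norm (Fy z) \<le> K"
     "\<And>z. norm z > R \<Longrightarrow> Fx z = 0" "\<And>z. norm z > R \<Longrightarrow> Fy z = 0"
    using C1c_bounds[OF F] by metis
  have G: "norm (G z) \<le> 2 * K" for z
    using norm_triangle_ineq4[of "\<i> * Fx z" "Fy z"] RK(3,4)[of z] by (simp add: G_def norm_mult)
  have GR: "norm z > R \<Longrightarrow> G z = 0" for z using RK(5,6) by (simp add: G_def)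
  have Gi: "integrable lborel (\<lambda>z. G z * of_real (u z))" if "u \<in> borel_measurable borel" "\<And>z. \<bar>u z\<bar> \<le> B" for u B
  proof (rule integrable_bounded_support[of _ "2 * K * B" R])
    have [measurable]: "u \<in> borel_measurable borel" by fact
    show "(\<lambda>z. G z * of_real (u z)) \<in> borel_measurable borel" by measurable
    show "norm (G z * of_real (u z)) \<le> 2 * K * B" for z
      unfolding norm_mult using G[of z] that(2)[of z] RK(1) by (intro mult_mono) auto
  qed (simp add: GR)
  have Gw: "integrable lborel (\<lambda>z. G z * of_real (wind z))"
  proof (rule Bochner_Integration.integrable_bound)
    show "integrable lborel (\<lambda>z. 2 * K * wind z)" using wind_integrable by simp
    have "norm (G z * of_real (wind z)) \<le> norm (2 * K * wind z)" for z
      using mult_right_mono[OF G[of z], of "\<bar>wind z\<bar>"] RK(1) by (simp add: norm_mult abs_mult)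
    then show "AE z in lborel. norm (G z * of_real (wind z)) \<le> norm (2 * K * wind z)" by simp
  qed measurable
  have poly: "(\<lambda>n. LINT z|lborel. G z * of_real (cr n z)) \<longlonglongrightarrow> I"
    using polygon_integral_tendsto[OF dominated cont C1c_continuous(1)[OF F] I]
    unfolding G_def polygon_green[where p = "inscribed g n" and n = n for n, OF F inscribed_closed] .
  have est: "norm ((LINT z|lborel. G z * of_real (wind z)) - I) \<le> 2 * (2 * K / N * L\<^sup>2)" if N: "N > 0" for N
  proof -
    have "norm ((LINT z|lborel. G z * of_real (truncate N (wind z))) - I) \<le> 2 * K / N * L\<^sup>2"
    proof (rule tendsto_upperbound[OF tendsto_norm[OF tendsto_diff[OF truncated_tendsto[OF G_meas G GR N] poly]]])
      have "norm ((LINT z|lborel. G z * of_real (truncate N (cr n z))) - (LINT z|lborel. G z * of_real (cr n z))) \<le> 2 * K / N * L\<^sup>2" for n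
        using truncation_error[OF G_meas G _ crossings_square Gi Gi N, of n "real n" N] crossings_le truncate_bound[of N] N
        by (simp add: norm_minus_commute)
      then show "\<forall>\<^sub>F n in sequentially. norm ((LINT z|lborel. G z * of_real (truncate N (cr n z))) - (LINT z|lborel. G z * of_real (cr n z))) \<le> 2 * K / N * L\<^sup>2"
        by simp
    qed simp_all
    moreover have "norm ((LINT z|lborel. G z * of_real (wind z)) - (LINT z|lborel. G z * of_real (truncate N (wind z)))) \<le> 2 * K / N * L\<^sup>2"
      using truncate_bound[of N] N by (intro truncation_error[OF G_meas G _ wind_square Gw Gi[of _ N] N]) auto
    ultimately show ?thesis
      using norm_triangle_ineq[of "(LINT z|lborel. G z * of_real (wind z)) - (LINT z|lborel. G z * of_real (truncate N (wind z)))" "(LINT z|lborel. G z * of_real (truncate N (wind z))) - I"]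
      by simp
  qed
  have "(\<lambda>n. 4 * K * L\<^sup>2 * inverse (real (Suc n))) \<longlonglongrightarrow> 0"
    by (rule tendsto_mult_right_zero[OF LIMSEQ_inverse_real_of_nat])
  then have "(\<lambda>n. 2 * (2 * K / real (Suc n) * L\<^sup>2)) \<longlonglongrightarrow> 0"
    by (simp add: divide_inverse algebra_simps)
  then have "norm ((LINT z|lborel. G z * of_real (wind z)) - I) \<le> 0"
    by (rule tendsto_lowerbound[OF _ always_eventually[OF allI[OF est]]]) simp_all
  then show ?thesis by (simp add: G_def)
qed

text \<open>The two partial derivatives are estimated separately on the polygons, whence the factor
  2. The bound is uniform in \<open>N\<close>, which the final limit relies on.\<close>

lemma truncated_index_bound:
  assumes F: "C1c F Fx Fy" and M: "\<And>z. norm (F z) \<le> M" and N: "N > 0"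
  shows "norm (LINT z|lborel. (\<i> * Fx z - Fy z) * of_real (truncate N (wind z))) \<le> 2 * M * L"
proof -
  have M0: "M \<ge> 0" using M[of 0] norm_ge_zero order_trans by blast
  obtain R K where RK: "\<And>z. norm (Fx z) \<le> K" "\<And>z. norm (Fy z) \<le> K"
     "\<And>z. norm z > R \<Longrightarrow> Fx z = 0" "\<And>z. norm z > R \<Longrightarrow> Fy z = 0"
    using C1c_bounds[OF F] by metis
  have le: "M * polygon_length (inscribed g n) n \<le> M * L" for n
    using inscribed_length_le M0 by (rule mult_left_mono)
  have x: "norm (LINT z|lborel. Fx z * of_real (truncate N (wind z))) \<le> M * L"
    using order_trans[OF polygon_truncated_bound(1)[where p = "inscribed g n" and n = n for n, OF F inscribed_closed M] le] N
    by (intro tendsto_upperbound[OF tendsto_norm[OF truncated_tendsto[OF C1c_measurable(2)[OF F] RK(1,3) N]]]) auto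
  have y: "norm (LINT z|lborel. Fy z * of_real (truncate N (wind z))) \<le> M * L"
    using order_trans[OF polygon_truncated_bound(2)[where p = "inscribed g n" and n = n for n, OF F inscribed_closed M] le] N
    by (intro tendsto_upperbound[OF tendsto_norm[OF truncated_tendsto[OF C1c_measurable(3)[OF F] RK(2,4) N]]]) auto
  have i: "integrable lborel (\<lambda>z. Fx z * of_real (truncate N (wind z)))" "integrable lborel (\<lambda>z. Fy z * of_real (truncate N (wind z)))"
    using truncate_bound[of N] N by (intro C1c_integrable_mult[OF F, of _ N]; simp)+
  have "(LINT z|lborel. (\<i> * Fx z - Fy z) * of_real (truncate N (wind z))) =
     \<i> * (LINT z|lborel. Fx z * of_real (truncate N (wind z))) - (LINT z|lborel. Fy z * of_real (truncate N (wind z)))"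
    using i by (simp add: left_diff_distrib mult.assoc)
  then show ?thesis
    using x y norm_triangle_ineq4[of "\<i> * (LINT z|lborel. Fx z * of_real (truncate N (wind z)))" "LINT z|lborel. Fy z * of_real (truncate N (wind z))"]
    by (simp add: norm_mult)
qed

end

section \<open>Smooth product functions and the algebra of C^1 triples\<close>

lemma C_k_add: "C_k k f \<Longrightarrow> C_k k h \<Longrightarrow> C_k k (\<lambda>z. f z + h z)"
proof (induction k arbitrary: f h)
  case 0
  then show ?case by (auto intro: continuous_on_add)
next
  case (Suc k)
  then have d: "f differentiable (at z)" "h differentiable (at z)" for z by auto
  have "frechet_derivative (\<lambda>z. f z + h z) (at z) v = frechet_derivative f (at z) v + frechet_derivative h (at z) v" for z v
    by (rule fun_cong[OF frechet_derivative_at[OF has_derivative_add[OF d[unfolded frechet_derivative_works]]], symmetric])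
  then show ?case using Suc d by simp
qed

text \<open>A directional derivative of such a product is a sum of two products of the same shape;
  the components of the direction are absorbed into \<open>c\<close>, which is why the induction
  runs over all \<open>c\<close>.\<close>

lemma C_k_Re_Im_product:
  "D_k (Suc k) a \<Longrightarrow> D_k (Suc k) b \<Longrightarrow> C_k k (\<lambda>z. c * of_real (a (Re z) * b (Im z)))"
proof (induction k arbitrary: a b c)
  case 0
  then obtain a' b' where "\<And>x. (a has_real_derivative a' x) (at x)" "\<And>x. (b has_real_derivative b' x) (at x)" by auto
  then have "continuous_on UNIV a" "continuous_on UNIV b" by (auto intro!: continuous_at_imp_continuous_on DERIV_isCont)
  then show ?case by (auto intro!: continuous_intros elim: continuous_on_compose2)
next
  case (Suc k)
  then obtain a' b' where ab: "\<And>x. (a has_real_derivative a' x) (at x)" "\<And>x. (b has_real_derivative b' x) (at x)"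
    "D_k (Suc k) a'" "D_k (Suc k) b'"
    by (auto simp only: D_k.simps(2)[of "Suc k"])
  have ab_k: "D_k (Suc k) a" "D_k (Suc k) b" using Suc.prems D_k_Suc by blast+
  have der: "((\<lambda>z. c * of_real (a (Re z) * b (Im z))) has_derivative
     (\<lambda>h. (c * of_real (Re h)) * of_real (a' (Re z) * b (Im z)) + (c * of_real (Im h)) * of_real (a (Re z) * b' (Im z)))) (at z)" for z
  proof -
    have A: "((\<lambda>z. a (Re z)) has_derivative (\<lambda>h. a' (Re z) * Re h)) (at z)"
      using has_derivative_compose[OF bounded_linear_imp_has_derivative[OF bounded_linear_Re], where g = a] ab(1)
      by (simp add: has_field_derivative_def)
    have B: "((\<lambda>z. b (Im z)) has_derivative (\<lambda>h. b' (Im z) * Im h)) (at z)"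
      using has_derivative_compose[OF bounded_linear_imp_has_derivative[OF bounded_linear_Im], where g = b] ab(2)
      by (simp add: has_field_derivative_def)
    have "((\<lambda>z. c * of_real (a (Re z) * b (Im z))) has_derivative
       (\<lambda>h. c * of_real (a (Re z) * (b' (Im z) * Im h) + (a' (Re z) * Re h) * b (Im z)))) (at z)"
      by (intro has_derivative_mult_right has_derivative_of_real has_derivative_mult A B)
    then show ?thesis by (rule has_derivative_eq_rhs) (auto simp: fun_eq_iff algebra_simps)
  qed
  have fd: "frechet_derivative (\<lambda>z. c * of_real (a (Re z) * b (Im z))) (at z) h =
     (c * of_real (Re h)) * of_real (a' (Re z) * b (Im z)) + (c * of_real (Im h)) * of_real (a (Re z) * b' (Im z))" for z h
    by (rule fun_cong[OF frechet_derivative_at[OF der], symmetric])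
  have "(\<lambda>z. c * of_real (a (Re z) * b (Im z))) differentiable (at z)" for z
    using der unfolding differentiable_def by blast
  moreover have "C_k k (\<lambda>z. frechet_derivative (\<lambda>z. c * of_real (a (Re z) * b (Im z))) (at z) h)" for h
    unfolding fd by (intro C_k_add Suc.IH ab ab_k)
  ultimately show ?case by simp
qed

lemma C1c_dbar:
  assumes "C1c F Fx Fy"
  shows "dbar F z = 1 / 2 * (Fx z + \<i> * Fy z)"
proof -
  have "(F has_derivative (\<lambda>h. of_real (Re h) * Fx z + of_real (Im h) * Fy z)) (at z)"
    using assms by (simp add: C1c_def)
  from frechet_derivative_at[OF this]
  have "frechet_derivative F (at z) = (\<lambda>h. of_real (Re h) * Fx z + of_real (Im h) * Fy z)" by simp
  then show ?thesis by (simp add: dbar_def)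
qed

lemma C1c_zero: "C1c (\<lambda>z. 0) (\<lambda>z. 0) (\<lambda>z. 0)"
  by (simp add: C1c_def)

lemma C1c_add:
  assumes F: "C1c F Fx Fy" and G: "C1c G Gx Gy"
  shows "C1c (\<lambda>z. F z + G z) (\<lambda>z. Fx z + Gx z) (\<lambda>z. Fy z + Gy z)"
  unfolding C1c_def
proof (intro conjI allI)
  fix z
  have "((\<lambda>z. F z + G z) has_derivative (\<lambda>h. (of_real (Re h) * Fx z + of_real (Im h) * Fy z) + (of_real (Re h) * Gx z + of_real (Im h) * Gy z))) (at z)"
    using F G by (intro has_derivative_add) (simp_all add: C1c_def)
  then show "((\<lambda>z. F z + G z) has_derivative (\<lambda>h. of_real (Re h) * (Fx z + Gx z) + of_real (Im h) * (Fy z + Gy z))) (at z)"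
    by (rule has_derivative_eq_rhs) (auto simp: fun_eq_iff algebra_simps)
next
  show "continuous_on UNIV (\<lambda>z. Fx z + Gx z)" "continuous_on UNIV (\<lambda>z. Fy z + Gy z)"
    using C1c_continuous[OF F] C1c_continuous[OF G] by (intro continuous_on_add; simp)+
  obtain R1 where "\<And>z. norm z > R1 \<Longrightarrow> F z = 0 \<and> Fx z = 0 \<and> Fy z = 0" using F unfolding C1c_def by blast
  moreover obtain R2 where "\<And>z. norm z > R2 \<Longrightarrow> G z = 0 \<and> Gx z = 0 \<and> Gy z = 0" using G unfolding C1c_def by blast
  ultimately show "\<exists>R. \<forall>z. R < norm z \<longrightarrow> F z + G z = 0 \<and> Fx z + Gx z = 0 \<and> Fy z + Gy z = 0"
    by (intro exI[of _ "max R1 R2"]) simp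
qed

lemma C1c_mult:
  assumes F: "C1c F Fx Fy" and G: "C1c G Gx Gy"
  shows "C1c (\<lambda>z. F z * G z) (\<lambda>z. F z * Gx z + Fx z * G z) (\<lambda>z. F z * Gy z + Fy z * G z)"
  unfolding C1c_def
proof (intro conjI allI)
  fix z
  have "((\<lambda>z. F z * G z) has_derivative (\<lambda>h. F z * (of_real (Re h) * Gx z + of_real (Im h) * Gy z) + (of_real (Re h) * Fx z + of_real (Im h) * Fy z) * G z)) (at z)"
    using F G by (intro has_derivative_mult) (simp_all add: C1c_def)
  then show "((\<lambda>z. F z * G z) has_derivative (\<lambda>h. of_real (Re h) * (F z * Gx z + Fx z * G z) + of_real (Im h) * (F z * Gy z + Fy z * G z))) (at z)"
    by (rule has_derivative_eq_rhs) (auto simp: fun_eq_iff algebra_simps)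
next
  show "continuous_on UNIV (\<lambda>z. F z * Gx z + Fx z * G z)" "continuous_on UNIV (\<lambda>z. F z * Gy z + Fy z * G z)"
    using C1c_continuous[OF F] C1c_continuous[OF G] by (intro continuous_on_add continuous_on_mult; simp)+
  obtain R where "\<And>z. norm z > R \<Longrightarrow> F z = 0 \<and> Fx z = 0 \<and> Fy z = 0" using F unfolding C1c_def by blast
  then show "\<exists>R. \<forall>z. R < norm z \<longrightarrow> F z * G z = 0 \<and> F z * Gx z + Fx z * G z = 0 \<and> F z * Gy z + Fy z * G z = 0"
    by (intro exI[of _ R]) simp
qed

lemma C1c_cmult:
  assumes F: "C1c F Fx Fy"
  shows "C1c (\<lambda>z. c * F z) (\<lambda>z. c * Fx z) (\<lambda>z. c * Fy z)"
  unfolding C1c_def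
proof (intro conjI allI)
  fix z
  have "((\<lambda>z. c * F z) has_derivative (\<lambda>h. c * (of_real (Re h) * Fx z + of_real (Im h) * Fy z))) (at z)"
    using F by (intro has_derivative_mult_right) (simp add: C1c_def)
  then show "((\<lambda>z. c * F z) has_derivative (\<lambda>h. of_real (Re h) * (c * Fx z) + of_real (Im h) * (c * Fy z))) (at z)"
    by (rule has_derivative_eq_rhs) (auto simp: fun_eq_iff algebra_simps)
next
  show "continuous_on UNIV (\<lambda>z. c * Fx z)" "continuous_on UNIV (\<lambda>z. c * Fy z)"
    using C1c_continuous[OF F] by (intro continuous_on_mult_left; simp)+
  obtain R where "\<And>z. norm z > R \<Longrightarrow> F z = 0 \<and> Fx z = 0 \<and> Fy z = 0" using F unfolding C1c_def by blast
  then show "\<exists>R. \<forall>z. R < norm z \<longrightarrow> c * F z = 0 \<and> c * Fx z = 0 \<and> c * Fy z = 0"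
    by (intro exI[of _ R]) simp
qed

lemma C1c_sum:
  assumes "finite J" "\<And>j. j \<in> J \<Longrightarrow> C1c (F j) (Fx j) (Fy j)"
  shows "C1c (\<lambda>z. \<Sum>j\<in>J. F j z) (\<lambda>z. \<Sum>j\<in>J. Fx j z) (\<lambda>z. \<Sum>j\<in>J. Fy j z)"
  using assms by (induction J rule: finite_induct) (auto intro: C1c_zero C1c_add)

text \<open>\<open>integral_partial_bound\<close> with the constant weight 1, whose variation is 0;
  the vertical part follows by rotation.\<close>

lemma C1c_integral_zero:
  assumes F: "C1c F Fx Fy"
  shows "(LINT z|lborel. Fx z + \<i> * Fy z) = 0"
proof -
  note [measurable] = C1c_measurable[OF F]
  have x: "(LINT z|lborel. Fx z) = 0" if F: "C1c F Fx Fy" for F Fx Fy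
  proof -
    obtain M where M: "\<And>z. norm (F z) \<le> M" using C1c_bounds[OF F] by metis
    have "norm (LINT z|lborel. Fx z * of_real 1) \<le> M * 0"
      by (rule integral_partial_bound[OF F, of "\<lambda>z. 1" 1]) (auto intro: M)
    then show ?thesis by simp
  qed
  have "(LINT z|lborel. Fy z) = (LINT z|lborel. Fy (\<i> * z))" by (rule integral_rotate[symmetric]) measurable
  also have "\<dots> = 0" by (rule x[OF C1c_rotate[OF F]])
  finally have y: "(LINT z|lborel. Fy z) = 0" .
  have "integrable lborel Fx" "integrable lborel Fy"
    using C1c_integrable_mult(2,3)[OF F, of "\<lambda>z. 1" 1] by simp_all
  then show ?thesis using x[OF F] y by simp
qed

lemma integration_by_parts:
  assumes F: "C1c F Fx Fy" and G: "C1c G Gx Gy"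
  shows "(LINT z|lborel. (Fx z + \<i> * Fy z) * G z) = - (LINT z|lborel. F z * (Gx z + \<i> * Gy z))"
proof -
  note [measurable] = C1c_measurable[OF F] C1c_measurable[OF G]
  obtain M where M: "\<And>z. norm (G z) \<le> M" "\<And>z. norm (Gx z) \<le> M" "\<And>z. norm (Gy z) \<le> M"
    using C1c_bounds[OF G] by metis
  have i: "integrable lborel (\<lambda>z. F z * Gx z)" "integrable lborel (\<lambda>z. F z * Gy z)"
    "integrable lborel (\<lambda>z. Fx z * G z)" "integrable lborel (\<lambda>z. Fy z * G z)"
    using M by (auto intro!: C1c_integrable_mult[OF F])
  have "(LINT z|lborel. (Fx z + \<i> * Fy z) * G z) + (LINT z|lborel. F z * (Gx z + \<i> * Gy z)) =
     (LINT z|lborel. (F z * Gx z + Fx z * G z) + \<i> * (F z * Gy z + Fy z * G z))"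
    using i by (simp add: distrib_left distrib_right mult.left_commute mult.assoc)
  also have "\<dots> = 0" by (rule C1c_integral_zero[OF C1c_mult[OF F G]])
  finally show ?thesis by (simp add: eq_neg_iff_add_eq_0)
qed

section \<open>A grid of bumps\<close>

locale partition_bump =
  fixes \<beta> \<beta>' :: "real \<Rightarrow> real"
  assumes smooth: "D_k k \<beta>"
    and deriv: "(\<beta> has_real_derivative \<beta>' x) (at x)"
    and nonneg: "0 \<le> \<beta> x"
    and support: "x \<notin> {0<..<2} \<Longrightarrow> \<beta> x = 0 \<and> \<beta>' x = 0"
    and sum_eq_1: "\<bar>x\<bar> \<le> real M \<Longrightarrow> (\<Sum>j\<in>{-int M - 1..int M}. \<beta> (x - of_int j)) = 1"
begin

text \<open>The translate of \<open>\<beta>\<close> by \<open>j\<close> lives on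
  \<open>{j<..<j + 2}\<close>, so at \<open>- M\<close> only the index \<open>- M - 1\<close>
  contributes; hence the asymmetric range.\<close>

definition grid :: "nat \<Rightarrow> (int \<times> int) set" where
  "grid M = {-int M - 1..int M} \<times> {-int M - 1..int M}"

definition \<phi> :: "real \<Rightarrow> int \<times> int \<Rightarrow> complex \<Rightarrow> complex" where
  "\<phi> e j z = of_real (\<beta> (Re z / e - of_int (fst j)) * \<beta> (Im z / e - of_int (snd j)))"

definition \<phi>x :: "real \<Rightarrow> int \<times> int \<Rightarrow> complex \<Rightarrow> complex" where
  "\<phi>x e j z = of_real (\<beta>' (Re z / e - of_int (fst j)) / e * \<beta> (Im z / e - of_int (snd j)))"

definition \<phi>y :: "real \<Rightarrow> int \<times> int \<Rightarrow> complex \<Rightarrow> complex" where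
  "\<phi>y e j z = of_real (\<beta> (Re z / e - of_int (fst j)) * (\<beta>' (Im z / e - of_int (snd j)) / e))"

definition corner :: "real \<Rightarrow> int \<times> int \<Rightarrow> complex" where
  "corner e j = Complex (e * of_int (fst j)) (e * of_int (snd j))"

text \<open>Side \<open>2 * e\<close> because \<open>\<beta>\<close> is supported in
  \<open>{0<..<2}\<close>.\<close>

definition cell :: "real \<Rightarrow> int \<times> int \<Rightarrow> complex set" where
  "cell e j = cbox (corner e j) (corner e j + Complex (2 * e) (2 * e))"

lemma finite_grid: "finite (grid M)"
  by (simp add: grid_def)

lemma corner_in_cell: "e > 0 \<Longrightarrow> corner e j \<in> cell e j"
  by (auto simp: cell_def in_cbox_complex_iff corner_def)

lemma connected_cell: "connected (cell e j)"
  by (simp add: cell_def convex_connected)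

lemma support_cell:
  assumes e: "e > 0" and z: "z \<notin> cell e j"
  shows "\<phi> e j z = 0" "\<phi>x e j z = 0" "\<phi>y e j z = 0"
proof -
  have "Re z / e - of_int (fst j) \<notin> {0<..<2} \<or> Im z / e - of_int (snd j) \<notin> {0<..<2}"
  proof (rule ccontr)
    assume "\<not> ?thesis"
    then have "z \<in> cell e j" using e
      by (auto simp: cell_def in_cbox_complex_iff corner_def field_simps)
    then show False using z by simp
  qed
  then show "\<phi> e j z = 0" "\<phi>x e j z = 0" "\<phi>y e j z = 0"
    using support by (auto simp: \<phi>_def \<phi>x_def \<phi>y_def)
qed

lemma cell_diameter:
  assumes "z \<in> cell e j"
  shows "norm (z - corner e j) \<le> 4 * e"
proof -
  have "\<bar>Re (z - corner e j)\<bar> \<le> 2 * e" "\<bar>Im (z - corner e j)\<bar> \<le> 2 * e"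
    using assms by (auto simp: cell_def in_cbox_complex_iff)
  then show ?thesis using cmod_le[of "z - corner e j"] by linarith
qed

lemma \<phi>_nonneg: "\<phi> e j z = of_real (norm (\<phi> e j z))"
  using nonneg by (simp add: \<phi>_def norm_mult)

lemma C1c_\<phi>:
  assumes e: "e > 0"
  shows "C1c (\<phi> e j) (\<phi>x e j) (\<phi>y e j)"
  unfolding C1c_def
proof (intro conjI allI)
  obtain \<beta>'' where D: "\<And>x. (\<beta>' has_real_derivative \<beta>'' x) (at x)"
  proof -
    obtain f' f'' where f: "\<And>x. (\<beta> has_real_derivative f' x) (at x)" "\<And>x. (f' has_real_derivative f'' x) (at x)"
      using smooth[of 2] by (auto simp: numeral_2_eq_2)
    have "f' = \<beta>'" using DERIV_unique[OF f(1) deriv] by auto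
    then show thesis using f(2) that by blast
  qed
  have c: "continuous_on UNIV \<beta>" "continuous_on UNIV \<beta>'"
    using deriv D by (auto intro!: continuous_at_imp_continuous_on DERIV_isCont)
  have c': "continuous_on UNIV (\<lambda>z. f (Re z / e - r))" "continuous_on UNIV (\<lambda>z. f (Im z / e - r))"
    if "continuous_on UNIV f" for f :: "real \<Rightarrow> real" and r
    using e by (auto intro!: continuous_on_compose2[OF that] continuous_intros)
  show "continuous_on UNIV (\<phi>x e j)" "continuous_on UNIV (\<phi>y e j)"
    unfolding \<phi>x_def[abs_def] \<phi>y_def[abs_def] using e
    by (intro continuous_on_of_real continuous_on_mult continuous_on_divide c' c continuous_on_const; simp)+
  fix z
  have A: "((\<lambda>z. \<beta> (Re z / e - r)) has_derivative (\<lambda>h. \<beta>' (Re z / e - r) * (Re h / e))) (at z)" for r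
  proof -
    have "((\<lambda>z. Re z / e - r) has_derivative (\<lambda>h. Re h / e)) (at z)"
      using e by (auto intro!: derivative_eq_intros)
    from has_derivative_compose[OF this, where g = \<beta> and g' = "(*) (\<beta>' (Re z / e - r))"] deriv
    show ?thesis unfolding has_field_derivative_def by blast
  qed
  have B: "((\<lambda>z. \<beta> (Im z / e - r)) has_derivative (\<lambda>h. \<beta>' (Im z / e - r) * (Im h / e))) (at z)" for r
  proof -
    have "((\<lambda>z. Im z / e - r) has_derivative (\<lambda>h. Im h / e)) (at z)"
      using e by (auto intro!: derivative_eq_intros)
    from has_derivative_compose[OF this, where g = \<beta> and g' = "(*) (\<beta>' (Im z / e - r))"] deriv
    show ?thesis unfolding has_field_derivative_def by blast
  qed
  have "(\<phi> e j has_derivative (\<lambda>h. of_real (\<beta> (Re z / e - of_int (fst j)) * (\<beta>' (Im z / e - of_int (snd j)) * (Im h / e)) + (\<beta>' (Re z / e - of_int (fst j)) * (Re h / e)) * \<beta> (Im z / e - of_int (snd j))))) (at z)"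
    unfolding \<phi>_def[abs_def] by (intro has_derivative_of_real has_derivative_mult A B)
  then show "(\<phi> e j has_derivative (\<lambda>h. of_real (Re h) * \<phi>x e j z + of_real (Im h) * \<phi>y e j z)) (at z)"
    by (rule has_derivative_eq_rhs) (auto simp: fun_eq_iff \<phi>x_def \<phi>y_def algebra_simps)
next
  have "bounded (cell e j)" by (simp add: cell_def)
  then obtain R where "\<And>z. z \<in> cell e j \<Longrightarrow> norm z \<le> R" unfolding bounded_iff by blast
  then show "\<exists>R. \<forall>z. R < norm z \<longrightarrow> \<phi> e j z = 0 \<and> \<phi>x e j z = 0 \<and> \<phi>y e j z = 0"
    using support_cell[OF e] by (intro exI[of _ R]) (metis not_less)
qed

lemma test_function_\<phi>:
  assumes e: "e > 0" and D: "cell e j \<subseteq> D"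
  shows "test_function_on D (\<phi> e j)"
  unfolding test_function_on_def
proof (intro conjI allI)
  fix k
  have "C_k k (\<lambda>z. 1 * of_real (\<beta> (1 / e * Re z + (- of_int (fst j))) * \<beta> (1 / e * Im z + (- of_int (snd j)))))"
    by (intro C_k_Re_Im_product D_k_affine smooth)
  then show "C_k k (\<phi> e j)" by (simp add: \<phi>_def[abs_def])
next
  have "{z. \<phi> e j z \<noteq> 0} \<subseteq> cell e j" using support_cell[OF e] by blast
  then have sub: "closure {z. \<phi> e j z \<noteq> 0} \<subseteq> cell e j"
    by (rule closure_minimal) (simp add: cell_def closed_cbox)
  then show "closure {z. \<phi> e j z \<noteq> 0} \<subseteq> D" using D by simp
  show "compact (closure {z. \<phi> e j z \<noteq> 0})"
    using sub by (intro compact_Int_closed[of "cell e j" "closure {z. \<phi> e j z \<noteq> 0}", unfolded Int_absorb1[OF sub]]) (simp_all add: cell_def)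
qed

lemma sum_grid:
  assumes "\<bar>Re z\<bar> \<le> e * real M" "\<bar>Im z\<bar> \<le> e * real M" "e > 0"
  shows "(\<Sum>j\<in>grid M. \<phi> e j z) = 1"
proof -
  have "(\<Sum>j\<in>grid M. \<phi> e j z) = of_real ((\<Sum>j\<in>{-int M - 1..int M}. \<beta> (Re z / e - of_int j)) * (\<Sum>j\<in>{-int M - 1..int M}. \<beta> (Im z / e - of_int j)))"
    unfolding grid_def \<phi>_def by (simp add: sum_product sum.cartesian_product case_prod_unfold)
  also have "\<dots> = 1"
  proof -
    have "\<bar>Re z / e\<bar> \<le> real M" "\<bar>Im z / e\<bar> \<le> real M" using assms by (auto simp: abs_divide divide_le_eq mult.commute)
    then show ?thesis by (simp only: sum_eq_1) simp
  qed
  finally show ?thesis .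
qed

text \<open>The terms are nonnegative, so the grid may be enlarged until it covers \<open>z\<close>,
  where the sum is 1.\<close>

lemma sum_grid_le:
  assumes e: "e > 0"
  shows "(\<Sum>j\<in>grid M. norm (\<phi> e j z)) \<le> 1"
proof -
  obtain n :: nat where n: "norm z / e \<le> real n" using real_arch_simple by blast
  define K where "K = max M n"
  have "norm z \<le> e * real n" using n e by (simp add: field_simps)
  also have "\<dots> \<le> e * real K" using e by (intro mult_left_mono) (auto simp: K_def)
  finally have nz: "norm z \<le> e * real K" .
  have "(\<Sum>j\<in>grid M. norm (\<phi> e j z)) \<le> (\<Sum>j\<in>grid K. norm (\<phi> e j z))"
    by (rule sum_mono2) (auto simp: finite_grid grid_def K_def)
  also have "\<dots> = 1"
  proof -
    have "of_real (\<Sum>j\<in>grid K. norm (\<phi> e j z)) = (1 :: complex)"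
      using sum_grid[of z e K] abs_Re_le_cmod[of z] abs_Im_le_cmod[of z] nz e by (simp add: \<phi>_nonneg[symmetric])
    then show ?thesis by (simp only: of_real_eq_1_iff)
  qed
  finally show ?thesis .
qed

lemma deriv_sum_eq_0:
  assumes "\<bar>x\<bar> < real M"
  shows "(\<Sum>j\<in>{-int M - 1..int M}. \<beta>' (x - of_int j)) = 0"
proof -
  have "((\<lambda>x. \<Sum>j\<in>{-int M - 1..int M}. \<beta> (x - of_int j)) has_real_derivative (\<Sum>j\<in>{-int M - 1..int M}. \<beta>' (x - of_int j))) (at x)"
    by (intro DERIV_sum DERIV_cong[OF DERIV_chain2[OF deriv]]) (auto intro!: derivative_eq_intros)
  moreover have "((\<lambda>x. \<Sum>j\<in>{-int M - 1..int M}. \<beta> (x - of_int j)) has_real_derivative 0) (at x)"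
  proof -
    have "\<forall>\<^sub>F y in nhds x. (\<Sum>j\<in>{-int M - 1..int M}. \<beta> (y - of_int j)) = 1"
    proof -
      have "\<forall>\<^sub>F y in nhds x. y \<in> {-real M<..<real M}"
        using assms by (intro eventually_nhds_in_open) auto
      then show ?thesis by eventually_elim (auto intro!: sum_eq_1)
    qed
    then show ?thesis by (subst DERIV_cong_ev) auto
  qed
  ultimately show ?thesis by (rule DERIV_unique)
qed

lemma deriv_sum_bounded:
  obtains B where "B > 0" "\<And>x J. finite J \<Longrightarrow> (\<Sum>j\<in>J. \<bar>\<beta>' (x - of_int j)\<bar>) \<le> B"
proof -
  obtain f' f'' where f: "\<And>x. (\<beta> has_real_derivative f' x) (at x)" "\<And>x. (f' has_real_derivative f'' x) (at x)"
    using smooth[of 2] by (auto simp: numeral_2_eq_2)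
  have "f' = \<beta>'" using DERIV_unique[OF f(1) deriv] by auto
  then have "continuous_on UNIV \<beta>'" using f(2) by (auto intro!: continuous_at_imp_continuous_on DERIV_isCont)
  moreover have "\<beta>' x = 0" if "norm x > 2" for x
  proof -
    have "x \<notin> {0<..<2}" using that by auto
    then show ?thesis using support by simp
  qed
  ultimately obtain M where M: "M > 0" "\<And>x. norm (\<beta>' x) \<le> M"
    using continuous_compact_support_bounded[of \<beta>' 2] by metis
  have "(\<Sum>j\<in>J. \<bar>\<beta>' (x - of_int j)\<bar>) \<le> 3 * M" if J: "finite J" for x J
  proof -
    \<comment> \<open>Outside this window \<open>x - of_int j\<close> misses
      \<open>{0<..<2}\<close>; its three elements give the constant \<open>3 * M\<close>.\<close>
    let ?S = "{\<lfloor>x\<rfloor> - 2..\<lfloor>x\<rfloor>}"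
    have "(\<Sum>j\<in>J. \<bar>\<beta>' (x - of_int j)\<bar>) = (\<Sum>j\<in>J \<inter> ?S. \<bar>\<beta>' (x - of_int j)\<bar>)"
    proof (rule sum.mono_neutral_right[OF J], blast, intro ballI)
      fix j assume "j \<in> J - J \<inter> ?S"
      then have "x - of_int j \<notin> {0<..<2}" by auto linarith+
      then show "\<bar>\<beta>' (x - of_int j)\<bar> = 0" using support by simp
    qed
    also have "\<dots> \<le> of_nat (card (J \<inter> ?S)) * M"
      using M(2) by (intro sum_bounded_above) auto
    also have "\<dots> \<le> 3 * M"
      using card_mono[of ?S "J \<inter> ?S"] M(1) by (intro mult_right_mono) auto
    finally show ?thesis .
  qed
  then show thesis using that[of "3 * M"] M(1) by simp
qed

lemma sum_grid_deriv:
  assumes "\<bar>Re z\<bar> < e * real M" "\<bar>Im z\<bar> < e * real M" "e > 0"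
  shows "(\<Sum>j\<in>grid M. \<phi>x e j z) = 0" "(\<Sum>j\<in>grid M. \<phi>y e j z) = 0"
proof -
  have lt: "\<bar>Re z / e\<bar> < real M" "\<bar>Im z / e\<bar> < real M" using assms by (auto simp: abs_divide field_simps)
  have "(\<Sum>j\<in>grid M. \<phi>x e j z) = of_real ((\<Sum>j\<in>{-int M - 1..int M}. \<beta>' (Re z / e - of_int j) / e) * (\<Sum>j\<in>{-int M - 1..int M}. \<beta> (Im z / e - of_int j)))"
    unfolding grid_def \<phi>x_def by (simp add: sum_product sum.cartesian_product case_prod_unfold)
  then show "(\<Sum>j\<in>grid M. \<phi>x e j z) = 0" using deriv_sum_eq_0[OF lt(1)] by (simp flip: sum_divide_distrib)
  have "(\<Sum>j\<in>grid M. \<phi>y e j z) = of_real ((\<Sum>j\<in>{-int M - 1..int M}. \<beta> (Re z / e - of_int j)) * (\<Sum>j\<in>{-int M - 1..int M}. \<beta>' (Im z / e - of_int j) / e))"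
    unfolding grid_def \<phi>y_def by (simp add: sum_product sum.cartesian_product case_prod_unfold)
  then show "(\<Sum>j\<in>grid M. \<phi>y e j z) = 0" using deriv_sum_eq_0[OF lt(2)] by (simp flip: sum_divide_distrib)
qed

lemma sum_\<beta>_le: "(\<Sum>j\<in>{-int M - 1..int M}. \<beta> (x - of_int j)) \<le> 1"
proof -
  obtain n :: nat where n: "\<bar>x\<bar> \<le> real n" using real_arch_simple by blast
  have "(\<Sum>j\<in>{-int M - 1..int M}. \<beta> (x - of_int j)) \<le> (\<Sum>j\<in>{-int (max M n) - 1..int (max M n)}. \<beta> (x - of_int j))"
    by (rule sum_mono2) (auto simp: nonneg)
  also have "\<dots> = 1" using n by (intro sum_eq_1) auto
  finally show ?thesis .
qed

text \<open>Differentiation at scale \<open>e\<close> costs \<open>1 / e\<close>, and only boundedly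
  many bumps are active at a point, so the size of the grid does not enter.\<close>

lemma sum_grid_deriv_bounded:
  obtains B where "B > 0" "\<And>e M z. e > 0 \<Longrightarrow> (\<Sum>j\<in>grid M. norm (\<phi>x e j z)) \<le> B / e"
    "\<And>e M z. e > 0 \<Longrightarrow> (\<Sum>j\<in>grid M. norm (\<phi>y e j z)) \<le> B / e"
proof -
  obtain B where B: "B > 0" "\<And>x J. finite J \<Longrightarrow> (\<Sum>j\<in>J. \<bar>\<beta>' (x - of_int j)\<bar>) \<le> B"
    using deriv_sum_bounded by blast
  have le: "(\<Sum>j\<in>{-int M - 1..int M}. \<bar>\<beta>' (x - of_int j)\<bar> / e) * (\<Sum>j\<in>{-int M - 1..int M}. \<beta> (y - of_int j)) \<le> B / e"
    if "e > 0" for e M x y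
  proof -
    have "(\<Sum>j\<in>{-int M - 1..int M}. \<bar>\<beta>' (x - of_int j)\<bar> / e) * (\<Sum>j\<in>{-int M - 1..int M}. \<beta> (y - of_int j)) \<le> (B / e) * 1"
      using B sum_\<beta>_le that by (intro mult_mono) (auto simp: divide_right_mono sum_nonneg nonneg simp flip: sum_divide_distrib)
    then show ?thesis by simp
  qed
  show thesis
  proof (rule that[OF B(1)])
    fix e :: real and M z assume e: "e > 0"
    have "(\<Sum>j\<in>grid M. norm (\<phi>x e j z)) = (\<Sum>j\<in>{-int M - 1..int M}. \<bar>\<beta>' (Re z / e - of_int j)\<bar> / e) * (\<Sum>j\<in>{-int M - 1..int M}. \<beta> (Im z / e - of_int j))"
      unfolding grid_def \<phi>x_def using e nonneg by (simp add: sum_product sum.cartesian_product case_prod_unfold norm_mult norm_divide)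
    then show "(\<Sum>j\<in>grid M. norm (\<phi>x e j z)) \<le> B / e" using le[OF e] by simp
    have "(\<Sum>j\<in>grid M. norm (\<phi>y e j z)) = (\<Sum>j\<in>{-int M - 1..int M}. \<beta> (Re z / e - of_int j)) * (\<Sum>j\<in>{-int M - 1..int M}. \<bar>\<beta>' (Im z / e - of_int j)\<bar> / e)"
      unfolding grid_def \<phi>y_def using e nonneg by (simp add: sum_product sum.cartesian_product case_prod_unfold norm_mult norm_divide)
    then show "(\<Sum>j\<in>grid M. norm (\<phi>y e j z)) \<le> B / e" using le[OF e] by (simp add: mult.commute)
  qed
qed

text \<open>Near the support of \<open>f\<close>, \<open>F z\<close> is a weighted average of the
  values of \<open>f\<close> at the corners of the cells containing \<open>z\<close>, all within
  \<open>4 * e\<close>. This takes the place of convolution and comes with explicit partial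
  derivatives.\<close>

lemma C1c_approximation:
  assumes f: "continuous_on UNIV f" and R: "\<And>z. norm z > R \<Longrightarrow> f z = 0" and d: "d > 0"
  obtains F Fx Fy where "C1c F Fx Fy" "\<And>z. norm (F z - f z) \<le> d"
proof -
  have "uniformly_continuous_on UNIV f"
  proof -
    have "uniformly_continuous_on (cball 0 (R + 1)) f"
      using f by (intro compact_uniformly_continuous) (auto elim: continuous_on_subset)
    then show ?thesis unfolding uniformly_continuous_on_def
    proof (intro allI impI)
      fix \<epsilon> :: real assume uc: "\<forall>\<epsilon>>0. \<exists>\<delta>>0. \<forall>x\<in>cball 0 (R + 1). \<forall>x'\<in>cball 0 (R + 1). dist x' x < \<delta> \<longrightarrow> dist (f x') (f x) < \<epsilon>" and e: "\<epsilon> > 0"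
      then obtain \<delta> where \<delta>: "\<delta> > 0" "\<And>x x'. x \<in> cball 0 (R + 1) \<Longrightarrow> x' \<in> cball 0 (R + 1) \<Longrightarrow> dist x' x < \<delta> \<Longrightarrow> dist (f x') (f x) < \<epsilon>"
        by meson
      have "dist (f x') (f x) < \<epsilon>" if "dist x' x < min \<delta> 1" for x x'
      proof (cases "x \<in> cball 0 (R + 1) \<and> x' \<in> cball 0 (R + 1)")
        case True
        then show ?thesis using \<delta>(2) that by simp
      next
        case False
        \<comment> \<open>If one point is outside the ball of radius \<open>R + 1\<close>, the
          other, at distance less than 1, is still outside radius \<open>R\<close>.\<close>
        then have "norm x > R" "norm x' > R"
          using that norm_triangle_ineq2[of x x'] norm_triangle_ineq2[of x' x] by (auto simp: dist_norm norm_minus_commute)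
        then show ?thesis using R e by simp
      qed
      then show "\<exists>\<delta>>0. \<forall>x\<in>UNIV. \<forall>x'\<in>UNIV. dist x' x < \<delta> \<longrightarrow> dist (f x') (f x) < \<epsilon>"
        using \<delta>(1) by (intro exI[of _ "min \<delta> 1"]) auto
    qed
  qed
  then obtain \<delta> where \<delta>: "\<delta> > 0" "\<And>x y. dist x y < \<delta> \<Longrightarrow> dist (f x) (f y) < d"
    using d unfolding uniformly_continuous_on_def by (metis UNIV_I)
  define e where "e = \<delta> / 5"
  have e: "e > 0" "4 * e < \<delta>" using \<delta>(1) by (auto simp: e_def)
  \<comment> \<open>The margin \<open>4 * e\<close> is for points beyond the covered disc: the
    corner of a cell containing such a point still has norm above \<open>R\<close>, where
    \<open>f\<close> is 0.\<close>
  obtain M :: nat where M: "(R + 4 * e) / e \<le> real M" using real_arch_simple by blast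
  have Me: "R + 4 * e \<le> e * real M" using M e by (simp add: field_simps)
  define F where "F z = (\<Sum>j\<in>grid M. f (corner e j) * \<phi> e j z)" for z
  define Fx where "Fx z = (\<Sum>j\<in>grid M. f (corner e j) * \<phi>x e j z)" for z
  define Fy where "Fy z = (\<Sum>j\<in>grid M. f (corner e j) * \<phi>y e j z)" for z
  have "C1c F Fx Fy"
    unfolding F_def[abs_def] Fx_def[abs_def] Fy_def[abs_def]
    by (intro C1c_sum finite_grid C1c_cmult C1c_\<phi> e)
  moreover have "norm (F z - f z) \<le> d" for z
  proof (cases "norm z \<le> e * real M")
    case True
    then have "(\<Sum>j\<in>grid M. \<phi> e j z) = 1"
      using abs_Re_le_cmod[of z] abs_Im_le_cmod[of z] e by (intro sum_grid) auto
    then have "F z - f z = (\<Sum>j\<in>grid M. f (corner e j) * \<phi> e j z) - f z * (\<Sum>j\<in>grid M. \<phi> e j z)" by (simp add: F_def)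
    also have "\<dots> = (\<Sum>j\<in>grid M. (f (corner e j) - f z) * \<phi> e j z)"
      by (simp add: sum_distrib_left left_diff_distrib sum_subtractf)
    also have "norm \<dots> \<le> (\<Sum>j\<in>grid M. d * norm (\<phi> e j z))"
    proof (rule sum_norm_le)
      fix j
      show "norm ((f (corner e j) - f z) * \<phi> e j z) \<le> d * norm (\<phi> e j z)"
      proof (cases "z \<in> cell e j")
        case True
        have "dist (corner e j) z < \<delta>" using cell_diameter[OF True] e by (simp add: dist_norm norm_minus_commute)
        then have "norm (f (corner e j) - f z) \<le> d" using \<delta>(2) by (simp add: dist_norm less_imp_le)
        then show ?thesis unfolding norm_mult by (intro mult_right_mono) auto
      qed (simp add: support_cell[OF e(1)])
    qed
    also have "\<dots> \<le> d * 1" unfolding sum_distrib_left[symmetric] using d sum_grid_le[OF e(1)] by (intro mult_left_mono) auto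
    finally show ?thesis by simp
  next
    case False
    have "f (corner e j) * \<phi> e j z = 0" for j
    proof (cases "z \<in> cell e j")
      case True
      have "norm (corner e j) > R"
        using cell_diameter[OF True] False Me norm_triangle_ineq2[of z "corner e j"] norm_triangle_ineq[of "z - corner e j" "corner e j"] by simp
      then show ?thesis using R by simp
    qed (simp add: support_cell[OF e(1)])
    then have "F z = 0" unfolding F_def by (intro sum.neutral) simp
    moreover have "f z = 0" using False Me e by (intro R) linarith
    ultimately show ?thesis using d by simp
  qed
  ultimately show thesis using that by blast
qed

end

lemma partition_bump_locale_exists: "\<exists>\<beta> \<beta>'. partition_bump \<beta> \<beta>'"
proof -
  obtain \<beta> \<beta>' :: "real \<Rightarrow> real" where "\<forall>k. D_k k \<beta>" "\<forall>x. (\<beta> has_real_derivative \<beta>' x) (at x)"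
    "\<forall>x. 0 \<le> \<beta> x" "\<forall>x. x \<notin> {0<..<2} \<longrightarrow> \<beta> x = 0 \<and> \<beta>' x = 0"
    "\<forall>(M::nat) (x::real). \<bar>x\<bar> \<le> real M \<longrightarrow> (\<Sum>j\<in>{-int M - 1..int M}. \<beta> (x - of_int j)) = 1"
    using partition_bump_exists by (elim exE conjE) (rule that; assumption)
  then have "partition_bump \<beta> \<beta>'" by unfold_locales auto
  then show ?thesis by blast
qed

section \<open>The Cauchy--Green formula\<close>

lemma integrable_square_mult:
  fixes a b :: "'a \<Rightarrow> complex"
  assumes [measurable]: "a \<in> borel_measurable M" "b \<in> borel_measurable M"
    and "integrable M (\<lambda>z. (norm (a z))\<^sup>2)" "integrable M (\<lambda>z. (norm (b z))\<^sup>2)"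
  shows "integrable M (\<lambda>z. a z * b z)"
proof (rule Bochner_Integration.integrable_bound)
  show "integrable M (\<lambda>z. (norm (a z))\<^sup>2 + (norm (b z))\<^sup>2)" using assms by simp
  have "norm (a z * b z) \<le> norm ((norm (a z))\<^sup>2 + (norm (b z))\<^sup>2)" for z
  proof -
    have "2 * (norm (a z) * norm (b z)) \<le> (norm (a z))\<^sup>2 + (norm (b z))\<^sup>2"
      using sum_squares_bound[of "norm (a z)" "norm (b z)"] by (simp add: mult.assoc)
    moreover have "0 \<le> norm (a z) * norm (b z)" by simp
    ultimately have "norm (a z) * norm (b z) \<le> (norm (a z))\<^sup>2 + (norm (b z))\<^sup>2" by linarith
    then show ?thesis by (simp add: norm_mult)
  qed
  then show "AE z in M. norm (a z * b z) \<le> norm ((norm (a z))\<^sup>2 + (norm (b z))\<^sup>2)" by simp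
qed measurable

lemma compactly_supported_extension:
  fixes f :: "complex \<Rightarrow> complex"
  assumes K: "compact K" and f: "continuous_on K f"
  obtains f' R where "continuous_on UNIV f'" "\<And>z. z \<in> K \<Longrightarrow> f' z = f z" "\<And>z. norm z > R \<Longrightarrow> f' z = 0"
proof -
  obtain B where B: "\<And>z. z \<in> K \<Longrightarrow> norm (f z) \<le> B"
    using compact_imp_bounded[OF compact_continuous_image[OF f K]] unfolding bounded_iff by blast
  obtain R where R: "\<And>z. z \<in> K \<Longrightarrow> norm z \<le> R"
    using compact_imp_bounded[OF K] unfolding bounded_iff by blast
  obtain f1 where f1: "continuous_on UNIV f1" "\<And>z. z \<in> K \<Longrightarrow> f1 z = f z"
    using Tietze[of K f UNIV "max B 0"] f K B compact_imp_closed[OF K] by (metis closed_closedin le_max_iff_disj max.cobounded2 subtopology_UNIV)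
  \<comment> \<open>The cutoff factor is 1 up to radius \<open>R\<close>, hence on \<open>K\<close>,
    and 0 from radius \<open>R + 1\<close> on.\<close>
  define f' where "f' z = f1 z * of_real (max 0 (min 1 (R + 1 - norm z)))" for z
  show thesis
  proof (rule that)
    show "continuous_on UNIV f'" unfolding f'_def by (intro continuous_intros f1)
    show "f' z = f z" if "z \<in> K" for z using R[OF that] f1(2)[OF that] by (simp add: f'_def)
    show "f' z = 0" if "norm z > R + 1" for z using that by (simp add: f'_def)
  qed
qed

section \<open>Cutting off the truncated index near the curve\<close>

locale bumped_loop = rectifiable_loop g v + partition_bump \<beta> \<beta>' for g v \<beta> \<beta>'
begin

definition D :: "complex set" where "D = {z. z \<notin> trace \<and> index z \<noteq> 0}"

lemma open_D: "open D"
proof -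
  have "D = {z \<in> - trace. index z \<in> - {0}}" by (auto simp: D_def)
  moreover have "open {z \<in> - trace. index z \<in> - {0}}"
    using closed_trace continuous_open_preimage[OF index_continuous, of "- {0}"] by (auto simp: vimage_def Int_def)
  ultimately show ?thesis by simp
qed

text \<open>Off the curve the index is an integer, so it vanishes exactly where its modulus is less
  than 1, an open condition. Compactness makes \<open>f\<close> bounded and extendable.\<close>

lemma compact_D_trace: "compact (D \<union> trace)"
proof -
  obtain R where R: "\<And>z. norm z > R \<Longrightarrow> z \<notin> trace \<and> index z = 0" using bounded_index by metis
  have "D \<union> trace \<subseteq> cball 0 R"
  proof
    fix z assume "z \<in> D \<union> trace"
    then show "z \<in> cball 0 R" using R[of z] by (auto simp: D_def not_less[symmetric])
  qed
  then have "bounded (D \<union> trace)" by (rule bounded_subset[OF bounded_cball])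
  moreover have "- (D \<union> trace) = {z \<in> - trace. index z \<in> ball 0 1}"
  proof -
    have "index z = 0 \<longleftrightarrow> norm (index z) < 1" if "z \<notin> trace" for z
      using index_Ints[OF that] by (auto elim!: Ints_cases)
    then show ?thesis by (auto simp: D_def)
  qed
  moreover have "open {z \<in> - trace. index z \<in> ball 0 1}"
    using closed_trace continuous_open_preimage[OF index_continuous, of "ball 0 1"] by (auto simp: vimage_def Int_def)
  ultimately show ?thesis by (simp add: compact_eq_bounded_closed closed_def)
qed

text \<open>On a cell that misses the curve the index is constant and can be read off at the corner;
  cells that meet the curve are dropped. The cutoff product is thus a finite combination of bumps,
  and the distributional identity is applied to each bump.\<close>

definition coeff :: "real \<Rightarrow> real \<Rightarrow> int \<times> int \<Rightarrow> complex" where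
  "coeff N e j = (if cell e j \<inter> trace = {} then of_real (truncate N (wind (corner e j))) else 0)"

definition cut :: "real \<Rightarrow> real \<Rightarrow> nat \<Rightarrow> complex \<Rightarrow> complex" where
  "cut N e M z = (\<Sum>j\<in>grid M. coeff N e j * \<phi> e j z)"

definition cutx :: "real \<Rightarrow> real \<Rightarrow> nat \<Rightarrow> complex \<Rightarrow> complex" where
  "cutx N e M z = (\<Sum>j\<in>grid M. coeff N e j * \<phi>x e j z)"

definition cuty :: "real \<Rightarrow> real \<Rightarrow> nat \<Rightarrow> complex \<Rightarrow> complex" where
  "cuty N e M z = (\<Sum>j\<in>grid M. coeff N e j * \<phi>y e j z)"

lemma C1c_cut: "e > 0 \<Longrightarrow> C1c (cut N e M) (cutx N e M) (cuty N e M)"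
  unfolding cut_def[abs_def] cutx_def[abs_def] cuty_def[abs_def]
  by (intro C1c_sum finite_grid C1c_cmult C1c_\<phi>)

lemma coeff_eq:
  assumes "e > 0" "cell e j \<inter> trace = {}" "z \<in> cell e j"
  shows "coeff N e j = of_real (truncate N (wind z))"
  using wind_constant[OF connected_cell assms(2) corner_in_cell[OF assms(1)] assms(3)] assms(2)
  by (simp add: coeff_def)

text \<open>This makes every bump that occurs with nonzero coefficient a test function on
  \<open>D\<close>.\<close>

lemma coeff_nonzero_cell:
  assumes e: "e > 0" and N: "N \<ge> 0" and c: "coeff N e j \<noteq> 0"
  shows "cell e j \<subseteq> D"
proof
  fix z assume z: "z \<in> cell e j"
  have d: "cell e j \<inter> trace = {}" using c by (auto simp: coeff_def split: if_splits)
  then have "truncate N (wind z) \<noteq> 0" using coeff_eq[OF e d z, of N] c by simp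
  then have "wind z \<noteq> 0" using truncate_eq[of 0 N] N by auto
  moreover have "z \<notin> trace" using d z by blast
  ultimately show "z \<in> D" using wind_index[of z] by (auto simp: D_def)
qed

text \<open>The coefficients active at \<open>z\<close> are 0 or the truncated index at
  \<open>z\<close>, and their weights sum to at most 1. The right-hand side is the dominating
  function in the limits over \<open>e\<close> and \<open>N\<close>.\<close>

lemma cut_bound:
  assumes e: "e > 0" and N: "N \<ge> 0"
  shows "norm (cut N e M z) \<le> \<bar>wind z\<bar>"
proof -
  have "norm (coeff N e j * \<phi> e j z) \<le> \<bar>wind z\<bar> * norm (\<phi> e j z)" for j
  proof (cases "z \<in> cell e j \<and> cell e j \<inter> trace = {}")
    case True
    then show ?thesis using coeff_eq[OF e, of j z N] truncate_le[OF N, of "wind z"] by (simp add: norm_mult mult_right_mono)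
  next
    case False
    then have "coeff N e j * \<phi> e j z = 0"
      using support_cell(1)[OF e, of z j] by (cases "z \<in> cell e j") (auto simp: coeff_def)
    then show ?thesis by (simp only: norm_zero) simp
  qed
  then have "norm (cut N e M z) \<le> (\<Sum>j\<in>grid M. \<bar>wind z\<bar> * norm (\<phi> e j z))"
    unfolding cut_def by (intro sum_norm_le)
  also have "\<dots> \<le> \<bar>wind z\<bar> * 1"
    unfolding sum_distrib_left[symmetric] by (intro mult_left_mono sum_grid_le e) auto
  finally show ?thesis by simp
qed

text \<open>Two points of one cell are at most \<open>8 * e\<close> apart, via the corner. So no
  cell containing \<open>z\<close> meets the curve, all active coefficients equal the truncated
  index at \<open>z\<close>, and the partition of unity does the rest.\<close>

lemma cut_away:
  assumes e: "e > 0" and N: "N \<ge> 0" and far: "infdist z trace > 8 * e" and R: "\<And>z. norm z > R \<Longrightarrow> z \<notin> trace \<and> index z = 0" and M: "R < e * real M"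
  shows "cut N e M z = of_real (truncate N (wind z))" "cutx N e M z = 0" "cuty N e M z = 0"
proof -
  let ?T = "of_real (truncate N (wind z)) :: complex"
  have c: "coeff N e j = ?T" if "z \<in> cell e j" for j
  proof (rule coeff_eq[OF e _ that], rule ccontr)
    assume "cell e j \<inter> trace \<noteq> {}"
    then obtain w where w: "w \<in> cell e j" "w \<in> trace" by blast
    have "infdist z trace \<le> dist z w" by (rule infdist_le[OF w(2)])
    also have "\<dots> \<le> norm (z - corner e j) + norm (w - corner e j)"
      using norm_triangle_ineq4[of "z - corner e j" "w - corner e j"] by (simp add: dist_norm)
    also have "\<dots> \<le> 8 * e" using cell_diameter[OF that] cell_diameter[OF w(1)] by simp
    finally show False using far by simp
  qed
  have eqs: "coeff N e j * \<phi> e j z = ?T * \<phi> e j z" "coeff N e j * \<phi>x e j z = ?T * \<phi>x e j z" "coeff N e j * \<phi>y e j z = ?T * \<phi>y e j z" for j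
    using c[of j] support_cell[OF e, of z j] by (cases "z \<in> cell e j"; simp)+
  have sums: "cut N e M z = ?T * (\<Sum>j\<in>grid M. \<phi> e j z)" "cutx N e M z = ?T * (\<Sum>j\<in>grid M. \<phi>x e j z)" "cuty N e M z = ?T * (\<Sum>j\<in>grid M. \<phi>y e j z)"
    unfolding cut_def cutx_def cuty_def eqs sum_distrib_left by simp_all
  have "cut N e M z = ?T \<and> cutx N e M z = 0 \<and> cuty N e M z = 0"
  \<comment> \<open>Beyond radius \<open>R\<close> the grid may fail to cover \<open>z\<close>, but
    there the common coefficient is 0.\<close>
  proof (cases "norm z > R")
    case True
    then have "wind z = 0" using R[of z] by (simp add: wind_def)
    then have "?T = 0" using truncate_eq[of 0 N] N by simp
    then show ?thesis using sums by simp
  next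
    case False
    then have "\<bar>Re z\<bar> < e * real M" "\<bar>Im z\<bar> < e * real M"
      using abs_Re_le_cmod[of z] abs_Im_le_cmod[of z] M by linarith+
    then show ?thesis using sums sum_grid[of z e M] sum_grid_deriv[of z e M] e by simp
  qed
  then show "cut N e M z = of_real (truncate N (wind z))" "cutx N e M z = 0" "cuty N e M z = 0" by auto
qed

text \<open>The gradient is at most \<open>2 * N * B / e\<close> and lives within
  \<open>8 * e\<close> of the curve, a set of area at most \<open>4 * pi * (L + 1) * 8 * e\<close>.
  The powers of \<open>e\<close> cancel; the factor \<open>N\<close> stays in
  \<open>C\<close>.\<close>

lemma cut_gradient_bound:
  assumes N: "N > 0"
  obtains C where "C > 0" "\<And>e M. 0 < e \<Longrightarrow> 8 * e \<le> 1 \<Longrightarrow>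
     (\<exists>R. (\<forall>z. norm z > R \<longrightarrow> z \<notin> trace \<and> index z = 0) \<and> R < e * real M) \<Longrightarrow>
     (LINT z|lborel. norm (cutx N e M z + \<i> * cuty N e M z)) \<le> C"
proof -
  obtain B where B: "B > 0" "\<And>e M z. e > 0 \<Longrightarrow> (\<Sum>j\<in>grid M. norm (\<phi>x e j z)) \<le> B / e"
    "\<And>e M z. e > 0 \<Longrightarrow> (\<Sum>j\<in>grid M. norm (\<phi>y e j z)) \<le> B / e"
    using sum_grid_deriv_bounded by blast
  define C where "C = 2 * N * B * (4 * pi * (L + 1) * 8)"
  have C: "C > 0" using N B(1) L_nonneg by (simp add: C_def)
  have "(LINT z|lborel. norm (cutx N e M z + \<i> * cuty N e M z)) \<le> C"
    if e: "0 < e" "8 * e \<le> 1" and R: "\<exists>R. (\<forall>z. norm z > R \<longrightarrow> z \<notin> trace \<and> index z = 0) \<and> R < e * real M" for e M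
  proof -
    note [measurable] = C1c_measurable[OF C1c_cut[OF e(1), of N M]]
    obtain R where R: "\<And>z. norm z > R \<Longrightarrow> z \<notin> trace \<and> index z = 0" "R < e * real M" using R by blast
    have cN: "norm (coeff N e j) \<le> N" for j
      using truncate_bound[of N] N by (auto simp: coeff_def)
    have part: "norm (\<Sum>j\<in>grid M. coeff N e j * \<psi> j) \<le> N * (\<Sum>j\<in>grid M. norm (\<psi> j))" for \<psi>
      unfolding sum_distrib_left by (intro sum_norm_le) (auto simp: norm_mult cN mult_right_mono)
    have le: "norm (cutx N e M z + \<i> * cuty N e M z) \<le> 2 * N * B / e * indicator {z. infdist z trace \<le> 8 * e} z" for z
    proof (cases "infdist z trace \<le> 8 * e")
      case True
      have "norm (cutx N e M z + \<i> * cuty N e M z) \<le> norm (cutx N e M z) + norm (cuty N e M z)"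
        by (rule order_trans[OF norm_triangle_ineq]) (simp add: norm_mult)
      also have "\<dots> \<le> N * (B / e) + N * (B / e)"
        unfolding cutx_def cuty_def
        by (intro add_mono order_trans[OF part] mult_left_mono B e) (use N in auto)
      also have "\<dots> = 2 * N * B / e" by simp
      finally show ?thesis using True by simp
    next
      case False
      then show ?thesis using cut_away[OF e(1) less_imp_le[OF N] _ R, of z] by simp
    qed
    have "ennreal (LINT z|lborel. norm (cutx N e M z + \<i> * cuty N e M z)) = (\<integral>\<^sup>+z. ennreal (norm (cutx N e M z + \<i> * cuty N e M z)) \<partial>lborel)"
    proof (rule nn_integral_eq_integral[symmetric])
      have "integrable lborel (cutx N e M)" "integrable lborel (cuty N e M)"
        using C1c_integrable_mult(2,3)[OF C1c_cut[OF e(1)], of "\<lambda>z. 1" 1] by simp_all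
      then show "integrable lborel (\<lambda>z. norm (cutx N e M z + \<i> * cuty N e M z))" by simp
    qed simp
    also have "\<dots> \<le> (\<integral>\<^sup>+z. ennreal (2 * N * B / e) * indicator {z. infdist z trace \<le> 8 * e} z \<partial>lborel)"
    proof (intro nn_integral_mono)
      fix z
      have "ennreal (norm (cutx N e M z + \<i> * cuty N e M z)) \<le> ennreal (2 * N * B / e * indicator {z. infdist z trace \<le> 8 * e} z)"
        by (intro ennreal_leI le)
      then show "ennreal (norm (cutx N e M z + \<i> * cuty N e M z)) \<le> ennreal (2 * N * B / e) * indicator {z. infdist z trace \<le> 8 * e} z"
        by (simp split: split_indicator_asm split_indicator)
    qed
    also have "\<dots> = ennreal (2 * N * B / e) * emeasure lborel {z. infdist z trace \<le> 8 * e}"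
      by (intro nn_integral_cmult_indicator) (auto intro!: borel_closed closed_Collect_le continuous_intros)
    also have "\<dots> \<le> ennreal (2 * N * B / e) * ennreal (4 * pi * (L + 1) * (8 * e))"
      using e by (intro mult_left_mono neighbourhood_measure) auto
    also have "\<dots> = ennreal C"
      using e N B(1) L_nonneg by (subst ennreal_mult[symmetric]) (auto simp: C_def)
    finally show ?thesis using C by (subst (asm) ennreal_le_iff) auto
  qed
  then show thesis using that[OF C] by blast
qed

end

section \<open>Comparing the distributional derivative with C^1 approximations\<close>

locale green_data = bumped_loop g v \<beta> \<beta>' for g v \<beta> \<beta>' +
  fixes f h :: "complex \<Rightarrow> complex"
  assumes f_cont: "continuous_on (D \<union> trace) f"
    and h_L2: "in_L2_on h D"
    and h_dbar: "has_distributional_dbar_on f h D"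
begin

text \<open>Extension by zero replaces integrals over \<open>D\<close> by integrals over the plane.
  \<open>h0\<close> is known only to be Lebesgue measurable, so its integrals stay over
  \<open>lebesgue\<close>, while those of Borel functions are taken over
  \<open>lborel\<close>.\<close>

definition f0 :: "complex \<Rightarrow> complex" where "f0 z = indicator D z *\<^sub>R f z"
definition h0 :: "complex \<Rightarrow> complex" where "h0 z = indicator D z *\<^sub>R h z"

lemma h0_measurable [measurable]: "h0 \<in> borel_measurable lebesgue"
  using h_L2 by (simp add: in_L2_on_def set_borel_measurable_def h0_def[abs_def])

lemma h0_square: "integrable lebesgue (\<lambda>z. (norm (h0 z))\<^sup>2)"
proof -
  have "(norm (h0 z))\<^sup>2 = indicator D z *\<^sub>R (norm (h z))\<^sup>2" for z by (simp add: h0_def indicator_def)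
  then show ?thesis using h_L2 by (simp add: in_L2_on_def set_integrable_def)
qed

lemma f0_measurable [measurable]: "f0 \<in> borel_measurable borel"
  unfolding f0_def[abs_def] using open_D f_cont
  by (intro borel_measurable_continuous_on_indicator) (auto elim: continuous_on_subset)

lemma f0_bounded: obtains K where "\<And>z. norm (f0 z) \<le> K"
proof -
  obtain K where "\<And>z. z \<in> D \<union> trace \<Longrightarrow> norm (f z) \<le> K"
    using compact_imp_bounded[OF compact_continuous_image[OF f_cont compact_D_trace]] unfolding bounded_iff by blast
  then have "norm (f0 z) \<le> max K 0" for z by (cases "z \<in> D") (auto simp: f0_def le_max_iff_disj)
  then show thesis by (rule that)
qed

lemma lebesgue_lborel:
  fixes u :: "complex \<Rightarrow> complex"
  assumes "u \<in> borel_measurable borel"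
  shows "integrable lebesgue u \<longleftrightarrow> integrable lborel u" "(LINT z|lebesgue. u z) = (LINT z|lborel. u z)"
  using integrable_completion[of u lborel] integral_completion[of u lborel] assms by simp_all

text \<open>Domination by the index puts \<open>u\<close> in L^2, and the product of two L^2
  functions is integrable.\<close>

lemma h0_mult_integrable:
  fixes u :: "complex \<Rightarrow> complex"
  assumes u: "u \<in> borel_measurable borel" and le: "\<And>z. norm (u z) \<le> K * \<bar>wind z\<bar>"
  shows "integrable lebesgue (\<lambda>z. h0 z * u z)"
proof (rule integrable_square_mult)
  show [measurable]: "u \<in> borel_measurable lebesgue" using u by (intro measurable_completion) simp
  have "integrable lborel (\<lambda>z. (norm (u z))\<^sup>2)"
  proof (rule Bochner_Integration.integrable_bound)
    show "integrable lborel (\<lambda>z. K\<^sup>2 * (wind z)\<^sup>2)" using wind_square_integrable by simp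
    have "(norm (u z))\<^sup>2 \<le> K\<^sup>2 * (wind z)\<^sup>2" for z
      using power_mono[OF le[of z], of 2] by (simp add: power_mult_distrib)
    then show "AE z in lborel. norm ((norm (u z))\<^sup>2) \<le> norm (K\<^sup>2 * (wind z)\<^sup>2)" by simp
    show "(\<lambda>z. (norm (u z))\<^sup>2) \<in> borel_measurable lborel" using u by measurable
  qed
  then show "integrable lebesgue (\<lambda>z. (norm (u z))\<^sup>2)"
    using u by (subst integrable_completion) auto
qed (auto intro: h0_square)

text \<open>The definition of the distributional derivative, tested on a single bump and written
  with the zero extensions.\<close>

lemma bump_identity:
  assumes e: "e > 0" and j: "cell e j \<subseteq> D"
  shows "integrable lebesgue (\<lambda>z. h0 z * \<phi> e j z)"
    and "integrable lborel (\<lambda>z. f0 z * (\<phi>x e j z + \<i> * \<phi>y e j z))"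
    and "(LINT z|lebesgue. h0 z * \<phi> e j z) = - (1 / 2 * (LINT z|lborel. f0 z * (\<phi>x e j z + \<i> * \<phi>y e j z)))"
proof -
  note C = C1c_\<phi>[OF e, of j]
  note [measurable] = C1c_measurable[OF C]
  show "integrable lebesgue (\<lambda>z. h0 z * \<phi> e j z)"
  proof (rule integrable_square_mult)
    show "\<phi> e j \<in> borel_measurable lebesgue" by (intro measurable_completion) simp
    obtain M where M: "\<And>z. norm (\<phi> e j z) \<le> M" using C1c_bounds[OF C] by metis
    have "integrable lborel (\<lambda>z. \<phi> e j z * \<phi> e j z)" using C M by (intro C1c_integrable_mult(1)[OF C]) auto
    then have "integrable lborel (\<lambda>z. norm (\<phi> e j z * \<phi> e j z))" by (rule integrable_norm)
    then have "integrable lborel (\<lambda>z. (norm (\<phi> e j z))\<^sup>2)" by (simp add: norm_mult power2_eq_square)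
    then show "integrable lebesgue (\<lambda>z. (norm (\<phi> e j z))\<^sup>2)" by (subst integrable_completion) auto
  qed (auto intro: h0_square)
  obtain K where K: "\<And>z. norm (f0 z) \<le> K" using f0_bounded by blast
  have i: "integrable lborel (\<lambda>z. \<phi>x e j z * f0 z)" "integrable lborel (\<lambda>z. \<phi>y e j z * f0 z)"
    by (intro C1c_integrable_mult[OF C _ K]; measurable)+
  then show "integrable lborel (\<lambda>z. f0 z * (\<phi>x e j z + \<i> * \<phi>y e j z))"
    by (simp add: distrib_left mult.commute mult.left_commute)
  have "(LINT z:D|lebesgue. h z * \<phi> e j z) = - (LINT z:D|lebesgue. f z * dbar (\<phi> e j) z)"
    using h_dbar test_function_\<phi>[OF e j] unfolding has_distributional_dbar_on_def by blast
  moreover have "(LINT z:D|lebesgue. h z * \<phi> e j z) = (LINT z|lebesgue. h0 z * \<phi> e j z)"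
    unfolding set_lebesgue_integral_def h0_def by simp
  moreover have "(LINT z:D|lebesgue. f z * dbar (\<phi> e j) z) = (LINT z|lebesgue. 1 / 2 * (f0 z * (\<phi>x e j z + \<i> * \<phi>y e j z)))"
    unfolding set_lebesgue_integral_def f0_def by (intro Bochner_Integration.integral_cong) (auto simp: C1c_dbar[OF C])
  moreover have "(LINT z|lebesgue. 1 / 2 * (f0 z * (\<phi>x e j z + \<i> * \<phi>y e j z))) = 1 / 2 * (LINT z|lborel. f0 z * (\<phi>x e j z + \<i> * \<phi>y e j z))"
    by (subst lebesgue_lborel(2)) simp_all
  ultimately show "(LINT z|lebesgue. h0 z * \<phi> e j z) = - (1 / 2 * (LINT z|lborel. f0 z * (\<phi>x e j z + \<i> * \<phi>y e j z)))"
    by simp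
qed

lemma cut_identity:
  assumes e: "e > 0" and N: "N \<ge> 0"
  shows "(LINT z|lebesgue. h0 z * cut N e M z) = - (1 / 2 * (LINT z|lborel. f0 z * (cutx N e M z + \<i> * cuty N e M z)))"
proof -
  let ?a = "coeff N e"
  \<comment> \<open>Only bumps with nonzero coefficient are known to be supported in
    \<open>D\<close>, so the sums are restricted to them before the identity is used.\<close>
  define J where "J = {j \<in> grid M. ?a j \<noteq> 0}"
  have J: "finite J" "\<And>j. j \<in> J \<Longrightarrow> cell e j \<subseteq> D"
    using coeff_nonzero_cell[OF e N] finite_grid by (auto simp: J_def)
  have sums: "cut N e M z = (\<Sum>j\<in>J. ?a j * \<phi> e j z)" "cutx N e M z = (\<Sum>j\<in>J. ?a j * \<phi>x e j z)" "cuty N e M z = (\<Sum>j\<in>J. ?a j * \<phi>y e j z)" for z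
    unfolding cut_def cutx_def cuty_def J_def by (intro sum.mono_neutral_right finite_grid; auto)+
  have "(LINT z|lebesgue. h0 z * cut N e M z) = (LINT z|lebesgue. (\<Sum>j\<in>J. ?a j * (h0 z * \<phi> e j z)))"
    by (simp add: sums sum_distrib_left mult.left_commute)
  also have "\<dots> = (\<Sum>j\<in>J. ?a j * (LINT z|lebesgue. h0 z * \<phi> e j z))"
    using bump_identity(1)[OF e J(2)] by (subst Bochner_Integration.integral_sum) auto
  also have "\<dots> = - (1 / 2 * (\<Sum>j\<in>J. ?a j * (LINT z|lborel. f0 z * (\<phi>x e j z + \<i> * \<phi>y e j z))))"
    using bump_identity(3)[OF e J(2)] by (simp add: sum_negf sum_divide_distrib)
  also have "(\<Sum>j\<in>J. ?a j * (LINT z|lborel. f0 z * (\<phi>x e j z + \<i> * \<phi>y e j z))) =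
     (LINT z|lborel. (\<Sum>j\<in>J. ?a j * (f0 z * (\<phi>x e j z + \<i> * \<phi>y e j z))))"
    using bump_identity(2)[OF e J(2)] by (subst Bochner_Integration.integral_sum) auto
  also have "\<dots> = (LINT z|lborel. f0 z * (cutx N e M z + \<i> * cuty N e M z))"
    by (intro Bochner_Integration.integral_cong refl)
      (simp add: sums sum_distrib_left sum.distrib[symmetric] algebra_simps)
  finally show ?thesis .
qed

text \<open>Hence \<open>F\<close> and \<open>f\<close> need to be compared on \<open>D\<close>
  only, where \<open>f0\<close> equals \<open>f\<close>.\<close>

lemma cut_gradient_outside:
  assumes e: "e > 0" and N: "N \<ge> 0" and z: "z \<notin> D"
  shows "cutx N e M z = 0" "cuty N e M z = 0"
proof -
  have "coeff N e j * \<phi>x e j z = 0" "coeff N e j * \<phi>y e j z = 0" for j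
    using coeff_nonzero_cell[OF e N, of j] z support_cell[OF e, of z j] by auto
  then show "cutx N e M z = 0" "cuty N e M z = 0" unfolding cutx_def cuty_def by (intro sum.neutral ballI; blast)+
qed

abbreviation h_integral :: "(complex \<Rightarrow> complex) \<Rightarrow> complex" where
  "h_integral u \<equiv> LINT z|lebesgue. h0 z * u z"

abbreviation dbar_integral :: "(complex \<Rightarrow> complex) \<Rightarrow> (complex \<Rightarrow> complex) \<Rightarrow> complex" where
  "dbar_integral F u \<equiv> LINT z|lborel. dbar F z * u z"

abbreviation truncated_wind :: "real \<Rightarrow> complex \<Rightarrow> complex" where
  "truncated_wind N \<equiv> \<lambda>z. of_real (truncate N (wind z))"

lemma dbar_bounded:
  assumes F: "C1c F Fx Fy"
  obtains K where "\<And>z. norm (dbar F z) \<le> K"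
proof -
  obtain K where K: "\<And>z. norm (Fx z) \<le> K" "\<And>z. norm (Fy z) \<le> K" using C1c_bounds[OF F] by metis
  have "norm (dbar F z) \<le> K" for z
    using norm_triangle_ineq[of "Fx z" "\<i> * Fy z"] K[of z] by (simp add: C1c_dbar[OF F] norm_mult norm_divide)
  then show thesis by (rule that)
qed

lemma dbar_measurable:
  assumes F: "C1c F Fx Fy"
  shows "dbar F \<in> borel_measurable borel"
proof -
  note [measurable] = C1c_measurable[OF F]
  have "dbar F = (\<lambda>z. 1 / 2 * (Fx z + \<i> * Fy z))" by (simp add: fun_eq_iff C1c_dbar[OF F])
  then show ?thesis by simp
qed

lemma dbar_mult_integrable:
  fixes u :: "complex \<Rightarrow> complex"
  assumes F: "C1c F Fx Fy" and [measurable]: "u \<in> borel_measurable borel" and le: "\<And>z. norm (u z) \<le> \<bar>wind z\<bar>"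
  shows "integrable lborel (\<lambda>z. dbar F z * u z)"
proof -
  note [measurable] = dbar_measurable[OF F]
  obtain K where K: "\<And>z. norm (dbar F z) \<le> K" using dbar_bounded[OF F] by blast
  have K0: "K \<ge> 0" using K[of 0] norm_ge_zero order_trans by blast
  show ?thesis
  proof (rule Bochner_Integration.integrable_bound)
    show "integrable lborel (\<lambda>z. K * wind z)" using wind_integrable by simp
    have "norm (dbar F z * u z) \<le> norm (K * wind z)" for z
      unfolding norm_mult using K[of z] le[of z] K0 by (auto intro!: mult_mono)
    then show "AE z in lborel. norm (dbar F z * u z) \<le> norm (K * wind z)" by simp
  qed measurable
qed

text \<open>The derivative is moved onto the cutoff on both sides, by the distributional identity
  for \<open>f\<close> and by integration by parts for \<open>F\<close>. What remains is half the
  integral of \<open>F - f0\<close> against the gradient of the cutoff.\<close>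

lemma cut_estimate:
  assumes F: "C1c F Fx Fy" and k: "\<And>z. z \<in> D \<Longrightarrow> norm (F z - f z) \<le> k" "k \<ge> 0" and e: "e > 0" and N: "N \<ge> 0"
    and C: "(LINT z|lborel. norm (cutx N e M z + \<i> * cuty N e M z)) \<le> C"
  shows "norm (h_integral (cut N e M) - dbar_integral F (cut N e M)) \<le> k * C"
proof -
  let ?d = "\<lambda>z. cutx N e M z + \<i> * cuty N e M z"
  note cc = C1c_cut[OF e, of N M]
  note [measurable] = C1c_measurable[OF F] C1c_measurable[OF cc]
  obtain K where K: "\<And>z. norm (f0 z) \<le> K" using f0_bounded by blast
  obtain K' where K': "\<And>z. norm (F z) \<le> K'" using C1c_bounds[OF F] by metis
  have i: "integrable lborel (\<lambda>z. f0 z * ?d z)" "integrable lborel (\<lambda>z. F z * ?d z)" "integrable lborel ?d"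
  proof -
    have "integrable lborel (\<lambda>z. cutx N e M z * f0 z)" "integrable lborel (\<lambda>z. cuty N e M z * f0 z)"
      by (intro C1c_integrable_mult[OF cc _ K]; measurable)+
    then show "integrable lborel (\<lambda>z. f0 z * ?d z)" by (simp add: distrib_left mult.commute mult.left_commute)
    have "integrable lborel (\<lambda>z. cutx N e M z * F z)" "integrable lborel (\<lambda>z. cuty N e M z * F z)"
      by (intro C1c_integrable_mult[OF cc _ K']; measurable)+
    then show "integrable lborel (\<lambda>z. F z * ?d z)" by (simp add: distrib_left mult.commute mult.left_commute)
    show "integrable lborel ?d"
      using C1c_integrable_mult(2,3)[OF cc, of "\<lambda>z. 1" 1] by simp
  qed
  have "dbar_integral F (cut N e M) = 1 / 2 * (LINT z|lborel. (Fx z + \<i> * Fy z) * cut N e M z)"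
    unfolding C1c_dbar[OF F] by (simp add: mult.assoc)
  also have "\<dots> = - (1 / 2 * (LINT z|lborel. F z * ?d z))"
    unfolding integration_by_parts[OF F cc] by simp
  finally have "h_integral (cut N e M) - dbar_integral F (cut N e M) =
     1 / 2 * (LINT z|lborel. (F z - f0 z) * ?d z)"
    using i by (simp add: cut_identity[OF e N] left_diff_distrib right_diff_distrib)
  moreover have "norm (LINT z|lborel. (F z - f0 z) * ?d z) \<le> k * C"
  proof -
    have "norm (LINT z|lborel. (F z - f0 z) * ?d z) \<le> (LINT z|lborel. norm ((F z - f0 z) * ?d z))"
      by (rule integral_norm_bound)
    also have "\<dots> \<le> (LINT z|lborel. k * norm (?d z))"
    proof (rule integral_mono)
      show "integrable lborel (\<lambda>z. norm ((F z - f0 z) * ?d z))"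
        using i by (intro integrable_norm) (simp add: left_diff_distrib)
      show "integrable lborel (\<lambda>z. k * norm (?d z))" using i by simp
      show "norm ((F z - f0 z) * ?d z) \<le> k * norm (?d z)" for z
        using k(1)[of z] cut_gradient_outside[OF e N, of z M]
        by (cases "z \<in> D") (auto simp: norm_mult f0_def intro!: mult_right_mono)
    qed
    also have "\<dots> = k * (LINT z|lborel. norm (?d z))" by simp
    also have "\<dots> \<le> k * C" by (intro mult_left_mono C k)
    finally show ?thesis .
  qed
  moreover have "norm (1 / 2 * X) \<le> norm X" for X :: complex by (simp add: norm_mult norm_divide)
  ultimately show ?thesis by (simp only:) (rule order_trans)
qed

text \<open>Dominated convergence with \<open>h0\<close> times the index; the curve, where nothing
  is assumed about the limit, is null.\<close>

lemma h0_tendsto: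
  fixes u :: "nat \<Rightarrow> complex \<Rightarrow> complex"
  assumes u: "\<And>n. u n \<in> borel_measurable borel" "w \<in> borel_measurable borel"
    and le: "\<And>n z. norm (u n z) \<le> \<bar>wind z\<bar>" and lim: "\<And>z. z \<notin> trace \<Longrightarrow> (\<lambda>n. u n z) \<longlonglongrightarrow> w z"
  shows "(\<lambda>n. LINT z|lebesgue. h0 z * u n z) \<longlonglongrightarrow> h_integral w"
proof (rule integral_dominated_convergence[where w = "\<lambda>z. norm (h0 z * of_real (wind z))"])
  have [measurable]: "u n \<in> borel_measurable lebesgue" "w \<in> borel_measurable lebesgue" for n
    using u by (auto intro: measurable_completion)
  show "(\<lambda>z. h0 z * w z) \<in> borel_measurable lebesgue" "(\<lambda>z. h0 z * u n z) \<in> borel_measurable lebesgue" for n by measurable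
  show "integrable lebesgue (\<lambda>z. norm (h0 z * of_real (wind z)))"
    by (intro integrable_norm h0_mult_integrable[of _ 1]) auto
  have "AE z in lebesgue. z \<notin> trace" using AE_not_trace by (rule AE_completion)
  then show "AE z in lebesgue. (\<lambda>n. h0 z * u n z) \<longlonglongrightarrow> h0 z * w z"
    by eventually_elim (intro tendsto_intros lim)
  show "AE z in lebesgue. norm (h0 z * u n z) \<le> norm (h0 z * of_real (wind z))" for n
    using le by (auto simp: norm_mult intro!: mult_left_mono)
qed

lemma dbar_tendsto:
  fixes u :: "nat \<Rightarrow> complex \<Rightarrow> complex"
  assumes F: "C1c F Fx Fy" and [measurable]: "\<And>n. u n \<in> borel_measurable borel" "w \<in> borel_measurable borel"
    and le: "\<And>n z. norm (u n z) \<le> \<bar>wind z\<bar>" and lim: "\<And>z. z \<notin> trace \<Longrightarrow> (\<lambda>n. u n z) \<longlonglongrightarrow> w z"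
  shows "(\<lambda>n. LINT z|lborel. dbar F z * u n z) \<longlonglongrightarrow> dbar_integral F w"
proof (rule integral_dominated_convergence[where w = "\<lambda>z. norm (dbar F z * of_real (wind z))"])
  note [measurable] = dbar_measurable[OF F]
  show "(\<lambda>z. dbar F z * w z) \<in> borel_measurable lborel" "(\<lambda>z. dbar F z * u n z) \<in> borel_measurable lborel" for n by measurable
  show "integrable lborel (\<lambda>z. norm (dbar F z * of_real (wind z)))"
    by (intro integrable_norm dbar_mult_integrable[OF F]) auto
  show "AE z in lborel. (\<lambda>n. dbar F z * u n z) \<longlonglongrightarrow> dbar F z * w z"
    using AE_not_trace by eventually_elim (intro tendsto_intros lim)
  show "AE z in lborel. norm (dbar F z * u n z) \<le> norm (dbar F z * of_real (wind z))" for n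
    using le by (auto simp: norm_mult intro!: mult_left_mono)
qed

lemma truncated_wind_measurable: "truncated_wind N \<in> borel_measurable borel"
  by measurable

text \<open>The limit of \<open>cut_estimate\<close> as the scale tends to 0. The order of
  quantifiers matters: \<open>C\<close> depends on \<open>N\<close> but serves all \<open>F\<close>
  and \<open>k\<close> at once, which later allows \<open>k\<close> to shrink for fixed
  \<open>N\<close>.\<close>

lemma truncated_estimate:
  assumes N: "N > 0"
  obtains C where "C > 0" "\<And>F Fx Fy k. C1c F Fx Fy \<Longrightarrow> (\<And>z. z \<in> D \<Longrightarrow> norm (F z - f z) \<le> k) \<Longrightarrow> k \<ge> 0 \<Longrightarrow>
     norm (h_integral (truncated_wind N) - dbar_integral F (truncated_wind N)) \<le> k * C"
proof -
  obtain R where R: "R > 0" "\<And>z. norm z > R \<Longrightarrow> z \<notin> trace \<and> index z = 0" using bounded_index by metis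
  obtain C where C: "C > 0" "\<And>e M. 0 < e \<Longrightarrow> 8 * e \<le> 1 \<Longrightarrow>
     (\<exists>R. (\<forall>z. norm z > R \<longrightarrow> z \<notin> trace \<and> index z = 0) \<and> R < e * real M) \<Longrightarrow>
     (LINT z|lborel. norm (cutx N e M z + \<i> * cuty N e M z)) \<le> C"
    using cut_gradient_bound[OF N] by blast
  \<comment> \<open>The scale tends to 0 with \<open>8 * e n \<le> 1\<close>; \<open>M n\<close>
    below is chosen so that the grid covers the ball outside which the index vanishes.\<close>
  define e where "e n = 1 / (8 * real (Suc n))" for n
  define M where "M n = nat \<lceil>R / e n\<rceil> + 1" for n
  have e: "e n > 0" "8 * e n \<le> 1" for n by (auto simp: e_def)
  have RM: "R < e n * real (M n)" for n
  proof -
    have "R / e n < real (M n)" using R(1) e[of n] by (simp add: M_def of_nat_nat) linarith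
    then show ?thesis using e[of n] by (simp add: field_simps)
  qed
  have Cn: "(LINT z|lborel. norm (cutx N (e n) (M n) z + \<i> * cuty N (e n) (M n) z)) \<le> C" for n
  proof (rule C(2)[OF e])
    show "\<exists>R. (\<forall>z. norm z > R \<longrightarrow> z \<notin> trace \<and> index z = 0) \<and> R < e n * real (M n)" using R(2) RM by blast
  qed
  define u where "u n = cut N (e n) (M n)" for n
  have um: "u n \<in> borel_measurable borel" for n
    unfolding u_def by (rule C1c_measurable(1)[OF C1c_cut[OF e(1)]])
  have ub: "norm (u n z) \<le> \<bar>wind z\<bar>" for n z unfolding u_def using cut_bound[OF e(1)] N by simp
  have ulim: "(\<lambda>n. u n z) \<longlonglongrightarrow> of_real (truncate N (wind z))" if z: "z \<notin> trace" for z
  proof -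
    have "infdist z trace > 0" using z closed_trace trace_nonempty
      by (metis in_closed_iff_infdist_zero infdist_nonneg less_eq_real_def)
    moreover have "(\<lambda>n. 8 * e n) \<longlonglongrightarrow> 0" unfolding e_def by real_asymp
    ultimately have "\<forall>\<^sub>F n in sequentially. 8 * e n < infdist z trace" by (rule order_tendstoD(2)[rotated])
    then have "\<forall>\<^sub>F n in sequentially. of_real (truncate N (wind z)) = u n z"
      by eventually_elim (simp add: u_def cut_away(1)[OF e(1) less_imp_le[OF N] _ R(2) RM])
    then show ?thesis by (rule Lim_transform_eventually[OF tendsto_const])
  qed
  show thesis
  proof (rule that[OF C(1)])
    fix F Fx Fy and k :: real
    assume F: "C1c F Fx Fy" and k: "\<And>z. z \<in> D \<Longrightarrow> norm (F z - f z) \<le> k" "k \<ge> 0"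
    have "norm (h_integral (u n) - dbar_integral F (u n)) \<le> k * C" for n
      unfolding u_def by (rule cut_estimate[OF F k e(1) less_imp_le[OF N] Cn])
    then show "norm (h_integral (truncated_wind N) - dbar_integral F (truncated_wind N)) \<le> k * C"
      by (intro tendsto_upperbound[OF tendsto_norm[OF tendsto_diff[OF h0_tendsto[OF um truncated_wind_measurable ub ulim] dbar_tendsto[OF F um truncated_wind_measurable ub ulim]]]]) auto
  qed
qed

text \<open>The constant in the estimate above depends on the truncation level, but comparing with ever
  better approximations of \<open>f\<close> replaces it by the length of the curve.\<close>

lemma uniform_truncated_estimate:
  assumes N: "N > 0" and f': "continuous_on UNIV f'" "\<And>z. norm z > R \<Longrightarrow> f' z = 0" "\<And>z. z \<in> D \<Longrightarrow> f' z = f z"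
    and F: "C1c F Fx Fy" and k: "\<And>z. norm (F z - f' z) \<le> k"
  shows "norm (h_integral (truncated_wind N) - dbar_integral F (truncated_wind N)) \<le> k * L"
proof (rule field_le_epsilon)
  fix \<epsilon> :: real assume \<epsilon>: "\<epsilon> > 0"
  obtain C where C: "C > 0" "\<And>F Fx Fy k. C1c F Fx Fy \<Longrightarrow> (\<And>z. z \<in> D \<Longrightarrow> norm (F z - f z) \<le> k) \<Longrightarrow> k \<ge> 0 \<Longrightarrow>
     norm (h_integral (truncated_wind N) - dbar_integral F (truncated_wind N)) \<le> k * C"
    using truncated_estimate[OF N] by blast
  \<comment> \<open>\<open>d * C\<close> is the error for the better approximation \<open>G\<close>,
    and \<open>d * L\<close> its share in the comparison of \<open>G\<close> with \<open>F\<close>;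
    together they make \<open>\<epsilon>\<close>.\<close>
  define d where "d = \<epsilon> / (C + L)"
  have d: "d > 0" "d * C + d * L = \<epsilon>"
  proof -
    have "C + L > 0" using C(1) L_nonneg by linarith
    then show "d > 0" "d * C + d * L = \<epsilon>" using \<epsilon> by (simp_all only: d_def distrib_left[symmetric]) simp_all
  qed
  obtain G Gx Gy where G: "C1c G Gx Gy" "\<And>z. norm (G z - f' z) \<le> d" using C1c_approximation[OF f'(1,2) d(1)] by blast
  let ?w = "truncated_wind N"
  have w: "norm (?w z) \<le> \<bar>wind z\<bar>" for z using truncate_le[of N "wind z"] N by simp
  have 1: "norm (h_integral ?w - dbar_integral G ?w) \<le> d * C"
    using G(2) f'(3) d(1) by (intro C(2)[OF G(1)]) (metis, simp)
  have H: "C1c (\<lambda>z. G z + -1 * F z) (\<lambda>z. Gx z + -1 * Fx z) (\<lambda>z. Gy z + -1 * Fy z)"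
    by (intro C1c_add G C1c_cmult F)
  \<comment> \<open>\<open>truncated_index_bound\<close> takes a supremum over the plane, so
    closeness to the extension \<open>f'\<close> everywhere is used here, not only closeness to
    \<open>f\<close> on \<open>D\<close>.\<close>
  have Hb: "norm (G z + -1 * F z) \<le> d + k" for z
    using norm_triangle_ineq4[of "G z - f' z" "F z - f' z"] G(2)[of z] k[of z] by simp
  \<comment> \<open>The 2 on the left comes from \<open>\<i> * Hx - Hy = 2 * \<i> * dbar H\<close>
    and cancels the 2 of \<open>truncated_index_bound\<close>.\<close>
  have "2 * norm (dbar_integral G ?w - dbar_integral F ?w) \<le> 2 * (d + k) * L"
  proof -
    have "(LINT z|lborel. (\<i> * (Gx z + -1 * Fx z) - (Gy z + -1 * Fy z)) * ?w z) =
       (LINT z|lborel. 2 * \<i> * (dbar G z * ?w z - dbar F z * ?w z))"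
      by (intro Bochner_Integration.integral_cong refl) (simp add: C1c_dbar[OF F] C1c_dbar[OF G(1)] algebra_simps)
    also have "\<dots> = 2 * \<i> * (dbar_integral G ?w - dbar_integral F ?w)"
      using dbar_mult_integrable[OF F truncated_wind_measurable w] dbar_mult_integrable[OF G(1) truncated_wind_measurable w]
      by simp
    finally show ?thesis using truncated_index_bound[OF H Hb N] by (simp add: norm_mult)
  qed
  then have 2: "norm (dbar_integral G ?w - dbar_integral F ?w) \<le> d * L + k * L"
    by (simp add: algebra_simps)
  show "norm (h_integral ?w - dbar_integral F ?w) \<le> k * L + \<epsilon>"
    using norm_triangle_ineq[of "h_integral ?w - dbar_integral G ?w" "dbar_integral G ?w - dbar_integral F ?w"] 1 2 d(2)
    by simp
qed

text \<open>For a C^1 function within \<open>k\<close> of \<open>f\<close>, the formula is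
  \<open>green\<close>. Replacing it by \<open>f\<close> changes the area side by at most
  \<open>2 * k * L\<close>, after \<open>N\<close> tends to infinity in the uniform estimate, and
  the curve integral by at most \<open>k * L\<close>.\<close>

lemma cauchy_green:
  assumes I: "has_RS_integral (\<lambda>t. f (g t)) g 0 1 I"
  shows "I = 2 * \<i> * h_integral (\<lambda>z. of_real (wind z))"
proof -
  obtain f' R where f': "continuous_on UNIV f'" "\<And>z. z \<in> D \<union> trace \<Longrightarrow> f' z = f z" "\<And>z. norm z > R \<Longrightarrow> f' z = 0"
    using compactly_supported_extension[OF compact_D_trace f_cont] by metis
  define X where "X = h_integral (\<lambda>z. of_real (wind z))"
  have est: "norm (2 * \<i> * X - I) \<le> k * (3 * L)" if k: "k > 0" for k
  proof -
    obtain F Fx Fy where F: "C1c F Fx Fy" "\<And>z. norm (F z - f' z) \<le> k" using C1c_approximation[OF f'(1,3) k] by blast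
    let ?u = "\<lambda>n. truncated_wind (real (Suc n))"
    have ub: "norm (?u n z) \<le> \<bar>wind z\<bar>" for n z using truncate_le[of "real (Suc n)" "wind z"] by simp
    \<comment> \<open>At each point the truncations are eventually equal to the index, so the
      convergence holds everywhere.\<close>
    have ulim: "(\<lambda>n. ?u n z) \<longlonglongrightarrow> of_real (wind z)" for z
    proof (rule Lim_transform_eventually[OF tendsto_const])
      obtain n0 :: nat where n0: "\<bar>wind z\<bar> \<le> real n0" using real_arch_simple by blast
      show "\<forall>\<^sub>F n in sequentially. of_real (wind z) = ?u n z"
        using eventually_ge_at_top[of n0]
      proof eventually_elim
        fix n assume "n0 \<le> n"
        then have "\<bar>wind z\<bar> \<le> real (Suc n)" using n0 by linarith
        then show "of_real (wind z) = ?u n z" by (simp only: truncate_eq)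
      qed
    qed
    have wm: "(\<lambda>z. of_real (wind z) :: complex) \<in> borel_measurable borel" by measurable
    have "norm (X - dbar_integral F (\<lambda>z. of_real (wind z))) \<le> k * L"
      unfolding X_def
    proof (rule tendsto_upperbound[OF tendsto_norm[OF tendsto_diff[OF h0_tendsto[OF truncated_wind_measurable wm ub ulim] dbar_tendsto[OF F(1) truncated_wind_measurable wm ub ulim]]]])
      have "norm (h_integral (?u n) - dbar_integral F (?u n)) \<le> k * L" for n
        using f' by (intro uniform_truncated_estimate[OF _ f'(1,3) _ F]) auto
      then show "\<forall>\<^sub>F n in sequentially. norm (h_integral (?u n) - dbar_integral F (?u n)) \<le> k * L"
        by simp
    qed simp
    then have 1: "norm (2 * \<i> * X - 2 * \<i> * dbar_integral F (\<lambda>z. of_real (wind z))) \<le> 2 * (k * L)"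
      by (simp add: norm_mult flip: right_diff_distrib)
    have "continuous_on {0..1} (\<lambda>t. F (g t))"
      by (rule continuous_on_compose2[OF C1c_continuous(1)[OF F(1)] cont]) simp
    then obtain J where J: "has_RS_integral (\<lambda>t. F (g t)) g 0 1 J" using has_RS_integral_exists[OF dominated] by blast
    have "2 * \<i> * dbar_integral F (\<lambda>z. of_real (wind z)) = (LINT z|lborel. 2 * \<i> * (dbar F z * of_real (wind z)))"
      by simp
    also have "\<dots> = (LINT z|lborel. (\<i> * Fx z - Fy z) * of_real (wind z))"
      by (intro Bochner_Integration.integral_cong refl) (simp add: C1c_dbar[OF F(1)] algebra_simps)
    also have "\<dots> = J" by (rule green[OF F(1) J])
    finally have 2: "2 * \<i> * dbar_integral F (\<lambda>z. of_real (wind z)) = J" .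
    have 3: "norm (J - I) \<le> k * L"
      unfolding L_def
    proof (rule has_RS_integral_bound[OF has_RS_integral_diff[OF J I] dominated])
      fix t :: real assume "t \<in> {0..1}"
      then have "f' (g t) = f (g t)" by (intro f'(2)) (simp add: trace_def)
      then show "norm (F (g t) - f (g t)) \<le> k" using F(2)[of "g t"] by simp
    qed
    show ?thesis
      using norm_triangle_ineq[of "2 * \<i> * X - J" "J - I"] 1[unfolded 2] 3 by simp
  qed
  have "norm (2 * \<i> * X - I) \<le> 0"
  proof (rule field_le_epsilon)
    fix \<epsilon> :: real assume \<epsilon>: "\<epsilon> > 0"
    \<comment> \<open>The summand 1 keeps the denominator positive for a constant curve, where
      \<open>L\<close> may be 0.\<close>
    have "norm (2 * \<i> * X - I) \<le> \<epsilon> / (3 * L + 1) * (3 * L)" using L_nonneg \<epsilon> by (intro est) (simp add: add_nonneg_pos)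
    also have "\<dots> \<le> \<epsilon>" using L_nonneg \<epsilon> by (simp add: field_simps)
    finally show "norm (2 * \<i> * X - I) \<le> 0 + \<epsilon>" by simp
  qed
  then show ?thesis by (simp add: X_def)
qed

end

section \<open>From the parametrised loop back to the curve on the circle\<close>

lemma circle_param_image: "circle_param \<gamma> ` {0..1} = curve_image \<gamma>"
proof -
  have "(\<lambda>t. cis (2 * pi * t)) ` {0..1} = sphere 0 1"
  proof (intro equalityI subsetI)
    fix w :: complex assume "w \<in> sphere 0 1"
    then have w: "norm w = 1" by simp
    have "w = cis (2 * pi * (Arg2pi w / (2 * pi)))"
      using Arg2pi_eq[of w] w by (simp add: cis_conv_exp)
    moreover have "Arg2pi w / (2 * pi) \<in> {0..1}" using Arg2pi[of w] by (simp add: divide_le_eq)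
    ultimately show "w \<in> (\<lambda>t. cis (2 * pi * t)) ` {0..1}" by blast
  qed auto
  then show ?thesis unfolding circle_param_def[abs_def] curve_image_def
    by (metis (no_types) image_image)
qed

lemma rectifiable_loop_circle_param:
  assumes "closed_rectifiable_curve \<gamma>"
  obtains v where "rectifiable_loop (circle_param \<gamma>) v"
proof -
  obtain v where v: "variation_dominated (circle_param \<gamma>) v"
    using assms bounded_variation_imp_dominated unfolding closed_rectifiable_curve_def by blast
  have "continuous_on {0..1} (circle_param \<gamma>)"
    unfolding circle_param_def
  proof (rule continuous_on_compose2[of "sphere 0 1" \<gamma>])
    show "continuous_on (sphere 0 1) \<gamma>" using assms by (simp add: closed_rectifiable_curve_def)
    show "continuous_on {0..1} (\<lambda>t. cis (2 * pi * t))" by (intro continuous_intros)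
  qed auto
  moreover have "circle_param \<gamma> 0 = circle_param \<gamma> 1" by (simp add: circle_param_def)
  ultimately show thesis using v that by (simp add: rectifiable_loop_def)
qed

theorem mainTheorem1:
  fixes \<gamma> f g :: "complex \<Rightarrow> complex" and D :: "complex set"
  assumes "closed_rectifiable_curve \<gamma>"
    and "D = index_domain \<gamma>"
    and "continuous_on (D \<union> curve_image \<gamma>) f"
    and "in_L2_on g D"
    and "has_distributional_dbar_on f g D"
  shows "f curve_integrable_on \<gamma> \<and>
    set_integrable lebesgue D (\<lambda>z. g z * curve_index \<gamma> z) \<and>
    curve_integral \<gamma> f = 2 * \<i> * (LINT z:D|lebesgue. g z * curve_index \<gamma> z)"
proof -
  obtain v where "rectifiable_loop (circle_param \<gamma>) v" using rectifiable_loop_circle_param[OF assms(1)] .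
  moreover obtain \<beta> \<beta>' where "partition_bump \<beta> \<beta>'" using partition_bump_locale_exists by blast
  ultimately interpret loop: bumped_loop "circle_param \<gamma>" v \<beta> \<beta>' by (simp add: bumped_loop_def)
  have trace: "loop.trace = curve_image \<gamma>" by (simp add: loop.trace_def circle_param_image)
  have ind: "curve_index \<gamma> z = loop.index z" for z
    by (simp add: curve_index_def curve_integral_def has_curve_integral_def loop.index_def)
  have D_eq: "loop.D = D" by (simp add: loop.D_def assms(2) index_domain_def trace ind)
  interpret green_data "circle_param \<gamma>" v \<beta> \<beta>' f g
    using assms by unfold_locales (simp_all only: D_eq trace)
  have "continuous_on {0..1} (\<lambda>t. f (circle_param \<gamma> t))"
    by (rule continuous_on_compose2[OF f_cont loop.cont]) (auto simp: loop.trace_def)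
  then obtain I where I: "has_RS_integral (\<lambda>t. f (circle_param \<gamma> t)) (circle_param \<gamma>) 0 1 I"
    using has_RS_integral_exists[OF loop.dominated] by blast
  have "curve_integral \<gamma> f = I"
    unfolding curve_integral_def has_curve_integral_def by (rule the_equality, rule I, rule has_RS_integral_unique[OF _ I])
  moreover have "f curve_integrable_on \<gamma>"
    using I by (auto simp: curve_integrable_on_def has_curve_integral_def)
  \<comment> \<open>Off \<open>D\<close> the indicator makes both sides 0; on \<open>D\<close> the
    point is off the curve, and there \<open>wind\<close> is the index.\<close>
  moreover have pointwise: "indicator D z *\<^sub>R (g z * curve_index \<gamma> z) = h0 z * of_real (loop.wind z)" for z
    unfolding h0_def D_eq using loop.wind_index[of z] by (cases "z \<in> D") (auto simp: ind D_eq[symmetric] loop.D_def)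
  moreover have "integrable lebesgue (\<lambda>z. h0 z * of_real (loop.wind z))"
    by (rule h0_mult_integrable[of _ 1]) auto
  ultimately show ?thesis
    using cauchy_green[OF I] unfolding set_integrable_def set_lebesgue_integral_def by simp
qed

end
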